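(* Let $\Omega\subset\mathbb R^d$ be an open connected bounded domain with sufficiently smooth boundary. Suppose that $f$ satisfies: - $f\in C^2(\overline\Omega\times(0,\infty))\cap L^1_{\mathrm{loc}}(\overline\Omega\times[0,\infty))$; - $uf,\ uf_x\in C(\overline\Omega\times[0,\infty))$; - $f_u<0$; - $|f(x,u)|\le g_1(u)$ for a.a. $u>0$, with some $g_1\in L^1_{\mathrm{loc}}[0,\infty)$; - $u|f_u(x,u)|+u|f_{xu}(x,u)|\le g_2(u)$ for a.a. $u>0$, with some $g_2\in L^1_{\mathrm{loc}}[0,\infty)$; - $f(x,m(x))=0$ for all $x\in\overline\Omega$, where $m:\overline\Omega\to(0,\infty)$ is a $C^2$-smooth probability density; - $\lim_{u\to\infty}f(x,u)=-\infty$ uniformly with respect to $x$. Let $U\subset L^\infty(\Omega)$ be a set of probability densities such that for any $u\in U$ we have $\Phi(\cdot,u(\cdot))\in H^1(\Omega)$, and $\sup_{u\in U}\mathcal E(u)<\infty$. Then there exists $C_U$ such that $$\mathcal E(u)\le C_U\,D\mathcal E(u)\qquad\text{for all }u\in U.$$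
   Context: $f_x$ denotes the gradient of $f(x,u)$ in $x$. Notation: $\Phi(x,u)=-\int_0^u\xi f_u(x,\xi)\,d\xi$, $\Phi_x(x,u)=-\int_0^u\xi f_{xu}(x,\xi)\,d\xi$, $E(x,u)=-\int_{m(x)}^uf(x,\xi)\,d\xi$. Relative entropy: $\mathcal E(u)=\int_\Omega E(x,u(x))\,dx$. When $u$ is given, $f$, $\Phi$, $\Phi_x$, $uf_x$ stand for the superpositions with $u(x)$, $\nabla\Phi$ is the full gradient of $x\mapsto\Phi(x,u(x))$, and $\bar f=\int_\Omega uf\,dx$. Entropy production, for $u\in L^\infty_+(\Omega)$ (nonnegative, bounded) with $\Phi(\cdot,u(\cdot))\in H^1(\Omega)$: $$D\mathcal E(u)=\int_\Omega u(f-\bar f)^2\,dx+\int_{[u>0]}\frac1u|-\nabla\Phi+\Phi_x+uf_x|^2\,dx,$$ where the second integral may be infinite and the first integrand is understood as $0$ where $u=0$. *)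

theory Defs
  imports "HOL-Analysis.Analysis"
begin

definition extends_continuously ::
  "'a::topological_space set \<Rightarrow> 'a set \<Rightarrow> ('a \<Rightarrow> 'b::topological_space) \<Rightarrow> bool" where
  "extends_continuously S T f \<longleftrightarrow> (\<exists>g. continuous_on T g \<and> (\<forall>x\<in>S. g x = f x))"

(* Partial derivatives up to order k exist on the open set S and extend continuously to T.
   T = S gives C^k(S); S = \<Omega>, T = closure \<Omega> gives the usual C^k up to the boundary. *)
primrec Ck_ext :: "nat \<Rightarrow> 'a::euclidean_space set \<Rightarrow> 'a set \<Rightarrow> ('a \<Rightarrow> real) \<Rightarrow> bool" where
  "Ck_ext 0 S T f \<longleftrightarrow> extends_continuously S T f"
| "Ck_ext (Suc k) S T f \<longleftrightarrow> extends_continuously S T f \<and> (\<forall>x\<in>S. f differentiable (at x)) \<and>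
     (\<forall>b\<in>Basis. Ck_ext k S T (\<lambda>x. frechet_derivative f (at x) b))"

(* The conjunct continuous_on T f makes the values of f on T - S those of the extension. *)
definition Ck_closed :: "nat \<Rightarrow> 'a::euclidean_space set \<Rightarrow> 'a set \<Rightarrow> ('a \<Rightarrow> real) \<Rightarrow> bool" where
  "Ck_closed k S T f \<longleftrightarrow> continuous_on T f \<and> Ck_ext k S T f"

(* Near each boundary point, \<Omega> lies strictly above the graph of a C^k function \<gamma> over the
   hyperplane orthogonal to a unit vector n; \<gamma> is evaluated on that hyperplane only. *)
definition Ck_boundary :: "nat \<Rightarrow> 'a::euclidean_space set \<Rightarrow> bool" where
  "Ck_boundary k \<Omega> \<longleftrightarrow> (\<forall>p\<in>frontier \<Omega>. \<exists>r>0. \<exists>n \<gamma>. norm n = 1 \<and> Ck_ext k UNIV UNIV \<gamma> \<and>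
     \<Omega> \<inter> ball p r = {x \<in> ball p r. \<gamma> (x - (x \<bullet> n) *\<^sub>R n) < x \<bullet> n})"

definition L1_loc :: "'a::euclidean_space set \<Rightarrow> ('a \<Rightarrow> real) \<Rightarrow> bool" where
  "L1_loc S g \<longleftrightarrow> (\<forall>K. compact K \<and> K \<subseteq> S \<longrightarrow> set_integrable lebesgue K g)"

definition L2_on :: "'a::euclidean_space set \<Rightarrow> ('a \<Rightarrow> 'b::euclidean_space) \<Rightarrow> bool" where
  "L2_on \<Omega> v \<longleftrightarrow> v \<in> borel_measurable (lebesgue_on \<Omega>) \<and>
     integrable (lebesgue_on \<Omega>) (\<lambda>x. (norm (v x))\<^sup>2)"

definition Linf_on :: "'a::euclidean_space set \<Rightarrow> ('a \<Rightarrow> real) \<Rightarrow> bool" where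
  "Linf_on \<Omega> u \<longleftrightarrow> u \<in> borel_measurable (lebesgue_on \<Omega>) \<and>
     (\<exists>M. AE x in lebesgue_on \<Omega>. \<bar>u x\<bar> \<le> M)"

definition prob_density_on :: "'a::euclidean_space set \<Rightarrow> ('a \<Rightarrow> real) \<Rightarrow> bool" where
  "prob_density_on \<Omega> u \<longleftrightarrow> integrable (lebesgue_on \<Omega>) u \<and> (AE x in lebesgue_on \<Omega>. 0 \<le> u x) \<and>
     (LINT x|lebesgue_on \<Omega>. u x) = 1"

definition test_function :: "'a::euclidean_space set \<Rightarrow> ('a \<Rightarrow> real) \<Rightarrow> bool" where
  "test_function \<Omega> \<phi> \<longleftrightarrow> (\<forall>k. Ck_ext k UNIV UNIV \<phi>) \<and>
     compact (closure {x. \<phi> x \<noteq> 0}) \<and> closure {x. \<phi> x \<noteq> 0} \<subseteq> \<Omega>"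

definition L2_weak_gradient ::
  "'a::euclidean_space set \<Rightarrow> ('a \<Rightarrow> real) \<Rightarrow> ('a \<Rightarrow> 'a) \<Rightarrow> bool" where
  "L2_weak_gradient \<Omega> v G \<longleftrightarrow> L2_on \<Omega> G \<and>
     (\<forall>\<phi>. test_function \<Omega> \<phi> \<longrightarrow> (\<forall>b\<in>Basis.
        (LINT x|lebesgue_on \<Omega>. v x * frechet_derivative \<phi> (at x) b) =
        - (LINT x|lebesgue_on \<Omega>. (G x \<bullet> b) * \<phi> x)))"

definition H1_on :: "'a::euclidean_space set \<Rightarrow> ('a \<Rightarrow> real) \<Rightarrow> bool" where
  "H1_on \<Omega> v \<longleftrightarrow> L2_on \<Omega> v \<and> (\<exists>G. L2_weak_gradient \<Omega> v G)"

(* Unique up to null sets for v in H^1, so integrals do not depend on the choice. *)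
definition weak_grad :: "'a::euclidean_space set \<Rightarrow> ('a \<Rightarrow> real) \<Rightarrow> 'a \<Rightarrow> 'a" where
  "weak_grad \<Omega> v = (SOME G. L2_weak_gradient \<Omega> v G)"

definition grad :: "('a::euclidean_space \<Rightarrow> real) \<Rightarrow> 'a \<Rightarrow> 'a" where
  "grad g x = (\<Sum>b\<in>Basis. frechet_derivative g (at x) b *\<^sub>R b)"

definition f_u :: "('a::euclidean_space \<Rightarrow> real \<Rightarrow> real) \<Rightarrow> 'a \<Rightarrow> real \<Rightarrow> real" where
  "f_u f x u = deriv (f x) u"

(* Meaningful for x in the open domain only, as is f_xu; f_u also makes sense on its boundary. *)
definition f_x :: "('a::euclidean_space \<Rightarrow> real \<Rightarrow> real) \<Rightarrow> 'a \<Rightarrow> real \<Rightarrow> 'a" where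
  "f_x f x u = grad (\<lambda>y. f y u) x"

definition f_xu :: "('a::euclidean_space \<Rightarrow> real \<Rightarrow> real) \<Rightarrow> 'a \<Rightarrow> real \<Rightarrow> 'a" where
  "f_xu f x u = vector_derivative (f_x f x) (at u)"

definition Phi :: "('a::euclidean_space \<Rightarrow> real \<Rightarrow> real) \<Rightarrow> 'a \<Rightarrow> real \<Rightarrow> real" where
  "Phi f x u = - (LBINT \<xi>=0..ereal u. \<xi> * f_u f x \<xi>)"

definition Phi_x :: "('a::euclidean_space \<Rightarrow> real \<Rightarrow> real) \<Rightarrow> 'a \<Rightarrow> real \<Rightarrow> 'a" where
  "Phi_x f x u = - (LBINT \<xi>=0..ereal u. \<xi> *\<^sub>R f_xu f x \<xi>)"

(* The interval integral is oriented, as needed when u < m x. *)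
definition E_dens ::
  "('a::euclidean_space \<Rightarrow> real \<Rightarrow> real) \<Rightarrow> ('a \<Rightarrow> real) \<Rightarrow> 'a \<Rightarrow> real \<Rightarrow> real" where
  "E_dens f m x u = - (LBINT \<xi>=ereal (m x)..ereal u. f x \<xi>)"

definition rel_entropy :: "'a::euclidean_space set \<Rightarrow> ('a \<Rightarrow> real \<Rightarrow> real) \<Rightarrow> ('a \<Rightarrow> real) \<Rightarrow>
    ('a \<Rightarrow> real) \<Rightarrow> real" where
  "rel_entropy \<Omega> f m u = (LINT x|lebesgue_on \<Omega>. E_dens f m x (u x))"

(* f x 0 is unspecified; the product u x * f x (u x) vanishes where u x = 0, which agrees with
   the continuous extension of u f to u = 0. *)
definition f_bar :: "'a::euclidean_space set \<Rightarrow> ('a \<Rightarrow> real \<Rightarrow> real) \<Rightarrow> ('a \<Rightarrow> real) \<Rightarrow> real" where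
  "f_bar \<Omega> f u = (LINT x|lebesgue_on \<Omega>. u x * f x (u x))"

(* Valued in [0,\<infinity>] because either integral may diverge: near u = 0 only u f is assumed to be
   bounded, not u f^2. *)
definition entropy_production :: "'a::euclidean_space set \<Rightarrow> ('a \<Rightarrow> real \<Rightarrow> real) \<Rightarrow>
    ('a \<Rightarrow> real) \<Rightarrow> ennreal" where
  "entropy_production \<Omega> f u =
     (\<integral>\<^sup>+x. ennreal (u x * (f x (u x) - f_bar \<Omega> f u)\<^sup>2) \<partial>lebesgue_on \<Omega>) +
     (\<integral>\<^sup>+x. (if u x > 0 then ennreal (1 / u x *
         (norm (- weak_grad \<Omega> (\<lambda>y. Phi f y (u y)) x + Phi_x f x (u x) + u x *\<^sub>R f_x f x (u x)))\<^sup>2)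
       else 0) \<partial>lebesgue_on \<Omega>)"

end

theory Submission
  imports Defs
begin

text \<open>
  Write \<open>c\<close> for the average \<open>f_bar\<close> and \<open>W\<close> for the vector in the second integral of the
  production.  Formally \<open>W\<close> is \<open>u\<close> times the gradient of \<open>x \<mapsto> f x (u x)\<close>, so the production is
  \<open>\<integral> u (f - c)\<^sup>2 + \<integral> u |\<nabla>f|\<^sup>2\<close>: if it is small, the fitness is almost constant wherever \<open>u\<close> is
  not small.

  The entropy density \<open>E\<close> is convex in the density with slope \<open>- f\<close>, hence \<open>E \<le> (m - u) f\<close>.  As
  \<open>u\<close> and \<open>m\<close> have equal mass, \<open>f\<close> may be replaced by \<open>f - c\<close> after integration.  Where \<open>u \<ge> \<delta>\<close>,
  strict monotonicity of \<open>f\<close> gives \<open>(m - u)\<^sup>2 \<le> C u E\<close> (\<open>deviation_bound\<close>), and Young's inequality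
  absorbs half of \<open>E\<close>, leaving \<open>u (f - c)\<^sup>2\<close> (\<open>absorbed_entropy_estimate\<close>).  Where \<open>u < \<delta>\<close>, the
  density \<open>E\<close> is merely bounded.  So everything reduces to one inequality: the measure of the low
  set \<open>A = {u < \<delta>}\<close> is at most a constant times the production.

  For \<open>\<delta>\<close> below \<open>m\<close>, the fitness is at least some \<open>e2 > 0\<close> on \<open>A\<close>.  Let \<open>B\<close> be the set where
  \<open>u \<ge> \<delta>\<close> and \<open>f \<le> e1\<close>, with \<open>e1 = e2 / 2\<close>.  On almost every segment that leads from \<open>A\<close> to \<open>B\<close>
  the fitness falls from \<open>e2\<close> to \<open>e1\<close> on a stretch where \<open>u\<close> lies between \<open>\<delta>\<close> and an upper
  bound of \<open>m\<close>; there \<open>W / u\<close> is its gradient.  Integration over parallel segments shows that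
  \<open>{x \<in> A. x + h \<in> B}\<close> is controlled by \<open>|h|\<^sup>2\<close> times the production (\<open>transition_set_measure\<close>).
  The Sobolev hypothesis enters here only, in the form that a function with integrable weak gradient
  agrees on almost every segment with the integral of that gradient (\<open>weak_gradient_AE_lines\<close>).

  The set outside \<open>A \<union> B\<close> is controlled by the first integral, because \<open>c \<le> e1 / 2\<close> for small
  production: otherwise \<open>u\<close> would lie strictly below \<open>m\<close> up to a small error, against equality of
  masses.  The entropy bound prevents concentration, so \<open>B\<close> has a definite measure.  A purely
  geometric argument (\<open>low_set_bound_domain\<close>) then bounds \<open>A\<close>: in a ball where \<open>B\<close> is large, \<open>A\<close>
  is small by averaging over all \<open>h\<close>; connectedness carries smallness of \<open>A\<close> along chains of balls,
  and near the boundary a translation along the normal direction of the local graph moves points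
  into a compact part of the domain.

  If the production is not small, the inequality follows from the bound on the entropy alone.
\<close>

section \<open>Smooth cut-offs of boxes and the fundamental lemma\<close>

text \<open>
  This family is closed under differentiation, which makes smoothness of its members provable by
  induction on the order.  The polynomial \<open>1\<close> gives the usual cut-off \<open>exp (- 1 / t)\<close>.
\<close>
definition bump :: "real poly \<Rightarrow> real \<Rightarrow> real" where
  "bump p t = (if t > 0 then poly p (1 / t) * exp (- 1 / t) else 0)"

lemma poly_times_exp_minus_tendsto_0: "((\<lambda>s::real. poly p s * exp (- s)) \<longlongrightarrow> 0) at_top"
proof -
  have "((\<lambda>s::real. \<Sum>i\<le>degree p. coeff p i * (s ^ i / exp s)) \<longlongrightarrow> (\<Sum>i\<le>degree p. coeff p i * 0)) at_top"
    by (intro tendsto_intros tendsto_power_div_exp_0)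
  then show ?thesis
    by (simp add: poly_altdef exp_minus sum_distrib_right field_simps sum_divide_distrib)
qed

text \<open>
  At \<open>0\<close> the difference quotient from the right is again a polynomial in \<open>1 / h\<close> times
  \<open>exp (- 1 / h)\<close>, so it tends to \<open>0\<close>.
\<close>
lemma bump_has_derivative:
  "(bump p has_real_derivative bump (monom 1 2 * (p - pderiv p)) t) (at t)"
proof -
  consider "t > 0" | "t < 0" | "t = 0" by linarith
  then show ?thesis
  proof cases
    case 1
    have "((\<lambda>t. poly p (1 / t) * exp (- 1 / t)) has_real_derivative
        bump (monom 1 2 * (p - pderiv p)) t) (at t)"
      using 1
      by (auto intro!: derivative_eq_intros DERIV_chain2[OF poly_DERIV] simp: bump_def poly_monom algebra_simps power2_eq_square divide_simps)
    then show ?thesis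
      by (rule has_field_derivative_transform_within_open[where S="{0<..}"])
         (use 1 in \<open>auto simp: bump_def\<close>)
  next
    case 2
    have "((\<lambda>t. 0) has_real_derivative bump (monom 1 2 * (p - pderiv p)) t) (at t)"
      using 2 by (auto simp: bump_def)
    then show ?thesis
      by (rule has_field_derivative_transform_within_open[where S="{..<0}"])
         (use 2 in \<open>auto simp: bump_def\<close>)
  next
    case 3
    have "((\<lambda>h. poly (pCons 0 p) (inverse h) * exp (- inverse h)) \<longlongrightarrow> 0) (at_right (0::real))"
      by (rule filterlim_compose[OF poly_times_exp_minus_tendsto_0 filterlim_inverse_at_top_right])
    then have right: "((\<lambda>h. bump p h / h) \<longlongrightarrow> 0) (at_right 0)"
      by (rule Lim_transform_eventually)
         (auto intro!: eventually_at_rightI[of 0 1] simp: bump_def field_simps)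
    have left: "((\<lambda>h. bump p h / h) \<longlongrightarrow> 0) (at_left 0)"
      by (rule Lim_transform_eventually[OF tendsto_const])
         (auto intro!: eventually_at_leftI[of "-1"] simp: bump_def)
    show ?thesis
      using filterlim_split_at[OF left right] 3 by (simp add: has_field_derivative_iff bump_def)
  qed
qed

lemma bump_continuous_on: "continuous_on S (bump p)"
  using bump_has_derivative[of p] by (metis DERIV_isCont continuous_at_imp_continuous_on)

text \<open>
  Dilations of one smooth function approximate the indicator of the half-line from below, so
  indicators of boxes are limits of test functions without any mollification.
\<close>
lemma bump_one_scaled_tendsto:
  "(\<lambda>n. bump 1 (real (Suc n) * t)) \<longlonglongrightarrow> of_bool (t > 0)"
proof (cases "t > 0")
  case True
  have "(\<lambda>n. exp (- (1 / t) * inverse (real (Suc n)))) \<longlonglongrightarrow> exp (- (1 / t) * 0)"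
    by (intro tendsto_intros LIMSEQ_inverse_real_of_nat)
  moreover have "bump 1 (real (Suc n) * t) = exp (- (1 / t) * inverse (real (Suc n)))" for n
    using True by (simp add: bump_def divide_simps del: of_nat_Suc)
  ultimately show ?thesis using True by simp
next
  case False
  then have "\<not> real (Suc n) * t > 0" for n by (simp add: zero_less_mult_iff)
  then show ?thesis using False by (simp add: bump_def)
qed

text \<open>
  On the whole space there is nothing to extend, and \<open>Ck_ext k UNIV UNIV\<close> is ordinary \<open>C\<^sup>k\<close> regularity.
\<close>
lemma extends_continuously_UNIV: "extends_continuously UNIV UNIV f \<longleftrightarrow> continuous_on UNIV f"
proof
  assume "extends_continuously UNIV UNIV f"
  then obtain g where "continuous_on UNIV g" "\<And>x. g x = f x"
    unfolding extends_continuously_def by auto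
  moreover from this have "g = f" by auto
  ultimately show "continuous_on UNIV f" by simp
qed (auto simp: extends_continuously_def)

lemma Ck_ext_Suc_imp: "Ck_ext (Suc k) S T f \<Longrightarrow> Ck_ext k S T f"
  by (induction k arbitrary: f) auto

lemma Ck_ext_imp_continuous: "Ck_ext k UNIV UNIV f \<Longrightarrow> continuous_on UNIV f"
  by (cases k) (auto simp: extends_continuously_UNIV)

lemma Ck_ext_SucI:
  assumes "\<And>x. (f has_derivative f' x) (at x)"
    and "\<And>b. b \<in> Basis \<Longrightarrow> Ck_ext k UNIV UNIV (\<lambda>x. f' x b)"
  shows "Ck_ext (Suc k) UNIV UNIV f"
proof -
  have "frechet_derivative f (at x) = f' x" for x
    using frechet_derivative_at[OF assms(1)] by simp
  moreover have "continuous_on UNIV f"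
    using assms(1) by (meson continuous_at_imp_continuous_on has_derivative_continuous)
  ultimately show ?thesis using assms by (auto simp: extends_continuously_UNIV differentiable_def)
qed

lemma Ck_ext_SucD:
  assumes "Ck_ext (Suc k) UNIV UNIV f"
  shows "(f has_derivative frechet_derivative f (at x)) (at x)"
    and "b \<in> Basis \<Longrightarrow> Ck_ext k UNIV UNIV (\<lambda>x. frechet_derivative f (at x) b)"
  using assms by (auto simp: frechet_derivative_works)

lemma Ck_ext_const: "Ck_ext k UNIV UNIV (\<lambda>_. c)"
proof (induction k arbitrary: c)
  case (Suc k)
  show ?case by (rule Ck_ext_SucI[where f'="\<lambda>_ _. 0"]) (auto intro: Suc)
qed (simp add: extends_continuously_UNIV)

lemma Ck_ext_add:
  "Ck_ext k UNIV UNIV f \<Longrightarrow> Ck_ext k UNIV UNIV g \<Longrightarrow> Ck_ext k UNIV UNIV (\<lambda>x. f x + g x)"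
proof (induction k arbitrary: f g)
  case (Suc k)
  show ?case
    by (rule Ck_ext_SucI[OF has_derivative_add[OF Ck_ext_SucD(1)[OF Suc(2)] Ck_ext_SucD(1)[OF Suc(3)]]])
       (intro Suc(1) Ck_ext_SucD(2)[OF Suc(2)] Ck_ext_SucD(2)[OF Suc(3)])
qed (simp add: extends_continuously_UNIV continuous_on_add)

lemma Ck_ext_mult:
  "Ck_ext k UNIV UNIV f \<Longrightarrow> Ck_ext k UNIV UNIV g \<Longrightarrow> Ck_ext k UNIV UNIV (\<lambda>x. f x * g x)"
proof (induction k arbitrary: f g)
  case (Suc k)
  have fg: "Ck_ext k UNIV UNIV f" "Ck_ext k UNIV UNIV g"
    using Suc.prems by (blast intro: Ck_ext_Suc_imp)+
  have "Ck_ext k UNIV UNIV (\<lambda>x. frechet_derivative f (at x) b)"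
    "Ck_ext k UNIV UNIV (\<lambda>x. frechet_derivative g (at x) b)" if "b \<in> Basis" for b
    using Suc.prems that by auto
  then have "Ck_ext k UNIV UNIV
      (\<lambda>x. f x * frechet_derivative g (at x) b + frechet_derivative f (at x) b * g x)"
    if "b \<in> Basis" for b
    using that by (intro Ck_ext_add Suc.IH[OF fg(1)] Suc.IH[OF _ fg(2)])
  with has_derivative_mult[OF Ck_ext_SucD(1)[OF Suc(2)] Ck_ext_SucD(1)[OF Suc(3)]]
  show ?case by (rule Ck_ext_SucI)
qed (simp add: extends_continuously_UNIV continuous_on_mult)

lemma Ck_ext_prod:
  "(\<And>i. i \<in> I \<Longrightarrow> Ck_ext k UNIV UNIV (f i)) \<Longrightarrow> Ck_ext k UNIV UNIV (\<lambda>x. \<Prod>i\<in>I. f i x)"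
proof (induction I rule: infinite_finite_induct)
  case (insert i I)
  then have "Ck_ext k UNIV UNIV (\<lambda>x. f i x * (\<Prod>i\<in>I. f i x))"
    by (intro Ck_ext_mult insert.IH insert.prems) simp_all
  with insert.hyps show ?case by simp
qed (simp_all add: Ck_ext_const del: Ck_ext.simps)

lemma Ck_ext_bump_affine: "Ck_ext k UNIV UNIV (\<lambda>x. bump p (x \<bullet> v + c))"
proof (induction k arbitrary: p)
  case 0
  show ?case
    by (auto simp: extends_continuously_UNIV intro!: continuous_intros continuous_on_compose2[OF bump_continuous_on])
next
  case (Suc k)
  have "((\<lambda>x. bump p (x \<bullet> v + c)) has_derivative
      (\<lambda>h. bump (monom 1 2 * (p - pderiv p)) (x \<bullet> v + c) * (h \<bullet> v))) (at x)" for x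
  proof -
    have "((\<lambda>x. x \<bullet> v + c) has_derivative (\<lambda>h. h \<bullet> v)) (at x)"
      by (auto intro!: derivative_eq_intros)
    from has_derivative_compose[OF this bump_has_derivative[unfolded has_field_derivative_def]]
    show ?thesis .
  qed
  then show ?case
    by (rule Ck_ext_SucI) (intro Ck_ext_mult Suc Ck_ext_const)
qed

lemma has_derivative_shift:
  assumes "(f has_derivative f') (at (x - c))"
  shows "((\<lambda>x. f (x - c)) has_derivative f') (at x)"
proof -
  have "((\<lambda>x. x - c) has_derivative (\<lambda>h. h)) (at x)"
    by (auto intro!: derivative_eq_intros)
  from has_derivative_compose[OF this assms] show ?thesis .
qed

lemma frechet_derivative_shift:
  "frechet_derivative (\<lambda>x. f (x - c)) (at x) = frechet_derivative f (at (x - c))"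
  if "f differentiable at (x - c)"
proof -
  have "((\<lambda>x. f (x - c)) has_derivative frechet_derivative f (at (x - c))) (at x)"
    by (rule has_derivative_shift) (use that in \<open>simp add: frechet_derivative_works\<close>)
  then show ?thesis by (metis frechet_derivative_at)
qed

lemma Ck_ext_shift: "Ck_ext k UNIV UNIV f \<Longrightarrow> Ck_ext k UNIV UNIV (\<lambda>x. f (x - c))"
proof (induction k arbitrary: f)
  case 0
  then show ?case
    by (auto simp: extends_continuously_UNIV intro!: continuous_intros continuous_on_compose2[of UNIV f])
next
  case (Suc k)
  have "((\<lambda>x. f (x - c)) has_derivative frechet_derivative f (at (x - c))) (at x)" for x
    by (rule has_derivative_shift) (use Suc(2) in \<open>simp add: frechet_derivative_works\<close>)
  then show ?case
    by (rule Ck_ext_SucI) (intro Suc(1)[of "\<lambda>x. frechet_derivative f (at x) _"] Ck_ext_SucD(2)[OF Suc(2)])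
qed

definition box_bump :: "'a::euclidean_space \<Rightarrow> 'a \<Rightarrow> nat \<Rightarrow> 'a \<Rightarrow> real" where
  "box_bump a b n x = (\<Prod>i\<in>Basis. bump 1 (real (Suc n) * (x \<bullet> i - a \<bullet> i)) * bump 1 (real (Suc n) * (b \<bullet> i - x \<bullet> i)))"

lemma bump_one_nz: "bump 1 t \<noteq> 0 \<longleftrightarrow> t > 0" by (simp add: bump_def)

lemma bump_one_bounds: "0 \<le> bump 1 t" "bump 1 t \<le> 1" by (auto simp: bump_def)

lemma box_bump_support: "{x. box_bump a b n x \<noteq> 0} = box a b"
  by (auto simp: box_bump_def bump_one_nz box_def zero_less_mult_iff simp del: of_nat_Suc)

lemma box_bump_bounds: "0 \<le> box_bump a b n x" "box_bump a b n x \<le> 1"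
  unfolding box_bump_def
  by (auto intro!: prod_nonneg prod_le_1 mult_nonneg_nonneg mult_le_one bump_one_bounds)

lemma box_bump_tendsto: "(\<lambda>n. box_bump a b n x) \<longlonglongrightarrow> indicator (box a b) x"
proof -
  have "(\<lambda>n. box_bump a b n x) \<longlonglongrightarrow>
      (\<Prod>i\<in>Basis. of_bool (x \<bullet> i - a \<bullet> i > 0) * of_bool (b \<bullet> i - x \<bullet> i > 0))"
    unfolding box_bump_def by (intro tendsto_prod tendsto_mult bump_one_scaled_tendsto)
  also have "(\<Prod>i\<in>Basis. of_bool (x \<bullet> i - a \<bullet> i > 0) * of_bool (b \<bullet> i - x \<bullet> i > 0)) =
      (indicator (box a b) x :: real)"
    by (auto simp: indicator_def box_def prod_eq_1_iff)
  finally show ?thesis .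
qed

lemma test_function_box_bump:
  assumes "cbox a b \<subseteq> \<Omega>"
  shows "test_function \<Omega> (box_bump a b n)"
proof -
  have "bump 1 (real (Suc n) * (x \<bullet> i - a \<bullet> i)) * bump 1 (real (Suc n) * (b \<bullet> i - x \<bullet> i))
     = bump 1 (x \<bullet> (real (Suc n) *\<^sub>R i) + (- real (Suc n) * (a \<bullet> i))) *
       bump 1 (x \<bullet> (- real (Suc n) *\<^sub>R i) + real (Suc n) * (b \<bullet> i))" for x i
    by (simp add: algebra_simps)
  then have "Ck_ext k UNIV UNIV (box_bump a b n)" for k
    unfolding box_bump_def[abs_def] by (simp only:) (intro Ck_ext_prod Ck_ext_mult Ck_ext_bump_affine)
  moreover have "closure (box a b) \<subseteq> cbox a b"
    by (rule closure_minimal) (auto simp: mem_box less_imp_le)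
  ultimately show ?thesis using assms
    by (auto simp: test_function_def box_bump_support bounded_closure_image)
qed

text \<open>
  The densities \<open>F\<^sup>+\<close> and \<open>F\<^sup>-\<close> define finite measures that agree on boxes, an intersection-stable
  generator of the Borel sets.
\<close>
lemma integrable_AE_zero_of_box_integrals:
  fixes F :: "'a::euclidean_space \<Rightarrow> real"
  assumes F: "integrable lborel F"
    and zero: "\<And>a b. (LINT x|lborel. indicator (box a b) x * F x) = 0"
  shows "AE x in lborel. F x = 0"
proof -
  have [measurable]: "F \<in> borel_measurable borel" using F by auto
  define M where "M = density lborel (\<lambda>x. ennreal (F x))"
  define N where "N = density lborel (\<lambda>x. ennreal (- F x))"
  have fin: "(\<integral>\<^sup>+x. ennreal (F x) \<partial>lborel) < \<infinity>" "(\<integral>\<^sup>+x. ennreal (- F x) \<partial>lborel) < \<infinity>"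
    using F by (auto simp: real_integrable_def less_top)
  have box: "emeasure M (box a b) = emeasure N (box a b)" for a b
  proof -
    have I: "integrable lborel (\<lambda>x. indicator (box a b) x * F x)"
      using integrable_real_mult_indicator[OF _ F, of "box a b"] by (simp add: mult.commute)
    have "0 = enn2real (\<integral>\<^sup>+x. ennreal (indicator (box a b) x * F x) \<partial>lborel) -
        enn2real (\<integral>\<^sup>+x. ennreal (- (indicator (box a b) x * F x)) \<partial>lborel)"
      using real_lebesgue_integral_def[OF I] zero[of a b] by simp
    moreover have "(\<integral>\<^sup>+x. ennreal (indicator (box a b) x * F x) \<partial>lborel) < \<infinity>"
      "(\<integral>\<^sup>+x. ennreal (- (indicator (box a b) x * F x)) \<partial>lborel) < \<infinity>"
      using I by (auto simp: real_integrable_def less_top)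
    ultimately have "(\<integral>\<^sup>+x. ennreal (indicator (box a b) x * F x) \<partial>lborel) =
       (\<integral>\<^sup>+x. ennreal (- (indicator (box a b) x * F x)) \<partial>lborel)"
      by (metis eq_iff_diff_eq_0 ennreal_enn2real infinity_ennreal_def)
    moreover have "emeasure M (box a b) = (\<integral>\<^sup>+x. ennreal (indicator (box a b) x * F x) \<partial>lborel)"
      unfolding M_def by (subst emeasure_density) (auto intro!: nn_integral_cong simp: indicator_def)
    moreover have "emeasure N (box a b) = (\<integral>\<^sup>+x. ennreal (- (indicator (box a b) x * F x)) \<partial>lborel)"
      unfolding N_def by (subst emeasure_density) (auto intro!: nn_integral_cong simp: indicator_def)
    ultimately show ?thesis by simp
  qed
  have "M = N"
  proof (rule measure_eqI_generator_eq)
    show "Int_stable (range (\<lambda>(a, b). box a b :: 'a set))"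
      by (auto simp: Int_stable_def box_Int_box)
    show "range (\<lambda>(a, b). box a b :: 'a set) \<subseteq> Pow UNIV" by simp
    show "\<And>X. X \<in> range (\<lambda>(a, b). box a b) \<Longrightarrow> emeasure M X = emeasure N X"
      using box by auto
    have sb: "sets borel = sigma_sets UNIV (range (\<lambda>(a, b). box a b :: 'a set))"
      by (subst borel_eq_box) simp
    show "sets M = sigma_sets UNIV (range (\<lambda>(a, b). box a b))"
      "sets N = sigma_sets UNIV (range (\<lambda>(a, b). box a b))"
      by (simp_all add: M_def N_def sb[symmetric])
    let ?A = "\<lambda>n::nat. box (- (real n *\<^sub>R One)) (real n *\<^sub>R One) :: 'a set"
    show "range ?A \<subseteq> range (\<lambda>(a, b). box a b)" by auto
    show "(\<Union>n. ?A n) = UNIV" by (rule UN_box_eq_UNIV)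
    show "emeasure M (?A n) \<noteq> \<infinity>" for n
    proof -
      have "emeasure M (?A n) \<le> (\<integral>\<^sup>+x. ennreal (F x) \<partial>lborel)"
        unfolding M_def by (subst emeasure_density)
           (auto intro!: nn_integral_mono simp: indicator_def)
      with fin show ?thesis by (auto simp: less_top[symmetric] top_unique)
    qed
  qed
  then have "AE x in lborel. ennreal (F x) = ennreal (- F x)"
    unfolding M_def N_def
    by (subst (asm) sigma_finite_measure.density_unique_iff[OF sigma_finite_lborel]) auto
  then show ?thesis
  proof eventually_elim
    case (elim x)
    show ?case
    proof (cases "F x" "0::real" rule: linorder_cases)
      case less
      then have "ennreal (F x) = 0" by (simp add: ennreal_neg)
      with elim have "- F x \<le> 0" by (simp add: ennreal_eq_0_iff)
      with less show ?thesis by simp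
    next
      case greater
      then have "ennreal (- F x) = 0" by (simp add: ennreal_neg)
      with elim have "F x \<le> 0" by (simp add: ennreal_eq_0_iff)
      with greater show ?thesis by simp
    qed
  qed
qed

text \<open>
  Cut-offs of boxes are test functions, and dominated convergence turns the hypothesis into vanishing
  integrals over all boxes whose closure lies in \<open>S\<close>; countably many of them cover \<open>S\<close>.
\<close>
lemma fundamental_lemma_calculus_of_variations:
  fixes F :: "'a::euclidean_space \<Rightarrow> real"
  assumes F: "integrable lborel F" and "open S"
    and zero: "\<And>\<phi>. test_function S \<phi> \<Longrightarrow> (LINT x|lborel. F x * \<phi> x) = 0"
  shows "AE x in lborel. x \<in> S \<longrightarrow> F x = 0"
proof -
  have [measurable]: "F \<in> borel_measurable borel" using F by auto
  have box0: "(LINT x|lborel. indicator (box a b) x * F x) = 0" if "cbox a b \<subseteq> S" for a b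
  proof -
    have [measurable]: "box_bump a b n \<in> borel_measurable borel" for n
      using test_function_box_bump[of a b UNIV n] unfolding test_function_def
      by (metis borel_measurable_continuous_onI Ck_ext_imp_continuous subset_UNIV)
    have "(\<lambda>n. LINT x|lborel. F x * box_bump a b n x) \<longlonglongrightarrow> (LINT x|lborel. F x * indicator (box a b) x)"
    proof (rule integral_dominated_convergence[where w="\<lambda>x. \<bar>F x\<bar>"])
      show "AE x in lborel. (\<lambda>n. F x * box_bump a b n x) \<longlonglongrightarrow> F x * indicator (box a b) x"
        by (intro AE_I2 tendsto_intros box_bump_tendsto)
      show "AE x in lborel. norm (F x * box_bump a b n x) \<le> \<bar>F x\<bar>" for n
        using box_bump_bounds[of a b n] by (auto simp: abs_mult intro!: mult_left_le)
    qed (use F in auto)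
    moreover have "(LINT x|lborel. F x * box_bump a b n x) = 0" for n
      by (intro zero test_function_box_bump that)
    ultimately show ?thesis by (simp add: LIMSEQ_const_iff mult.commute)
  qed
  have boxae: "AE x in lborel. x \<in> box a b \<longrightarrow> F x = 0" if "cbox a b \<subseteq> S" for a b
  proof -
    have "AE x in lborel. indicator (box a b) x * F x = 0"
    proof (rule integrable_AE_zero_of_box_integrals)
      show "integrable lborel (\<lambda>x. indicator (box a b) x * F x)"
        using integrable_real_mult_indicator[OF _ F, of "box a b"] by (simp add: mult.commute)
      fix c d :: 'a
      obtain a' b' where ab: "box c d \<inter> box a b = box a' b'"
        using box_Int_box[of c d a b] by blast
      have "(LINT x|lborel. indicator (box c d) x * (indicator (box a b) x * F x)) =
        (LINT x|lborel. indicator (box a' b') x * F x)"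
        unfolding ab[symmetric] by (simp add: indicator_inter_arith mult.assoc)
      also have "\<dots> = 0"
      proof (cases "box a' b' = {}")
        case False
        then have "cbox a' b' = closure (box a' b')" by (simp add: closure_box)
        also have "\<dots> \<subseteq> closure (box a b)" by (intro closure_mono) (use ab in auto)
        also have "\<dots> \<subseteq> cbox a b" by (rule closure_minimal) (auto simp: mem_box less_imp_le)
        finally show ?thesis using that by (intro box0) auto
      qed simp
      finally show "(LINT x|lborel. indicator (box c d) x * (indicator (box a b) x * F x)) = 0" .
    qed
    then show ?thesis by eventually_elim (auto simp: indicator_def)
  qed
  obtain \<D> where D: "countable \<D>" "\<Union>\<D> = S"
    "\<And>X. X \<in> \<D> \<Longrightarrow> \<exists>a b. X = box a b \<and> cbox a b \<subseteq> S"
  proof -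
    have "\<exists>r>0. cbox (x - r *\<^sub>R One) (x + r *\<^sub>R One) \<subseteq> S" if "x \<in> S" for x
    proof -
      obtain e where e: "e > 0" "ball x e \<subseteq> S" by (rule openE[OF \<open>open S\<close> \<open>x \<in> S\<close>])
      define r where "r = e / (2 * real DIM('a))"
      have "cbox (x - r *\<^sub>R One) (x + r *\<^sub>R One) \<subseteq> ball x e"
      proof
        fix y assume "y \<in> cbox (x - r *\<^sub>R One) (x + r *\<^sub>R One)"
        then have "\<bar>(y - x) \<bullet> i\<bar> \<le> r" if "i \<in> Basis" for i
          using that by (auto simp: mem_box inner_simps abs_le_iff)
        then have "(\<Sum>i\<in>Basis. \<bar>(y - x) \<bullet> i\<bar>) \<le> (\<Sum>i\<in>(Basis::'a set). r)" by (intro sum_mono)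
        then have "norm (y - x) \<le> e / 2"
          using norm_le_l1[of "y - x"] by (simp add: r_def)
        then show "y \<in> ball x e" using e by (simp add: dist_norm norm_minus_commute)
      qed
      moreover have "r > 0" using e by (simp add: r_def)
      ultimately show ?thesis using e by blast
    qed
    then obtain r where r: "\<And>x. x \<in> S \<Longrightarrow> r x > 0" "\<And>x. x \<in> S \<Longrightarrow> cbox (x - r x *\<^sub>R One) (x + r x *\<^sub>R One) \<subseteq> S"
      by metis
    let ?\<F> = "(\<lambda>x. box (x - r x *\<^sub>R One) (x + r x *\<^sub>R One)) ` S"
    have xin: "x \<in> box (x - r x *\<^sub>R One) (x + r x *\<^sub>R One)" if "x \<in> S" for x
      using r(1)[OF that] by (auto simp: mem_box inner_simps)
    obtain \<F>' where "\<F>' \<subseteq> ?\<F>" "countable \<F>'" "\<Union>\<F>' = \<Union>?\<F>"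
      using Lindelof[of ?\<F>] by (metis (no_types, lifting) imageE open_box)
    moreover have "\<Union>?\<F> = S" using xin r(2) box_subset_cbox by fast
    ultimately show ?thesis using r(2) by (intro that[of \<F>']) (simp, simp, blast)
  qed
  have "AE x in lborel. \<forall>X\<in>\<D>. x \<in> X \<longrightarrow> F x = 0"
    by (subst AE_ball_countable[OF D(1)]) (use D(3) boxae in blast)
  then show ?thesis using D(2) by auto
qed

section \<open>Weak gradients along segments\<close>

definition segment_dom :: "'a::real_vector set \<Rightarrow> 'a \<Rightarrow> 'a set" where
  "segment_dom \<Omega> h = {x. \<forall>t\<in>{0..1}. x + t *\<^sub>R h \<in> \<Omega>}"

lemma segment_domD: "x \<in> segment_dom \<Omega> h \<Longrightarrow> 0 \<le> t \<Longrightarrow> t \<le> 1 \<Longrightarrow> x + t *\<^sub>R h \<in> \<Omega>"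
  by (auto simp: segment_dom_def)

lemma segment_dom_scale: "s \<in> {0..1} \<Longrightarrow> segment_dom \<Omega> h \<subseteq> segment_dom \<Omega> (s *\<^sub>R h)"
  by (auto simp: segment_dom_def mult_le_one)

lemma open_segment_dom:
  fixes \<Omega> :: "'a::euclidean_space set"
  assumes "open \<Omega>" shows "open (segment_dom \<Omega> h)"
  unfolding open_contains_ball
proof
  fix x assume x: "x \<in> segment_dom \<Omega> h"
  have "compact ((\<lambda>t. x + t *\<^sub>R h) ` {0..1})"
    by (intro compact_continuous_image continuous_intros) auto
  moreover have "(\<lambda>t. x + t *\<^sub>R h) ` {0..1} \<subseteq> \<Omega>" using x by (auto simp: segment_dom_def)
  ultimately obtain e where e: "e > 0" "(\<Union>y\<in>(\<lambda>t. x + t *\<^sub>R h) ` {0..1}. ball y e) \<subseteq> \<Omega>"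
    using compact_subset_open_imp_ball_epsilon_subset[OF _ assms] by metis
  have "ball x e \<subseteq> segment_dom \<Omega> h"
  proof
    fix y assume "y \<in> ball x e"
    then have "y + t *\<^sub>R h \<in> ball (x + t *\<^sub>R h) e" for t by (simp add: dist_norm)
    then show "y \<in> segment_dom \<Omega> h" using e(2) by (force simp: segment_dom_def)
  qed
  then show "\<exists>e>0. ball x e \<subseteq> segment_dom \<Omega> h" using e(1) by blast
qed

lemma nn_integral_lborel_shift:
  fixes f :: "'a::euclidean_space \<Rightarrow> ennreal"
  assumes [measurable]: "f \<in> borel_measurable borel"
  shows "(\<integral>\<^sup>+x. f (x + c) \<partial>lborel) = (\<integral>\<^sup>+x. f x \<partial>lborel)"
proof -
  have "(\<integral>\<^sup>+x. f x \<partial>lborel) = (\<integral>\<^sup>+x. f x \<partial>distr lborel borel ((+) c))"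
    by (simp only: lborel_distr_plus)
  also have "\<dots> = (\<integral>\<^sup>+x. f (x + c) \<partial>lborel)"
    by (subst nn_integral_distr) (auto simp: add.commute)
  finally show ?thesis by simp
qed

lemma integral_lborel_shift:
  fixes f :: "'a::euclidean_space \<Rightarrow> 'b::{banach, second_countable_topology}"
  assumes [measurable]: "f \<in> borel_measurable borel"
  shows "(LINT x|lborel. f (x + c)) = (LINT x|lborel. f x)"
proof -
  have "(LINT x|lborel. f x) = (LINT x|distr lborel borel ((+) c). f x)"
    by (simp only: lborel_distr_plus)
  also have "\<dots> = (LINT x|lborel. f (x + c))"
    by (subst integral_distr) (auto simp: add.commute)
  finally show ?thesis by simp
qed

lemma integrable_lborel_shift:
  fixes f :: "'a::euclidean_space \<Rightarrow> 'b::{banach, second_countable_topology}"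
  assumes "integrable lborel f"
  shows "integrable lborel (\<lambda>x. f (x + c))"
proof -
  have [measurable]: "f \<in> borel_measurable borel" using assms by auto
  show ?thesis
    using assms nn_integral_lborel_shift[of "\<lambda>x. ennreal (norm (f x))" c]
    by (auto simp: integrable_iff_bounded)
qed

lemma AE_lborel_shift:
  fixes P :: "'a::euclidean_space \<Rightarrow> bool"
  assumes "AE x in lborel. P x"
  shows "AE x in lborel. P (x + c)"
proof -
  from assms obtain N where N: "{x. \<not> P x} \<subseteq> N" "N \<in> null_sets lborel"
    by (auto simp: eventually_ae_filter)
  then have [measurable]: "N \<in> sets borel" by auto
  have "(\<integral>\<^sup>+x. indicator N (x + c) \<partial>lborel) = 0"
    using N(2) by (subst nn_integral_lborel_shift) auto
  then have "AE x in lborel. indicator N (x + c) = (0::ennreal)"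
    by (subst (asm) nn_integral_0_iff_AE) auto
  then show ?thesis
    by eventually_elim (use N(1) in \<open>auto simp: indicator_def split: if_splits\<close>)
qed

text \<open>
  By Tonelli and translation invariance, the integral over all segments equals the integral of
  \<open>norm G\<close>; in particular \<open>G\<close> is integrable on almost every segment.
\<close>
lemma integrable_along_segments:
  fixes G :: "'a::euclidean_space \<Rightarrow> 'b::{banach, second_countable_topology}"
  assumes "integrable lborel G"
  shows "integrable (lborel \<Otimes>\<^sub>M lborel) (\<lambda>(x, t::real). indicator {0..1} t *\<^sub>R G (x + t *\<^sub>R h))"
proof -
  have [measurable]: "G \<in> borel_measurable borel" using assms by auto
  have "(\<integral>\<^sup>+p. ennreal (norm ((\<lambda>(x, t::real). indicator {0..1} t *\<^sub>R G (x + t *\<^sub>R h)) p)) \<partial>(lborel \<Otimes>\<^sub>M lborel))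
     = (\<integral>\<^sup>+t. (\<integral>\<^sup>+x. ennreal (norm (indicator {0..1::real} t *\<^sub>R G (x + t *\<^sub>R h))) \<partial>lborel) \<partial>lborel)"
    by (subst lborel_pair.nn_integral_snd[symmetric]) (auto simp: case_prod_unfold)
  also have "\<dots> = (\<integral>\<^sup>+t. indicator {0..1::real} t * (\<integral>\<^sup>+x. ennreal (norm (G x)) \<partial>lborel) \<partial>lborel)"
  proof (rule nn_integral_cong)
    fix t :: real
    show "(\<integral>\<^sup>+x. ennreal (norm (indicator {0..1::real} t *\<^sub>R G (x + t *\<^sub>R h))) \<partial>lborel) =
      indicator {0..1::real} t * (\<integral>\<^sup>+x. ennreal (norm (G x)) \<partial>lborel)"
      using nn_integral_lborel_shift[of "\<lambda>x. ennreal (norm (G x))" "t *\<^sub>R h"]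
      by (auto simp: indicator_def)
  qed
  also have "\<dots> = (\<integral>\<^sup>+x. ennreal (norm (G x)) \<partial>lborel)"
    by (subst nn_integral_multc) auto
  also have "\<dots> < \<infinity>" using assms by (simp add: integrable_iff_bounded)
  finally show ?thesis by (simp add: integrable_iff_bounded)
qed

lemma frechet_derivative_expand:
  fixes \<phi> :: "'a::euclidean_space \<Rightarrow> real"
  assumes "\<phi> differentiable (at x)"
  shows "frechet_derivative \<phi> (at x) h = (\<Sum>b\<in>Basis. (h \<bullet> b) * frechet_derivative \<phi> (at x) b)"
proof -
  interpret linear "frechet_derivative \<phi> (at x)" using assms by (rule linear_frechet_derivative)
  have "frechet_derivative \<phi> (at x) h = frechet_derivative \<phi> (at x) (\<Sum>b\<in>Basis. (h \<bullet> b) *\<^sub>R b)"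
    by (simp add: euclidean_representation)
  also have "\<dots> = (\<Sum>b\<in>Basis. (h \<bullet> b) * frechet_derivative \<phi> (at x) b)"
    by (simp add: sum scale)
  finally show ?thesis .
qed

lemma test_function_props:
  assumes "test_function S \<phi>"
  shows "continuous_on UNIV \<phi>" and "\<phi> differentiable (at x)"
    and "continuous_on UNIV (\<lambda>x. frechet_derivative \<phi> (at x) h)"
    and "\<exists>C. \<forall>x. \<bar>\<phi> x\<bar> \<le> C" and "\<exists>C. \<forall>x. \<bar>frechet_derivative \<phi> (at x) h\<bar> \<le> C"
proof -
  have C: "Ck_ext k UNIV UNIV \<phi>" for k using assms by (simp add: test_function_def)
  from C show cont: "continuous_on UNIV \<phi>" by (rule Ck_ext_imp_continuous)
  from C[of "Suc 0"] show diff: "\<phi> differentiable (at x)" for x by auto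
  have "continuous_on UNIV (\<lambda>x. frechet_derivative \<phi> (at x) b)" if "b \<in> Basis" for b
    using Ck_ext_imp_continuous[OF Ck_ext_SucD(2)[OF C[of "Suc 0"] that]] .
  moreover have lin: "frechet_derivative \<phi> (at x) h = (\<Sum>b\<in>Basis. (h \<bullet> b) * frechet_derivative \<phi> (at x) b)" for x
    using diff by (rule frechet_derivative_expand)
  ultimately show contD: "continuous_on UNIV (\<lambda>x. frechet_derivative \<phi> (at x) h)"
    by (auto intro!: continuous_intros)
  define K where "K = closure {x. \<phi> x \<noteq> 0}"
  have K: "compact K" using assms by (simp add: test_function_def K_def)
  have out: "\<phi> x = 0" if "x \<notin> K" for x
    using that closure_subset[of "{x. \<phi> x \<noteq> 0}"] by (auto simp: K_def)
  have outD: "frechet_derivative \<phi> (at x) h = 0" if "x \<notin> K" for x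
  proof -
    have "open (- K)" by (simp add: K_def open_Compl)
    then have "((\<lambda>x. 0) has_derivative (\<lambda>h. 0)) (at x)" "open (- K)" "x \<in> - K" using that by auto
    then have "(\<phi> has_derivative (\<lambda>h. 0)) (at x)"
      by (rule has_derivative_transform_within_open) (simp add: out)
    from frechet_derivative_at[OF this] show ?thesis by metis
  qed
  have bdd: "\<exists>C. \<forall>x. \<bar>g x\<bar> \<le> C" if g: "continuous_on UNIV g" "\<And>x. x \<notin> K \<Longrightarrow> g x = 0" for g :: "'a \<Rightarrow> real"
  proof -
    have "compact (g ` K)" using K g(1) by (meson compact_continuous_image continuous_on_subset subset_UNIV)
    then have "bounded (g ` K)" by (rule compact_imp_bounded)
    then obtain C where C: "\<And>x. x \<in> K \<Longrightarrow> \<bar>g x\<bar> \<le> C"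
      unfolding bounded_iff by auto
    have "\<bar>g x\<bar> \<le> max C 0" for x using C[of x] g(2)[of x] by (cases "x \<in> K") auto
    then show ?thesis by blast
  qed
  show "\<exists>C. \<forall>x. \<bar>\<phi> x\<bar> \<le> C" by (rule bdd[OF cont out])
  show "\<exists>C. \<forall>x. \<bar>frechet_derivative \<phi> (at x) h\<bar> \<le> C" by (rule bdd[OF contD outD])
qed

lemma test_function_shift:
  assumes "test_function (segment_dom \<Omega> h) \<phi>" "t \<in> {0..1}"
  shows "test_function \<Omega> (\<lambda>x. \<phi> (x - t *\<^sub>R h))"
proof -
  have "{x. \<phi> (x - t *\<^sub>R h) \<noteq> 0} = (\<lambda>x. t *\<^sub>R h + x) ` {x. \<phi> x \<noteq> 0}"
    by (force simp: image_iff intro!: exI[of _ "_ - t *\<^sub>R h"])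
  then have "closure {x. \<phi> (x - t *\<^sub>R h) \<noteq> 0} = (\<lambda>x. t *\<^sub>R h + x) ` closure {x. \<phi> x \<noteq> 0}"
    by (simp add: closure_translation)
  moreover have "compact ((\<lambda>x. t *\<^sub>R h + x) ` closure {x. \<phi> x \<noteq> 0})"
    using assms by (intro compact_translation) (auto simp: test_function_def)
  moreover have "(\<lambda>x. t *\<^sub>R h + x) ` closure {x. \<phi> x \<noteq> 0} \<subseteq> \<Omega>"
    using assms by (fastforce simp: test_function_def segment_dom_def add.commute)
  ultimately show ?thesis
    using assms(1) by (simp add: test_function_def Ck_ext_shift del: Ck_ext.simps)
qed

text \<open>
  The increment \<open>\<phi> (y - h) - \<phi> y\<close> is the integral over \<open>t\<close> of \<open>- D\<phi> (y - t h) h\<close>.  For each \<open>t\<close> the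
  shifted function is a test function on \<open>\<Omega>\<close>, so the derivative can be moved to \<open>V\<close>; a shift of
  variables brings all translations to the other factor.
\<close>
lemma weak_gradient_difference_quotient_weak:
  fixes V :: "'a::euclidean_space \<Rightarrow> real" and G :: "'a \<Rightarrow> 'a"
  assumes V: "integrable lborel V" and G: "integrable lborel G"
    and weak: "\<And>\<phi> b. test_function \<Omega> \<phi> \<Longrightarrow> b \<in> Basis \<Longrightarrow>
      (LINT x|lborel. V x * frechet_derivative \<phi> (at x) b) = - (LINT x|lborel. (G x \<bullet> b) * \<phi> x)"
    and \<phi>: "test_function (segment_dom \<Omega> h) \<phi>"
  shows "(LINT x|lborel. (V (x + h) - V x) * \<phi> x) =
         (LINT x|lborel. (LINT t|lborel. indicator {0..1} t * (G (x + t *\<^sub>R h) \<bullet> h)) * \<phi> x)"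
proof -
  have [measurable]: "V \<in> borel_measurable borel" "G \<in> borel_measurable borel" using V G by auto
  note tp = test_function_props[OF \<phi>]
  define D where "D = (\<lambda>x v. frechet_derivative \<phi> (at x) v)"
  have [measurable]: "\<phi> \<in> borel_measurable borel" "(\<lambda>x. D x v) \<in> borel_measurable borel" for v
    using tp(1,3) by (auto simp: D_def intro: borel_measurable_continuous_onI)
  obtain C where C: "\<And>x. \<bar>\<phi> x\<bar> \<le> C" using tp(4) by blast
  have "\<exists>C. \<forall>x. \<bar>D x v\<bar> \<le> C" for v using tp(5) by (simp add: D_def)
  then obtain CD where CD: "\<And>x v. \<bar>D x v\<bar> \<le> CD v" by metis
  have FTC: "(LINT t|lborel. indicator {0..1} t * - D (y - t *\<^sub>R h) h) = \<phi> (y - h) - \<phi> y" for y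
  proof -
    have "((\<lambda>t. \<phi> (y - t *\<^sub>R h)) has_vector_derivative - D (y - t *\<^sub>R h) h) (at t within {0..1})" for t
    proof -
      have d: "((\<lambda>t. y - t *\<^sub>R h) has_derivative (\<lambda>s. - (s *\<^sub>R h))) (at t within {0..1})"
        by (auto intro!: derivative_eq_intros)
      have e: "(\<phi> has_derivative frechet_derivative \<phi> (at (y - t *\<^sub>R h))) (at (y - t *\<^sub>R h))"
        using tp(2) by (simp add: frechet_derivative_works)
      interpret linear "frechet_derivative \<phi> (at (y - t *\<^sub>R h))"
        using tp(2) by (rule linear_frechet_derivative)
      show ?thesis
        using has_derivative_compose[OF d e]
        by (simp add: has_vector_derivative_def D_def neg scale)
    qed
    moreover have "continuous_on {0..1} (\<lambda>t. - D (y - t *\<^sub>R h) h)"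
      using tp(3)[of h] unfolding D_def
      by (intro continuous_intros continuous_on_compose2[where f="\<lambda>t. y - t *\<^sub>R h" and t=UNIV]) auto
    ultimately show ?thesis
      using integral_FTC_Icc[of 0 1 "\<lambda>t. \<phi> (y - t *\<^sub>R h)" "\<lambda>t. - D (y - t *\<^sub>R h) h"] by simp
  qed
  have intVb: "integrable lborel (\<lambda>y. V y * g y)"
    if [measurable]: "g \<in> borel_measurable borel" and "\<And>y. \<bar>g y\<bar> \<le> B" for g B
  proof (rule Bochner_Integration.integrable_bound[of _ "\<lambda>y. B * V y"])
    show "AE y in lborel. norm (V y * g y) \<le> norm (B * V y)"
      using order_trans[OF that(2) abs_ge_self]
      by (auto simp: abs_mult mult.commute[of "\<bar>B\<bar>"] intro!: AE_I2 mult_left_mono)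
  qed (use V in auto)
  have intGb: "integrable lborel (\<lambda>y. (G y \<bullet> v) * g y)"
    if [measurable]: "g \<in> borel_measurable borel" and "\<And>y. \<bar>g y\<bar> \<le> B" for g v B
  proof (rule Bochner_Integration.integrable_bound[of _ "\<lambda>y. B * (G y \<bullet> v)"])
    show "AE y in lborel. norm ((G y \<bullet> v) * g y) \<le> norm (B * (G y \<bullet> v))"
      using order_trans[OF that(2) abs_ge_self]
      by (auto simp: abs_mult mult.commute[of "\<bar>B\<bar>"] intro!: AE_I2 mult_left_mono)
  qed (use G in auto)
  have inner: "(LINT y|lborel. V y * - D (y - t *\<^sub>R h) h) = (LINT x|lborel. (G (x + t *\<^sub>R h) \<bullet> h) * \<phi> x)"
    if t: "t \<in> {0..1}" for t
  proof -
    let ?\<phi> = "\<lambda>y. \<phi> (y - t *\<^sub>R h)"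
    have DS: "D (y - t *\<^sub>R h) h = (\<Sum>b\<in>Basis. (h \<bullet> b) * D (y - t *\<^sub>R h) b)" for y
      unfolding D_def using tp(2) by (rule frechet_derivative_expand)
    have "(LINT y|lborel. V y * - D (y - t *\<^sub>R h) h) =
        (LINT y|lborel. (\<Sum>b\<in>Basis. - (h \<bullet> b) * (V y * D (y - t *\<^sub>R h) b)))"
      by (subst DS) (simp add: sum_distrib_left sum_negf algebra_simps)
    also have "\<dots> = (\<Sum>b\<in>Basis. - (h \<bullet> b) * (LINT y|lborel. V y * D (y - t *\<^sub>R h) b))"
      by (subst Bochner_Integration.integral_sum) (auto intro!: integrable_mult_right intVb CD)
    also have "\<dots> = (\<Sum>b\<in>Basis. (h \<bullet> b) * (LINT y|lborel. (G y \<bullet> b) * \<phi> (y - t *\<^sub>R h)))"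
      using weak[OF test_function_shift[OF \<phi> t]] tp(2)
      by (intro sum.cong refl) (simp add: frechet_derivative_shift D_def)
    also have "\<dots> = (LINT y|lborel. (\<Sum>b\<in>Basis. (h \<bullet> b) * ((G y \<bullet> b) * \<phi> (y - t *\<^sub>R h))))"
      by (subst Bochner_Integration.integral_sum) (auto intro!: integrable_mult_right intGb C)
    also have "\<dots> = (LINT y|lborel. (G y \<bullet> h) * \<phi> (y - t *\<^sub>R h))"
      by (intro Bochner_Integration.integral_cong refl, subst (3) euclidean_inner)
         (simp add: sum_distrib_right sum_distrib_left mult_ac)
    also have "\<dots> = (LINT x|lborel. (G (x + t *\<^sub>R h) \<bullet> h) * \<phi> (x + t *\<^sub>R h - t *\<^sub>R h))"
      by (subst integral_lborel_shift[symmetric, of _ "t *\<^sub>R h"]) auto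
    finally show ?thesis by simp
  qed
  have I1: "integrable (lborel \<Otimes>\<^sub>M lborel) (\<lambda>(y, t::real). V y * (indicator {0..1} t * - D (y - t *\<^sub>R h) h))"
  proof (rule Bochner_Integration.integrable_bound)
    show "integrable (lborel \<Otimes>\<^sub>M lborel) (\<lambda>(y, t::real). CD h *\<^sub>R (indicator {0..1} t *\<^sub>R V y))"
      using integrable_along_segments[OF V, of 0] by (simp add: case_prod_unfold)
    have "\<bar>V y * (indicator {0..1} t * - D (y - t *\<^sub>R h) h)\<bar> \<le> \<bar>CD h * (indicator {0..1} t * V y)\<bar>" for y and t :: real
    proof -
      have "\<bar>D (y - t *\<^sub>R h) h\<bar> \<le> \<bar>CD h\<bar>" using CD[of "y - t *\<^sub>R h" h] by simp
      then have "\<bar>V y\<bar> * \<bar>D (y - t *\<^sub>R h) h\<bar> \<le> \<bar>V y\<bar> * \<bar>CD h\<bar>" by (intro mult_left_mono) auto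
      then show ?thesis by (auto simp: abs_mult indicator_def mult.commute)
    qed
    then show "AE p in lborel \<Otimes>\<^sub>M lborel. norm (case p of (y, t::real) \<Rightarrow> V y * (indicator {0..1} t * - D (y - t *\<^sub>R h) h))
        \<le> norm (case p of (y, t::real) \<Rightarrow> CD h *\<^sub>R (indicator {0..1} t *\<^sub>R V y))"
      by auto
  qed measurable
  have I2: "integrable (lborel \<Otimes>\<^sub>M lborel) (\<lambda>(x, t::real). indicator {0..1} t * ((G (x + t *\<^sub>R h) \<bullet> h) * \<phi> x))"
  proof (rule Bochner_Integration.integrable_bound)
    show "integrable (lborel \<Otimes>\<^sub>M lborel) (\<lambda>p. (C * norm h) *\<^sub>R norm (case p of (x, t::real) \<Rightarrow> indicator {0..1} t *\<^sub>R G (x + t *\<^sub>R h)))"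
      using integrable_along_segments[OF G, of h] by (intro integrable_scaleR_right integrable_norm)
    have "\<bar>indicator {0..1} t * ((G (x + t *\<^sub>R h) \<bullet> h) * \<phi> x)\<bar> \<le> \<bar>(C * norm h) * norm (indicator {0..1} t *\<^sub>R G (x + t *\<^sub>R h))\<bar>"
      for x and t :: real
    proof -
      have "C \<ge> 0" using C[of 0] by linarith
      have "\<bar>G (x + t *\<^sub>R h) \<bullet> h\<bar> * \<bar>\<phi> x\<bar> \<le> (norm (G (x + t *\<^sub>R h)) * norm h) * C"
        by (intro mult_mono Cauchy_Schwarz_ineq2 C) auto
      then show ?thesis using \<open>C \<ge> 0\<close> by (auto simp: abs_mult indicator_def mult_ac)
    qed
    then show "AE p in lborel \<Otimes>\<^sub>M lborel. norm (case p of (x, t::real) \<Rightarrow> indicator {0..1} t * ((G (x + t *\<^sub>R h) \<bullet> h) * \<phi> x))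
        \<le> norm ((C * norm h) *\<^sub>R norm (case p of (x, t::real) \<Rightarrow> indicator {0..1} t *\<^sub>R G (x + t *\<^sub>R h)))"
      by auto
  qed measurable
  have "(LINT x|lborel. (V (x + h) - V x) * \<phi> x) = (LINT x|lborel. V (x + h) * \<phi> x) - (LINT x|lborel. V x * \<phi> x)"
  proof -
    have "integrable lborel (\<lambda>x. V (x + h) * \<phi> (x + h - h))"
      using C by (intro integrable_lborel_shift[of "\<lambda>x. V x * \<phi> (x - h)"] intVb) auto
    then show ?thesis using intVb[OF _ C] by (simp add: left_diff_distrib)
  qed
  also have "(LINT x|lborel. V (x + h) * \<phi> x) = (LINT y|lborel. V y * \<phi> (y - h))"
    using integral_lborel_shift[of "\<lambda>y. V y * \<phi> (y - h)" h] by simp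
  also have "\<dots> - (LINT x|lborel. V x * \<phi> x) = (LINT y|lborel. V y * (\<phi> (y - h) - \<phi> y))"
    using intVb[of \<phi> C] intVb[of "\<lambda>y. \<phi> (y - h)" C] C by (simp add: right_diff_distrib)
  also have "\<dots> = (LINT y|lborel. LINT t|lborel. V y * (indicator {0..1} t * - D (y - t *\<^sub>R h) h))"
    by (simp only: FTC[symmetric] integral_mult_right_zero)
  also have "\<dots> = (LINT t|lborel. LINT y|lborel. V y * (indicator {0..1} t * - D (y - t *\<^sub>R h) h))"
    by (rule lborel_pair.Fubini_integral[OF I1, symmetric])
  also have "\<dots> = (LINT t|lborel. LINT x|lborel. indicator {0..1} t * ((G (x + t *\<^sub>R h) \<bullet> h) * \<phi> x))"
  proof (rule Bochner_Integration.integral_cong[OF refl])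
    fix t :: real
    show "(LINT y|lborel. V y * (indicator {0..1} t * - D (y - t *\<^sub>R h) h)) =
       (LINT x|lborel. indicator {0..1} t * ((G (x + t *\<^sub>R h) \<bullet> h) * \<phi> x))"
      using inner[of t] by (cases "t \<in> {0..1}") auto
  qed
  also have "\<dots> = (LINT x|lborel. LINT t|lborel. indicator {0..1} t * ((G (x + t *\<^sub>R h) \<bullet> h) * \<phi> x))"
    by (rule lborel_pair.Fubini_integral[OF I2])
  also have "\<dots> = (LINT x|lborel. (LINT t|lborel. indicator {0..1} t * (G (x + t *\<^sub>R h) \<bullet> h)) * \<phi> x)"
    by (simp only: integral_mult_left_zero[symmetric] mult.assoc)
  finally show ?thesis .
qed

lemma weak_gradient_AE_difference:
  fixes V :: "'a::euclidean_space \<Rightarrow> real" and G :: "'a \<Rightarrow> 'a"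
  assumes V: "integrable lborel V" and G: "integrable lborel G" and "open \<Omega>"
    and weak: "\<And>\<phi> b. test_function \<Omega> \<phi> \<Longrightarrow> b \<in> Basis \<Longrightarrow>
      (LINT x|lborel. V x * frechet_derivative \<phi> (at x) b) = - (LINT x|lborel. (G x \<bullet> b) * \<phi> x)"
  shows "AE x in lborel. x \<in> segment_dom \<Omega> h \<longrightarrow>
    V (x + h) = V x + (LINT t|lborel. indicator {0..1} t * (G (x + t *\<^sub>R h) \<bullet> h))"
proof -
  have [measurable]: "V \<in> borel_measurable borel" "G \<in> borel_measurable borel" using V G by auto
  define J where "J = (\<lambda>x. LINT t|lborel. indicator {0..1} t * (G (x + t *\<^sub>R h) \<bullet> h))"
  have "integrable (lborel \<Otimes>\<^sub>M lborel) (\<lambda>p. (case p of (x, t::real) \<Rightarrow> indicator {0..1} t *\<^sub>R G (x + t *\<^sub>R h)) \<bullet> h)"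
    by (intro integrable_inner_left integrable_along_segments G)
  then have I: "integrable (lborel \<Otimes>\<^sub>M lborel) (\<lambda>(x, t::real). indicator {0..1} t * (G (x + t *\<^sub>R h) \<bullet> h))"
    by (simp add: case_prod_unfold)
  have J: "integrable lborel J"
    unfolding J_def using lborel_pair.integrable_fst'[OF I] by simp
  have VV: "integrable lborel (\<lambda>x. V (x + h) - V x)"
    by (intro Bochner_Integration.integrable_diff integrable_lborel_shift V)
  have "AE x in lborel. x \<in> segment_dom \<Omega> h \<longrightarrow> V (x + h) - V x - J x = 0"
  proof (rule fundamental_lemma_calculus_of_variations)
    show "integrable lborel (\<lambda>x. V (x + h) - V x - J x)"
      by (intro Bochner_Integration.integrable_diff integrable_lborel_shift V J)
    show "open (segment_dom \<Omega> h)" by (rule open_segment_dom[OF \<open>open \<Omega>\<close>])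
    fix \<phi> assume \<phi>: "test_function (segment_dom \<Omega> h) \<phi>"
    obtain C where C: "\<And>x. \<bar>\<phi> x\<bar> \<le> C" using test_function_props(4)[OF \<phi>] by blast
    have [measurable]: "\<phi> \<in> borel_measurable borel"
      using test_function_props(1)[OF \<phi>] by (auto intro: borel_measurable_continuous_onI)
    have mult: "integrable lborel (\<lambda>x. g x * \<phi> x)" if g: "integrable lborel g" for g :: "'a \<Rightarrow> real"
    proof (rule Bochner_Integration.integrable_bound[of _ "\<lambda>x. C * g x"])
      have "C \<ge> 0" using C[of 0] by linarith
      then show "AE y in lborel. norm (g y * \<phi> y) \<le> norm (C * g y)"
        using C by (auto simp: abs_mult mult.commute intro!: AE_I2 mult_right_mono)
    qed (use g in auto)
    show "(LINT x|lborel. (V (x + h) - V x - J x) * \<phi> x) = 0"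
      using weak_gradient_difference_quotient_weak[OF V G weak \<phi>] mult[OF VV] mult[OF J]
      by (simp add: left_diff_distrib[of "_ - _"] J_def)
  qed
  then show ?thesis by (simp add: J_def algebra_simps)
qed

text \<open>
  The formula at all intermediate points comes from the previous lemma with \<open>s *\<^sub>R h\<close> in place of \<open>h\<close>
  and Fubini, so it holds for almost all \<open>s\<close> only.  The end point is a null set of the segment and is
  recorded separately, because the argument on a single segment needs the values at both ends.
\<close>
lemma weak_gradient_AE_lines:
  fixes V :: "'a::euclidean_space \<Rightarrow> real" and G :: "'a \<Rightarrow> 'a"
  assumes V: "integrable lborel V" and G: "integrable lborel G" and "open \<Omega>"
    and weak: "\<And>\<phi> b. test_function \<Omega> \<phi> \<Longrightarrow> b \<in> Basis \<Longrightarrow>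
      (LINT x|lborel. V x * frechet_derivative \<phi> (at x) b) = - (LINT x|lborel. (G x \<bullet> b) * \<phi> x)"
  shows "AE x in lborel. x \<in> segment_dom \<Omega> h \<longrightarrow>
      integrable lborel (\<lambda>t::real. indicator {0..1} t *\<^sub>R G (x + t *\<^sub>R h)) \<and>
      V (x + h) = V x + (LINT t|lborel. indicator {0..1} t * (G (x + t *\<^sub>R h) \<bullet> h)) \<and>
      (AE s in lborel. s \<in> {0..1} \<longrightarrow>
        V (x + s *\<^sub>R h) = V x + (LINT t|lborel. indicator {0..s} t * (G (x + t *\<^sub>R h) \<bullet> h)))"
proof -
  have [measurable]: "V \<in> borel_measurable borel" "G \<in> borel_measurable borel" using V G by auto
  have [measurable]: "segment_dom \<Omega> h \<in> sets borel" using open_segment_dom[OF \<open>open \<Omega>\<close>] by auto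
  have 1: "AE x in lborel. integrable lborel (\<lambda>t::real. indicator {0..1} t *\<^sub>R G (x + t *\<^sub>R h))"
    using lborel_pair.AE_integrable_fst'[OF integrable_along_segments[OF G, of h]] by simp
  have eq: "AE x in lborel. x \<in> segment_dom \<Omega> h \<longrightarrow> V (x + s *\<^sub>R h) = V x + (LINT t|lborel. indicator {0..s} t * (G (x + t *\<^sub>R h) \<bullet> h))"
    if s: "s \<in> {0..1}" for s
  proof (cases "s = 0")
    case True
    have "(LINT t|lborel. indicator {0..0::real} t * (G (x + t *\<^sub>R h) \<bullet> h)) = 0" for x
    proof (rule integral_eq_zero_AE)
      show "AE t in lborel. indicator {0..0::real} t * (G (x + t *\<^sub>R h) \<bullet> h) = 0"
        using AE_lborel_singleton[of "0::real"] by eventually_elim (auto simp: indicator_def)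
    qed
    then show ?thesis using True by simp
  next
    case False
    with s have "s > 0" by simp
    have "(LINT t|lborel. indicator {0..s} t * (G (x + t *\<^sub>R h) \<bullet> h)) =
        (LINT t|lborel. indicator {0..1} t * (G (x + t *\<^sub>R (s *\<^sub>R h)) \<bullet> (s *\<^sub>R h)))" for x
    proof -
      have "(LINT t|lborel. indicator {0..s} t * (G (x + t *\<^sub>R h) \<bullet> h)) =
          s * (LINT t|lborel. indicator {0..s} (s * t) * (G (x + (s * t) *\<^sub>R h) \<bullet> h))"
        using lborel_integral_real_affine[of s "\<lambda>t. indicator {0..s} t * (G (x + t *\<^sub>R h) \<bullet> h)" 0] \<open>s > 0\<close>
        by simp
      also have "\<dots> = (LINT t|lborel. s * (indicator {0..s} (s * t) * (G (x + (s * t) *\<^sub>R h) \<bullet> h)))"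
        by (rule integral_mult_right_zero[symmetric])
      also have "\<dots> = (LINT t|lborel. indicator {0..1} t * (G (x + t *\<^sub>R (s *\<^sub>R h)) \<bullet> (s *\<^sub>R h)))"
        using \<open>s > 0\<close>
        by (intro Bochner_Integration.integral_cong refl)
           (simp add: indicator_def zero_le_mult_iff mult.commute[of _ s])
      finally show ?thesis .
    qed
    with weak_gradient_AE_difference[OF V G \<open>open \<Omega>\<close> weak, of "s *\<^sub>R h"] segment_dom_scale[OF s, of \<Omega> h]
    show ?thesis by (auto elim!: eventually_mono)
  qed
  have one: "1 \<in> {0..1::real}" by simp
  have "AE x in lborel. AE s in lborel. s \<in> {0..1} \<longrightarrow> x \<in> segment_dom \<Omega> h \<longrightarrow>
     V (x + s *\<^sub>R h) = V x + (LINT t|lborel. indicator {0..s} t * (G (x + t *\<^sub>R h) \<bullet> h))"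
  \<comment> \<open>exchange the quantifiers: \<open>eq\<close> provides an exceptional null set for every fixed \<open>s\<close>\<close>
  proof (subst lborel_pair.AE_commute)
    have meas: "Measurable.pred (lborel \<Otimes>\<^sub>M lborel) (\<lambda>p. snd p \<in> {0..1} \<longrightarrow> fst p \<in> segment_dom \<Omega> h \<longrightarrow>
       V (fst p + snd p *\<^sub>R h) = V (fst p) + (LINT t|lborel. (if 0 \<le> t \<and> t \<le> snd p then 1 else 0) * (G (fst p + t *\<^sub>R h) \<bullet> h)))"
      by measurable
    have ind: "indicator {0..s} t = (if 0 \<le> t \<and> t \<le> s then 1 else 0 :: real)" for s t :: real
      by (simp add: indicator_def)
    show "{p \<in> space (lborel \<Otimes>\<^sub>M lborel). snd p \<in> {0..1} \<longrightarrow> fst p \<in> segment_dom \<Omega> h \<longrightarrow>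
       V (fst p + snd p *\<^sub>R h) = V (fst p) + (LINT t|lborel. indicator {0..snd p} t * (G (fst p + t *\<^sub>R h) \<bullet> h))}
       \<in> sets (lborel \<Otimes>\<^sub>M lborel)"
      using meas unfolding pred_def ind .
    show "AE s in lborel. AE x in lborel. s \<in> {0..1} \<longrightarrow> x \<in> segment_dom \<Omega> h \<longrightarrow>
       V (x + s *\<^sub>R h) = V x + (LINT t|lborel. indicator {0..s} t * (G (x + t *\<^sub>R h) \<bullet> h))"
      by (rule AE_I2) (use eq in auto)
  qed
  with 1 eq[OF one] show ?thesis
  proof eventually_elim
    case (elim x)
    then show ?case by (cases "x \<in> segment_dom \<Omega> h") simp_all
  qed
qed

section \<open>Regularity of the fitness\<close>

lemma extends_continuously_imp_continuous_on:
  assumes "extends_continuously S T f" "S \<subseteq> T" shows "continuous_on S f"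
proof -
  obtain g where g: "continuous_on T g" "\<forall>x\<in>S. g x = f x"
    using assms(1) by (auto simp: extends_continuously_def)
  have "continuous_on S g" using g(1) assms(2) by (rule continuous_on_subset)
  then show ?thesis using g(2) by (simp cong: continuous_on_cong)
qed

text \<open>
  The constants \<open>f_u\<close>, \<open>f_x\<close> and \<open>f_xu\<close> are defined through derivatives of slices of \<open>f\<close>; here they are
  identified with partial derivatives of the function of \<open>(x, u)\<close>, of which \<open>f_xu\<close> is taken first in \<open>x\<close> and then
  in \<open>u\<close>.
\<close>
lemma C2_interior_regularity:
  fixes f :: "'a::euclidean_space \<Rightarrow> real \<Rightarrow> real"
  assumes "open \<Omega>" and C2: "Ck_closed 2 (\<Omega> \<times> {0<..}) (closure \<Omega> \<times> {0<..}) (\<lambda>(x, u). f x u)"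
  shows "\<And>x u. x \<in> \<Omega> \<Longrightarrow> 0 < u \<Longrightarrow> (f x has_real_derivative f_u f x u) (at u)"
    and "\<And>x u. x \<in> \<Omega> \<Longrightarrow> 0 < u \<Longrightarrow> ((\<lambda>y. f y u) has_derivative (\<lambda>h. f_x f x u \<bullet> h)) (at x)"
    and "\<And>x u. x \<in> \<Omega> \<Longrightarrow> 0 < u \<Longrightarrow> (f_x f x has_vector_derivative f_xu f x u) (at u)"
    and "extends_continuously (\<Omega> \<times> {0<..}) (closure \<Omega> \<times> {0<..}) (\<lambda>(x, u). f_u f x u)"
    and "continuous_on (\<Omega> \<times> {0<..}) (\<lambda>(x, u). f_x f x u)"
    and "continuous_on (\<Omega> \<times> {0<..}) (\<lambda>(x, u). f_xu f x u)"
proof -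
  let ?S = "\<Omega> \<times> {0::real<..}" and ?T = "closure \<Omega> \<times> {0::real<..}"
  define F where "F = (\<lambda>(x, u). f x u)"
  define D where "D = (\<lambda>b p. frechet_derivative F (at p) b)"
  have ST: "?S \<subseteq> ?T" using closure_subset by auto
  have Cext: "Ck_ext (Suc (Suc 0)) ?S ?T F"
    using C2 by (simp add: Ck_closed_def F_def numeral_2_eq_2 del: Ck_ext.simps)
  have Fd: "F differentiable (at p)" if "p \<in> ?S" for p using Cext that by (cases p) auto
  have DC: "Ck_ext (Suc 0) ?S ?T (D b)" if "b \<in> Basis" for b
    using Cext that by (simp add: D_def[abs_def])
  have Dext: "extends_continuously ?S ?T (D b)" and Dd: "p \<in> ?S \<Longrightarrow> D b differentiable (at p)"
    and DDext: "c \<in> Basis \<Longrightarrow> extends_continuously ?S ?T (\<lambda>p. frechet_derivative (D b) (at p) c)"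
    if "b \<in> Basis" for b c p
    using DC[OF that] by auto
  have B: "(b, 0) \<in> (Basis :: ('a \<times> real) set)" if "b \<in> Basis" for b :: 'a
    using that by (auto simp: Basis_prod_def)
  have B1: "(0, 1) \<in> (Basis :: ('a \<times> real) set)" by (auto simp: Basis_prod_def)
  have slice_u: "((\<lambda>u. H (x, u)) has_vector_derivative frechet_derivative H (at (x, u)) (0, 1)) (at u)"
    if "H differentiable (at (x, u))" for H :: "'a \<times> real \<Rightarrow> real" and x u
  proof -
    have h: "(H has_derivative frechet_derivative H (at (x, u))) (at (x, u))"
      using that by (simp add: frechet_derivative_works)
    have "((\<lambda>u. (x, u)) has_derivative (\<lambda>s. (0, s))) (at u)" by (auto intro!: derivative_eq_intros)
    from has_derivative_compose[OF this h]
    have "((\<lambda>u. H (x, u)) has_derivative (\<lambda>s. frechet_derivative H (at (x, u)) (0, s))) (at u)" .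
    moreover have "(\<lambda>s. frechet_derivative H (at (x, u)) (0, s)) =
        (\<lambda>s. s *\<^sub>R frechet_derivative H (at (x, u)) (0, 1))"
    proof
      fix s :: real
      have s: "(0 :: 'a, s) = s *\<^sub>R (0, 1)" by simp
      show "frechet_derivative H (at (x, u)) (0, s) = s *\<^sub>R frechet_derivative H (at (x, u)) (0, 1)"
        by (subst s) (rule linear_scale[OF linear_frechet_derivative[OF that]])
    qed
    ultimately show ?thesis by (simp only: has_vector_derivative_def)
  qed
  have slice_x: "((\<lambda>y. f y u) has_derivative (\<lambda>h. frechet_derivative F (at (x, u)) (h, 0))) (at x)"
    if "(x, u) \<in> ?S" for x u
  proof -
    have h: "(F has_derivative frechet_derivative F (at (x, u))) (at (x, u))"
      using Fd[OF that] by (simp add: frechet_derivative_works)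
    have "((\<lambda>y. (y, u)) has_derivative (\<lambda>h. (h, 0))) (at x)" by (auto intro!: derivative_eq_intros)
    from has_derivative_compose[OF this h] show ?thesis by (simp add: F_def)
  qed
  have fu: "(f x has_real_derivative D (0, 1) (x, u)) (at u)" if "x \<in> \<Omega>" "0 < u" for x u
    using slice_u[OF Fd, of x u] that
    by (simp add: F_def D_def has_real_derivative_iff_has_vector_derivative)
  then have fu_eq: "f_u f x u = D (0, 1) (x, u)" if "x \<in> \<Omega>" "0 < u" for x u
    using that by (simp add: f_u_def DERIV_imp_deriv)
  show "(f x has_real_derivative f_u f x u) (at u)" if "x \<in> \<Omega>" "0 < u" for x u
    using fu[OF that] fu_eq[OF that] by simp
  have fx_eq: "f_x f x u = (\<Sum>b\<in>Basis. D (b, 0) (x, u) *\<^sub>R b)" if "x \<in> \<Omega>" "0 < u" for x u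
    using frechet_derivative_at[OF slice_x, of x u, symmetric] that by (simp add: f_x_def grad_def D_def)
  show "((\<lambda>y. f y u) has_derivative (\<lambda>h. f_x f x u \<bullet> h)) (at x)" if "x \<in> \<Omega>" "0 < u" for x u
  proof -
    have xu: "(x, u) \<in> ?S" using that by auto
    have "frechet_derivative F (at (x, u)) (h, 0) = f_x f x u \<bullet> h" for h
    proof -
      have "f_x f x u \<bullet> h = (\<Sum>b\<in>Basis. (h \<bullet> b) * D (b, 0) (x, u))"
        using fx_eq[OF that] by (simp add: inner_sum_left inner_commute[of h] mult.commute)
      also have "\<dots> = frechet_derivative (\<lambda>y. f y u) (at x) h"
        using frechet_derivative_at[OF slice_x[OF xu], symmetric] slice_x[OF xu]
        by (subst frechet_derivative_expand) (auto simp: D_def differentiable_def)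
      finally show ?thesis using frechet_derivative_at[OF slice_x[OF xu]] by metis
    qed
    then show ?thesis using slice_x[OF xu] by simp
  qed
  have fxu: "(f_x f x has_vector_derivative
      (\<Sum>b\<in>Basis. frechet_derivative (D (b, 0)) (at (x, u)) (0, 1) *\<^sub>R b)) (at u)"
    if "x \<in> \<Omega>" "0 < u" for x u
  proof -
    have "((\<lambda>u. \<Sum>b\<in>Basis. D (b, 0) (x, u) *\<^sub>R b) has_vector_derivative
      (\<Sum>b\<in>Basis. frechet_derivative (D (b, 0)) (at (x, u)) (0, 1) *\<^sub>R b)) (at u)"
      by (intro has_vector_derivative_sum
            bounded_linear.has_vector_derivative[OF bounded_linear_scaleR_left slice_u[OF Dd[OF B]]])
         (use that in auto)
    then show ?thesis
      by (rule has_vector_derivative_transform_within_open[where S="{0<..}"])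
         (use that fx_eq in auto)
  qed
  then have fxu_eq: "f_xu f x u = (\<Sum>b\<in>Basis. frechet_derivative (D (b, 0)) (at (x, u)) (0, 1) *\<^sub>R b)"
    if "x \<in> \<Omega>" "0 < u" for x u using that by (simp add: f_xu_def vector_derivative_at)
  show "(f_x f x has_vector_derivative f_xu f x u) (at u)" if "x \<in> \<Omega>" "0 < u" for x u
    using fxu[OF that] fxu_eq[OF that] by simp
  show "extends_continuously ?S ?T (\<lambda>(x, u). f_u f x u)"
    using Dext[OF B1] by (auto simp: extends_continuously_def fu_eq)
  have "continuous_on ?S (\<lambda>p. \<Sum>b\<in>Basis. D (b, 0) p *\<^sub>R b)"
    by (intro continuous_intros extends_continuously_imp_continuous_on[OF Dext[OF B] ST])
  then show "continuous_on ?S (\<lambda>(x, u). f_x f x u)"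
    by (rule continuous_on_eq) (auto simp: fx_eq)
  have "continuous_on ?S (\<lambda>p. \<Sum>b\<in>Basis. frechet_derivative (D (b, 0)) (at p) (0, 1) *\<^sub>R b)"
    by (intro continuous_intros extends_continuously_imp_continuous_on[OF DDext[OF B B1] ST])
  then show "continuous_on ?S (\<lambda>(x, u). f_xu f x u)"
    by (rule continuous_on_eq) (auto simp: fxu_eq)
qed

text \<open>
  For a boundary point \<open>x\<close> the derivative of \<open>f x\<close> is the limit of interior ones: in the mean value
  theorem along \<open>x\<^sub>n \<longrightarrow> x\<close> the intermediate points stay in a compact interval, so a subsequence
  converges and the identity passes to \<open>x\<close>.
\<close>
lemma C1_extension_derivative_closure:
  fixes f :: "'a::euclidean_space \<Rightarrow> real \<Rightarrow> real"
  assumes cont: "continuous_on (closure \<Omega> \<times> {0<..}) (\<lambda>(x, u). f x u)"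
    and der: "\<And>x u. x \<in> \<Omega> \<Longrightarrow> 0 < u \<Longrightarrow> (f x has_real_derivative f_u f x u) (at u)"
    and ext: "extends_continuously (\<Omega> \<times> {0<..}) (closure \<Omega> \<times> {0<..}) (\<lambda>(x, u). f_u f x u)"
  shows "\<And>x u. x \<in> closure \<Omega> \<Longrightarrow> 0 < u \<Longrightarrow> (f x has_real_derivative f_u f x u) (at u)"
    and "continuous_on (closure \<Omega> \<times> {0<..}) (\<lambda>(x, u). f_u f x u)"
proof -
  obtain g where g: "continuous_on (closure \<Omega> \<times> {0<..}) g"
    "\<And>x u. x \<in> \<Omega> \<Longrightarrow> 0 < u \<Longrightarrow> g (x, u) = f_u f x u"
    using ext by (auto simp: extends_continuously_def)
  have mvt: "\<exists>\<xi>\<in>{a..b}. f x b - f x a = (b - a) * g (x, \<xi>)"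
    if x: "x \<in> closure \<Omega>" and ab: "0 < a" "a < b" for x a b
  proof -
    obtain X where X: "\<And>n. X n \<in> \<Omega>" "X \<longlonglongrightarrow> x" using x by (auto simp: closure_sequential)
    have "\<exists>\<xi>. a < \<xi> \<and> \<xi> < b \<and> f (X n) b - f (X n) a = (b - a) * f_u f (X n) \<xi>" for n
      using ab by (intro MVT2 der X) auto
    then obtain \<xi> where \<xi>: "\<And>n. a < \<xi> n" "\<And>n. \<xi> n < b"
      "\<And>n. f (X n) b - f (X n) a = (b - a) * f_u f (X n) (\<xi> n)" by metis
    have "seq_compact {a..b}" using compact_imp_seq_compact by auto
    then obtain l r where lr: "l \<in> {a..b}" "strict_mono r" "(\<xi> \<circ> r) \<longlonglongrightarrow> l"
      unfolding seq_compact_def using \<xi> by (metis atLeastAtMost_iff less_imp_le)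
    have Xr: "(\<lambda>n. X (r n)) \<longlonglongrightarrow> x" using X(2) lr(2) LIMSEQ_subseq_LIMSEQ by (fastforce simp: o_def)
    have Xc: "X n \<in> closure \<Omega>" for n using X(1) closure_subset by blast
    have "(\<lambda>n. g (X (r n), \<xi> (r n))) \<longlonglongrightarrow> g (x, l)"
      using g(1) x lr ab Xr Xc less_trans[OF ab(1) \<xi>(1)]
      by (intro continuous_on_tendsto_compose[OF g(1), of "\<lambda>n. (X (r n), \<xi> (r n))"] tendsto_Pair)
         (auto simp: o_def)
    then have 1: "(\<lambda>n. (b - a) * g (X (r n), \<xi> (r n))) \<longlonglongrightarrow> (b - a) * g (x, l)"
      by (intro tendsto_intros)
    have fl: "(\<lambda>n. f (X (r n)) c) \<longlonglongrightarrow> f x c" if "c > 0" for c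
      using continuous_on_tendsto_compose[OF cont, of "\<lambda>n. (X (r n), c)" "(x, c)" sequentially]
        tendsto_Pair[OF Xr tendsto_const[of c]] x that Xc
      by auto
    have 2: "(\<lambda>n. f (X (r n)) b - f (X (r n)) a) \<longlonglongrightarrow> f x b - f x a"
      using ab by (intro tendsto_intros fl) auto
    have "f (X (r n)) b - f (X (r n)) a = (b - a) * g (X (r n), \<xi> (r n))" for n
      using \<xi>(3)[of "r n"] g(2)[OF X(1), of "\<xi> (r n)" "r n"] less_trans[OF ab(1) \<xi>(1)[of "r n"]] by simp
    then have "f x b - f x a = (b - a) * g (x, l)"
      using LIMSEQ_unique[OF 1] 2 by simp
    with lr(1) show ?thesis by blast
  qed
  have D: "(f x has_real_derivative g (x, u)) (at u)" if x: "x \<in> closure \<Omega>" and u: "0 < u" for x u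
    unfolding DERIV_def
  proof (rule LIM_I)
    fix e :: real assume "e > 0"
    have "continuous_on {0<..} (\<lambda>v. g (x, v))"
      by (rule continuous_on_compose2[OF g(1)]) (use x in \<open>auto intro!: continuous_intros\<close>)
    then obtain d where d: "d > 0" "\<And>v. 0 < v \<Longrightarrow> \<bar>v - u\<bar> < d \<Longrightarrow> \<bar>g (x, v) - g (x, u)\<bar> < e"
      using u \<open>e > 0\<close> unfolding continuous_on_iff dist_real_def by (metis greaterThan_iff)
    show "\<exists>s>0. \<forall>h. h \<noteq> 0 \<and> norm (h - 0) < s \<longrightarrow> norm ((f x (u + h) - f x u) / h - g (x, u)) < e"
    proof (intro exI[of _ "min d u"] conjI allI impI)
      fix h :: real assume "h \<noteq> 0 \<and> norm (h - 0) < min d u"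
      then have h: "h \<noteq> 0" "\<bar>h\<bar> < d" "\<bar>h\<bar> < u" by auto
      have "\<exists>\<xi>. 0 < \<xi> \<and> \<bar>\<xi> - u\<bar> < d \<and> f x (u + h) - f x u = h * g (x, \<xi>)"
      proof (cases "h > 0")
        case True
        then obtain \<xi> where "\<xi> \<in> {u..u + h}" "f x (u + h) - f x u = h * g (x, \<xi>)"
          using mvt[OF x u, of "u + h"] by auto
        with u h show ?thesis by (intro exI[of _ \<xi>]) auto
      next
        case False
        then obtain \<xi> where "\<xi> \<in> {u + h..u}" "f x u - f x (u + h) = - h * g (x, \<xi>)"
          using mvt[OF x, of "u + h" u] h by auto
        with u h False show ?thesis by (intro exI[of _ \<xi>]) auto
      qed
      with h d show "norm ((f x (u + h) - f x u) / h - g (x, u)) < e" by auto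
    qed (use d u in auto)
  qed
  then have eq: "f_u f x u = g (x, u)" if "x \<in> closure \<Omega>" "0 < u" for x u
    using that by (simp add: f_u_def DERIV_imp_deriv)
  show "(f x has_real_derivative f_u f x u) (at u)" if "x \<in> closure \<Omega>" "0 < u" for x u
    using D[OF that] eq[OF that] by simp
  show "continuous_on (closure \<Omega> \<times> {0<..}) (\<lambda>(x, u). f_u f x u)"
    using g(1) by (rule continuous_on_eq) (auto simp: eq)
qed

section \<open>Borel representatives\<close>

lemma AE_lebesgue_on_open:
  assumes "open \<Omega>"
  shows "(AE x in lebesgue_on \<Omega>. P x) \<longleftrightarrow> (AE x in lborel. x \<in> \<Omega> \<longrightarrow> P x)"
  using assms by (subst AE_restrict_space_iff) (auto simp: AE_completion_iff)

lemma borel_measurable_lebesgue_on: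
  "F \<in> borel_measurable borel \<Longrightarrow> F \<in> borel_measurable (lebesgue_on \<Omega>)"
  by (intro measurable_restrict_space1 measurable_completion) simp

lemma integral_lebesgue_on_borel:
  fixes F :: "'a::euclidean_space \<Rightarrow> 'b::{banach, second_countable_topology}"
  assumes "open \<Omega>" and F: "F \<in> borel_measurable borel" and 0: "\<And>x. x \<notin> \<Omega> \<Longrightarrow> F x = 0"
  shows "(LINT x|lebesgue_on \<Omega>. F x) = (LINT x|lborel. F x)"
    and "integrable (lebesgue_on \<Omega>) F \<longleftrightarrow> integrable lborel F"
proof -
  have eq: "(\<lambda>x. indicator \<Omega> x *\<^sub>R F x) = F" using 0 by (force simp: indicator_def)
  have s: "\<Omega> \<inter> space lebesgue \<in> sets lebesgue" using assms(1) by simp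
  show "(LINT x|lebesgue_on \<Omega>. F x) = (LINT x|lborel. F x)"
    by (subst integral_restrict_space[OF s]) (simp only: eq, subst integral_completion, use F in auto)
  show "integrable (lebesgue_on \<Omega>) F \<longleftrightarrow> integrable lborel F"
    by (subst integrable_restrict_space[OF s]) (simp only: eq, subst integrable_completion, use F in auto)
qed

lemma nn_integral_lebesgue_on_borel:
  fixes F :: "'a::euclidean_space \<Rightarrow> ennreal"
  assumes "open \<Omega>" and 0: "\<And>x. x \<notin> \<Omega> \<Longrightarrow> F x = 0"
  shows "(\<integral>\<^sup>+x. F x \<partial>lebesgue_on \<Omega>) = (\<integral>\<^sup>+x. F x \<partial>lborel)"
proof -
  have eq: "(\<lambda>x. F x * indicator \<Omega> x) = F" using 0 by (force simp: indicator_def)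
  show ?thesis
    using assms(1) by (subst nn_integral_restrict_space) (auto simp: eq nn_integral_completion)
qed

lemma indicator_lebesgue_on:
  assumes "open \<Omega>" "bounded \<Omega>" "A \<in> sets borel" "A \<subseteq> \<Omega>"
  shows "integrable (lebesgue_on \<Omega>) (indicator A :: 'a::euclidean_space \<Rightarrow> real)"
    and "(LINT x|lebesgue_on \<Omega>. indicator A x) = measure lborel A"
proof -
  have 0: "indicator A x = (0::real)" if "x \<notin> \<Omega>" for x using that assms(4) by (auto simp: indicator_def)
  have m: "(indicator A :: 'a \<Rightarrow> real) \<in> borel_measurable borel" using assms(3) by simp
  have "emeasure lborel A < \<infinity>" using bounded_subset[OF assms(2,4)] emeasure_bounded_finite by auto
  then show "integrable (lebesgue_on \<Omega>) (indicator A :: 'a \<Rightarrow> real)"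
    using integral_lebesgue_on_borel(2)[OF assms(1) m 0] assms(3) by (auto simp: integrable_indicator_iff)
  show "(LINT x|lebesgue_on \<Omega>. indicator A x) = measure lborel A"
    using integral_lebesgue_on_borel(1)[OF assms(1) m 0] by simp
qed

lemma borel_representative_real:
  fixes v :: "'a::euclidean_space \<Rightarrow> real"
  assumes "open \<Omega>" "v \<in> borel_measurable (lebesgue_on \<Omega>)"
  obtains v1 where "v1 \<in> borel_measurable borel" "AE x in lborel. x \<in> \<Omega> \<longrightarrow> v1 x = v x" "\<And>x. x \<notin> \<Omega> \<Longrightarrow> v1 x = 0"
proof -
  have [measurable]: "\<Omega> \<in> sets borel" using assms(1) by simp
  have "(\<lambda>x. indicator \<Omega> x *\<^sub>R v x) \<in> borel_measurable lebesgue"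
    using assms borel_measurable_restrict_space_iff[of \<Omega> lebesgue v] by simp
  then obtain v0 where v0: "v0 \<in> borel_measurable lborel" "AE x in lborel. indicator \<Omega> x *\<^sub>R v x = v0 x"
    using completion_ex_borel_measurable_real by metis
  have [measurable]: "v0 \<in> borel_measurable borel" using v0(1) by simp
  show ?thesis
  proof (rule that[of "\<lambda>x. indicator \<Omega> x * v0 x"])
    show "AE x in lborel. x \<in> \<Omega> \<longrightarrow> indicator \<Omega> x * v0 x = v x"
      using v0(2) by eventually_elim auto
  qed auto
qed

lemma borel_representative_integrable:
  fixes v :: "'a::euclidean_space \<Rightarrow> 'b::euclidean_space"
  assumes \<Omega>: "open \<Omega>" and v: "integrable (lebesgue_on \<Omega>) v"
  obtains v1 where "integrable lborel v1" "AE x in lborel. x \<in> \<Omega> \<longrightarrow> v1 x = v x" "\<And>x. x \<notin> \<Omega> \<Longrightarrow> v1 x = 0"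
proof -
  have "\<exists>w. integrable lborel w \<and> (AE x in lborel. x \<in> \<Omega> \<longrightarrow> w x = v x \<bullet> b) \<and> (\<forall>x. x \<notin> \<Omega> \<longrightarrow> w x = 0)" for b
  proof -
    have i: "integrable (lebesgue_on \<Omega>) (\<lambda>x. v x \<bullet> b)" using v by simp
    obtain w where w: "w \<in> borel_measurable borel" "AE x in lborel. x \<in> \<Omega> \<longrightarrow> w x = v x \<bullet> b" "\<And>x. x \<notin> \<Omega> \<Longrightarrow> w x = 0"
      using borel_representative_real[OF \<Omega> borel_measurable_integrable[OF i]] by metis
    have "AE x in lebesgue_on \<Omega>. v x \<bullet> b = w x"
      using w(2) unfolding AE_lebesgue_on_open[OF \<Omega>] by eventually_elim auto
    then have "integrable (lebesgue_on \<Omega>) w"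
      by (rule integrable_cong_AE_imp[OF i borel_measurable_lebesgue_on[OF w(1)]])
    then have "integrable lborel w" using integral_lebesgue_on_borel(2)[OF \<Omega> w(1,3)] by simp
    with w show ?thesis by blast
  qed
  then obtain w where w: "\<And>b. integrable lborel (w b)" "\<And>b. AE x in lborel. x \<in> \<Omega> \<longrightarrow> w b x = v x \<bullet> b"
    "\<And>b x. x \<notin> \<Omega> \<Longrightarrow> w b x = 0" by metis
  show ?thesis
  proof (rule that[of "\<lambda>x. \<Sum>b\<in>Basis. w b x *\<^sub>R b"])
    show "integrable lborel (\<lambda>x. \<Sum>b\<in>Basis. w b x *\<^sub>R b)"
      by (intro Bochner_Integration.integrable_sum integrable_scaleR_left w)
    have "AE x in lborel. \<forall>b\<in>Basis. x \<in> \<Omega> \<longrightarrow> w b x = v x \<bullet> b"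
      using w(2) by (subst AE_ball_countable) (auto simp: countable_finite)
    then show "AE x in lborel. x \<in> \<Omega> \<longrightarrow> (\<Sum>b\<in>Basis. w b x *\<^sub>R b) = v x"
      by eventually_elim (auto simp: euclidean_representation)
  qed (simp add: w(3))
qed

lemma L2_on_integrable:
  fixes v :: "'a::euclidean_space \<Rightarrow> 'b::euclidean_space"
  assumes "open \<Omega>" "bounded \<Omega>" and v: "L2_on \<Omega> v"
  shows "integrable (lebesgue_on \<Omega>) v"
proof (rule Bochner_Integration.integrable_bound)
  have "integrable (lebesgue_on \<Omega>) (\<lambda>x. indicator \<Omega> x + (norm (v x))\<^sup>2)"
    using v indicator_lebesgue_on(1)[OF assms(1,2), of \<Omega>] assms(1)
    by (intro Bochner_Integration.integrable_add) (auto simp: L2_on_def)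
  then show "integrable (lebesgue_on \<Omega>) (\<lambda>x. indicator \<Omega> x + (norm (v x))\<^sup>2)" .
  have "norm (v x) \<le> 1 + (norm (v x))\<^sup>2" for x
  proof -
    have "0 \<le> (norm (v x) - 1)\<^sup>2" by simp
    then have "2 * norm (v x) \<le> (norm (v x))\<^sup>2 + 1" by (simp add: power2_diff)
    then show ?thesis using norm_ge_zero[of "v x"] by linarith
  qed
  then show "AE x in lebesgue_on \<Omega>. norm (v x) \<le> norm (indicator \<Omega> x + (norm (v x))\<^sup>2)"
    using assms(1) by (intro AE_I2) (simp add: space_restrict_space)
qed (use v in \<open>simp add: L2_on_def\<close>)

text \<open>
  The arguments on segments use Fubini for the product of two Borel measures and composition with
  \<open>(x, t) \<mapsto> x + t *\<^sub>R h\<close>.  So the functions, given up to null sets of \<open>\<Omega>\<close>, are replaced by Borel functions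
  that vanish outside \<open>\<Omega>\<close>.
\<close>
lemma weak_gradient_borel_representatives:
  fixes V :: "'a::euclidean_space \<Rightarrow> real"
  assumes \<Omega>: "open \<Omega>" "bounded \<Omega>" and V: "L2_on \<Omega> V" and G: "L2_weak_gradient \<Omega> V G"
  obtains V1 G1 where "integrable lborel V1" "AE x in lborel. x \<in> \<Omega> \<longrightarrow> V1 x = V x"
    "integrable lborel G1" "AE x in lborel. x \<in> \<Omega> \<longrightarrow> G1 x = G x"
    "\<And>\<phi> b. test_function \<Omega> \<phi> \<Longrightarrow> b \<in> Basis \<Longrightarrow>
      (LINT x|lborel. V1 x * frechet_derivative \<phi> (at x) b) = - (LINT x|lborel. (G1 x \<bullet> b) * \<phi> x)"
proof -
  have G2: "L2_on \<Omega> G" using G by (simp add: L2_weak_gradient_def)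
  obtain V1 where V1: "integrable lborel V1" "AE x in lborel. x \<in> \<Omega> \<longrightarrow> V1 x = V x" "\<And>x. x \<notin> \<Omega> \<Longrightarrow> V1 x = 0"
    using borel_representative_integrable[OF \<Omega>(1) L2_on_integrable[OF \<Omega> V]] by metis
  obtain G1 where G1: "integrable lborel G1" "AE x in lborel. x \<in> \<Omega> \<longrightarrow> G1 x = G x" "\<And>x. x \<notin> \<Omega> \<Longrightarrow> G1 x = 0"
    using borel_representative_integrable[OF \<Omega>(1) L2_on_integrable[OF \<Omega> G2]] by metis
  have [measurable]: "V1 \<in> borel_measurable borel" "G1 \<in> borel_measurable borel" using V1 G1 by auto
  have VG[measurable]: "V \<in> borel_measurable (lebesgue_on \<Omega>)" "G \<in> borel_measurable (lebesgue_on \<Omega>)"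
    using V G2 by (auto simp: L2_on_def)
  show ?thesis
  proof (rule that[OF V1(1,2) G1(1,2)])
    fix \<phi> :: "'a \<Rightarrow> real" and b :: 'a assume \<phi>: "test_function \<Omega> \<phi>" and b: "b \<in> Basis"
    have m[measurable]: "\<phi> \<in> borel_measurable borel" "(\<lambda>x. frechet_derivative \<phi> (at x) b) \<in> borel_measurable borel"
      using test_function_props(1,3)[OF \<phi>] by (auto intro: borel_measurable_continuous_onI)
    note [measurable] = borel_measurable_lebesgue_on[OF m(1), of \<Omega>] borel_measurable_lebesgue_on[OF m(2), of \<Omega>]
      borel_measurable_lebesgue_on[of V1 \<Omega>] borel_measurable_lebesgue_on[of G1 \<Omega>]
    have "(LINT x|lborel. V1 x * frechet_derivative \<phi> (at x) b) = (LINT x|lebesgue_on \<Omega>. V1 x * frechet_derivative \<phi> (at x) b)"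
      by (subst integral_lebesgue_on_borel(1)[OF \<Omega>(1)]) (auto simp: V1(3))
    also have "\<dots> = (LINT x|lebesgue_on \<Omega>. V x * frechet_derivative \<phi> (at x) b)"
      using V1(2)[folded AE_lebesgue_on_open[OF \<Omega>(1)]] by (intro integral_cong_AE) auto
    also have "\<dots> = - (LINT x|lebesgue_on \<Omega>. (G x \<bullet> b) * \<phi> x)"
      using G \<phi> b by (simp add: L2_weak_gradient_def)
    also have "(LINT x|lebesgue_on \<Omega>. (G x \<bullet> b) * \<phi> x) = (LINT x|lebesgue_on \<Omega>. (G1 x \<bullet> b) * \<phi> x)"
      using G1(2)[folded AE_lebesgue_on_open[OF \<Omega>(1)]] by (intro integral_cong_AE) auto
    also have "\<dots> = (LINT x|lborel. (G1 x \<bullet> b) * \<phi> x)"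
      by (subst integral_lebesgue_on_borel(1)[OF \<Omega>(1)]) (auto simp: G1(3))
    finally show "(LINT x|lborel. V1 x * frechet_derivative \<phi> (at x) b) = - (LINT x|lborel. (G1 x \<bullet> b) * \<phi> x)" .
  qed
qed

text \<open>
  The factor \<open>indicator S (x, v x)\<close> is needed because \<open>F\<close> is continuous on \<open>S\<close> only.
\<close>
lemma borel_measurable_superposition:
  fixes F :: "'a::euclidean_space \<Rightarrow> real \<Rightarrow> 'b::euclidean_space"
  assumes "continuous_on S (\<lambda>(x, u). F x u)" "S \<in> sets borel" "v \<in> borel_measurable borel"
  shows "(\<lambda>x. indicator S (x, v x) *\<^sub>R F x (v x)) \<in> borel_measurable borel"
proof -
  have 1: "(\<lambda>p. indicator S p *\<^sub>R (\<lambda>(x, u). F x u) p) \<in> borel_measurable borel"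
    by (rule borel_measurable_continuous_on_indicator[OF assms(2,1)])
  have "(\<lambda>x. (x, v x)) \<in> borel_measurable borel"
    unfolding borel_prod[symmetric] using assms(3) by measurable
  from measurable_compose[OF this 1] show ?thesis by simp
qed

section \<open>Primitives in the density variable\<close>

text \<open>
  Both \<open>Phi\<close> and \<open>Phi_x\<close> are, up to sign, primitives of this kind, of integrands that may be singular
  at \<open>0\<close>.
\<close>
definition primitive :: "('a \<Rightarrow> real \<Rightarrow> 'b::{banach, second_countable_topology}) \<Rightarrow> 'a \<Rightarrow> real \<Rightarrow> 'b" where
  "primitive K x u = (LINT \<xi>|lborel. indicator {0<..<u} \<xi> *\<^sub>R K x \<xi>)"

lemma LBINT_eq_primitive: "0 \<le> u \<Longrightarrow> (LBINT \<xi>=0..ereal u. K x \<xi>) = primitive K x u"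
  by (simp add: interval_lebesgue_integral_le_eq set_lebesgue_integral_def primitive_def zero_ereal_def)

lemma primitive_integrand_measurable:
  fixes K :: "'a \<Rightarrow> real \<Rightarrow> 'b::{banach, second_countable_topology}"
  assumes "continuous_on {0<..} (K x)"
  shows "(\<lambda>\<xi>. indicator {0<..<u} \<xi> *\<^sub>R K x \<xi>) \<in> borel_measurable borel"
  by (intro borel_measurable_continuous_on_indicator continuous_on_subset[OF assms]) auto

lemma primitive_integrable:
  fixes K :: "'a \<Rightarrow> real \<Rightarrow> 'b::{banach, second_countable_topology}" and w :: "real \<Rightarrow> real"
  assumes "continuous_on {0<..} (K x)" "integrable lborel w"
    and "AE \<xi> in lborel. 0 < \<xi> \<and> \<xi> \<le> M \<longrightarrow> norm (K x \<xi>) \<le> w \<xi>" "u \<le> M"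
  shows "integrable lborel (\<lambda>\<xi>. indicator {0<..<u} \<xi> *\<^sub>R K x \<xi>)"
proof (rule Bochner_Integration.integrable_bound[OF assms(2)])
  show "AE \<xi> in lborel. norm (indicator {0<..<u} \<xi> *\<^sub>R K x \<xi>) \<le> norm (w \<xi>)"
    using assms(3) by eventually_elim (use assms(4) in \<open>auto simp: indicator_def\<close>)
qed (use primitive_integrand_measurable[of K x u, OF assms(1)] in simp)

lemma continuous_on_subst2:
  assumes "continuous_on (S \<times> T) (\<lambda>(x, u). K x u)" "continuous_on A X" "continuous_on A U"
    and "\<And>t. t \<in> A \<Longrightarrow> X t \<in> S" "\<And>t. t \<in> A \<Longrightarrow> U t \<in> T"
  shows "continuous_on A (\<lambda>t. K (X t) (U t))"
  using continuous_on_compose2[OF assms(1) continuous_on_Pair[OF assms(2,3)]] assms(4,5)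
  by (auto simp: image_subset_iff)

text \<open>
  Continuity is tested on sequences: the null set outside which \<open>w\<close> dominates depends on \<open>x\<close>, and a
  sequence involves only countably many such sets.
\<close>
lemma primitive_continuous_on:
  fixes K :: "'a::euclidean_space \<Rightarrow> real \<Rightarrow> 'b::{banach, second_countable_topology}"
  assumes cont: "continuous_on (\<Omega> \<times> {0<..}) (\<lambda>(x, \<xi>). K x \<xi>)"
    and w: "integrable lborel w" "\<And>\<xi>. 0 \<le> w \<xi>"
    and dom: "\<And>x. x \<in> \<Omega> \<Longrightarrow> AE \<xi> in lborel. 0 < \<xi> \<and> \<xi> \<le> M \<longrightarrow> norm (K x \<xi>) \<le> w \<xi>"
  shows "continuous_on (\<Omega> \<times> {0..M}) (\<lambda>(x, u). primitive K x u)"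
  unfolding continuous_on_sequentially
proof (intro ballI allI impI, elim conjE)
  fix X :: "nat \<Rightarrow> 'a \<times> real" and p
  assume X: "\<forall>n. X n \<in> \<Omega> \<times> {0..M}" "X \<longlonglongrightarrow> p" and p: "p \<in> \<Omega> \<times> {0..M}"
  obtain x u where xu: "p = (x, u)" by (cases p)
  have X1: "(\<lambda>n. fst (X n)) \<longlonglongrightarrow> x" "(\<lambda>n. snd (X n)) \<longlonglongrightarrow> u"
    using tendsto_fst[OF X(2)] tendsto_snd[OF X(2)] xu by auto
  have X2: "fst (X n) \<in> \<Omega>" "0 \<le> snd (X n)" "snd (X n) \<le> M" for n
    using X(1)[rule_format, of n] by auto
  have pc: "continuous_on {0<..} (K y)" if "y \<in> \<Omega>" for y
    by (rule continuous_on_subst2[OF cont continuous_on_const continuous_on_id]) (use that in auto)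
  have x: "x \<in> \<Omega>" using p xu by auto
  have "(\<lambda>n. LINT \<xi>|lborel. indicator {0<..<snd (X n)} \<xi> *\<^sub>R K (fst (X n)) \<xi>) \<longlonglongrightarrow>
      (LINT \<xi>|lborel. indicator {0<..<u} \<xi> *\<^sub>R K x \<xi>)"
  proof (rule integral_dominated_convergence[where w=w])
    show "integrable lborel w" by fact
    have "AE \<xi> in lborel. \<xi> \<noteq> u" by (rule AE_lborel_singleton)
    then show "AE \<xi> in lborel. (\<lambda>n. indicator {0<..<snd (X n)} \<xi> *\<^sub>R K (fst (X n)) \<xi>) \<longlonglongrightarrow>
        indicator {0<..<u} \<xi> *\<^sub>R K x \<xi>"
    proof eventually_elim
      case (elim \<xi>)
      consider "\<xi> \<le> 0" | "0 < \<xi>" "\<xi> < u" | "\<xi> > u" using elim by linarith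
      then show ?case
      proof cases
        case 1 then show ?thesis by (simp add: indicator_def)
      next
        case 2
        have "\<forall>\<^sub>F n in sequentially. \<xi> < snd (X n)" using X1(2) 2(2) by (rule order_tendstoD)
        moreover have "(\<lambda>n. K (fst (X n)) \<xi>) \<longlonglongrightarrow> K x \<xi>"
          using continuous_on_tendsto_compose[OF cont tendsto_Pair[OF X1(1) tendsto_const[of \<xi>]]] X2 x 2
          by simp
        ultimately show ?thesis
          using 2 by (auto intro: Lim_transform_eventually[rotated] elim!: eventually_mono)
      next
        case 3
        have "\<forall>\<^sub>F n in sequentially. \<xi> > snd (X n)" using X1(2) 3 by (rule order_tendstoD)
        then have "\<forall>\<^sub>F n in sequentially. 0 = indicator {0<..<snd (X n)} \<xi> *\<^sub>R K (fst (X n)) \<xi>"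
          by eventually_elim auto
        from Lim_transform_eventually[OF tendsto_const this] show ?thesis using 3 by simp
      qed
    qed
    show "AE \<xi> in lborel. norm (indicator {0<..<snd (X n)} \<xi> *\<^sub>R K (fst (X n)) \<xi>) \<le> w \<xi>" for n
      using dom[OF X2(1)[of n]] by eventually_elim (use X2(3)[of n] w(2) in \<open>auto simp: indicator_def\<close>)
    show "(\<lambda>\<xi>. indicator {0<..<u} \<xi> *\<^sub>R K x \<xi>) \<in> borel_measurable lborel"
      "(\<lambda>\<xi>. indicator {0<..<snd (X n)} \<xi> *\<^sub>R K (fst (X n)) \<xi>) \<in> borel_measurable lborel" for n
      using primitive_integrand_measurable[of K x u, OF pc[OF x]]
        primitive_integrand_measurable[of K "fst (X n)" "snd (X n)", OF pc[OF X2(1)]] by simp_all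
  qed
  then show "((\<lambda>(x, u). primitive K x u) \<circ> X) \<longlonglongrightarrow> (\<lambda>(x, u). primitive K x u) p"
    by (simp add: primitive_def o_def xu case_prod_unfold)
qed

text \<open>
  The number \<open>M\<close> is an upper bound for the densities under consideration, and \<open>w\<close> an integrable
  majorant on \<open>(0, M]\<close>, uniform in \<open>x\<close>, of the integrands that define \<open>Phi\<close> and \<open>Phi_x\<close>.
\<close>
locale regular_fitness =
  fixes \<Omega> :: "'a::euclidean_space set" and f :: "'a \<Rightarrow> real \<Rightarrow> real" and w :: "real \<Rightarrow> real" and M :: real
  assumes open_dom: "open \<Omega>"
    and der_u: "\<And>x u. x \<in> \<Omega> \<Longrightarrow> 0 < u \<Longrightarrow> (f x has_real_derivative f_u f x u) (at u)"
    and der_x: "\<And>x u. x \<in> \<Omega> \<Longrightarrow> 0 < u \<Longrightarrow> ((\<lambda>y. f y u) has_derivative (\<lambda>h. f_x f x u \<bullet> h)) (at x)"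
    and der_xu: "\<And>x u. x \<in> \<Omega> \<Longrightarrow> 0 < u \<Longrightarrow> (f_x f x has_vector_derivative f_xu f x u) (at u)"
    and cont_f: "continuous_on (\<Omega> \<times> {0<..}) (\<lambda>(x, u). f x u)"
    and cont_u: "continuous_on (\<Omega> \<times> {0<..}) (\<lambda>(x, u). f_u f x u)"
    and cont_x: "continuous_on (\<Omega> \<times> {0<..}) (\<lambda>(x, u). f_x f x u)"
    and cont_xu: "continuous_on (\<Omega> \<times> {0<..}) (\<lambda>(x, u). f_xu f x u)"
    and u_neg: "\<And>x u. x \<in> \<Omega> \<Longrightarrow> 0 < u \<Longrightarrow> f_u f x u < 0"
    and w_int: "integrable lborel w" and w_nonneg: "\<And>\<xi>. 0 \<le> w \<xi>"
    and dom: "\<And>x. x \<in> \<Omega> \<Longrightarrow> AE \<xi> in lborel. 0 < \<xi> \<and> \<xi> \<le> M \<longrightarrow>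
                \<xi> * \<bar>f_u f x \<xi>\<bar> + \<xi> * norm (f_xu f x \<xi>) \<le> w \<xi>"
begin

lemma dom_u: "x \<in> \<Omega> \<Longrightarrow> AE \<xi> in lborel. 0 < \<xi> \<and> \<xi> \<le> M \<longrightarrow> norm (\<xi> * f_u f x \<xi>) \<le> w \<xi>"
proof -
  assume "x \<in> \<Omega>"
  from dom[OF this] show ?thesis
  proof eventually_elim
    case (elim \<xi>)
    show ?case
    proof
      assume \<xi>: "0 < \<xi> \<and> \<xi> \<le> M"
      then have "norm (\<xi> * f_u f x \<xi>) \<le> \<xi> * \<bar>f_u f x \<xi>\<bar> + \<xi> * norm (f_xu f x \<xi>)"
        by (simp add: abs_mult)
      with elim \<xi> show "norm (\<xi> * f_u f x \<xi>) \<le> w \<xi>" by linarith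
    qed
  qed
qed

lemma dom_xu: "x \<in> \<Omega> \<Longrightarrow> AE \<xi> in lborel. 0 < \<xi> \<and> \<xi> \<le> M \<longrightarrow> norm (\<xi> *\<^sub>R f_xu f x \<xi>) \<le> w \<xi>"
proof -
  assume "x \<in> \<Omega>"
  from dom[OF this] show ?thesis
  proof eventually_elim
    case (elim \<xi>)
    show ?case
    proof
      assume \<xi>: "0 < \<xi> \<and> \<xi> \<le> M"
      then have "norm (\<xi> *\<^sub>R f_xu f x \<xi>) \<le> \<xi> * \<bar>f_u f x \<xi>\<bar> + \<xi> * norm (f_xu f x \<xi>)"
        by simp
      with elim \<xi> show "norm (\<xi> *\<^sub>R f_xu f x \<xi>) \<le> w \<xi>" by linarith
    qed
  qed
qed

lemma slice:
  assumes "x \<in> \<Omega>" "continuous_on (\<Omega> \<times> {0<..}) (\<lambda>(x, u). K x u)"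
  shows "continuous_on {0<..} (K x)"
  by (rule continuous_on_subst2[OF assms(2) continuous_on_const continuous_on_id]) (use assms(1) in auto)

lemma cont_mu: "continuous_on (\<Omega> \<times> {0<..}) (\<lambda>(x, \<xi>). \<xi> * f_u f x \<xi>)"
  using continuous_on_mult[OF continuous_on_snd[OF continuous_on_id] cont_u] by (simp add: case_prod_unfold)

lemma cont_mxu: "continuous_on (\<Omega> \<times> {0<..}) (\<lambda>(x, \<xi>). \<xi> *\<^sub>R f_xu f x \<xi>)"
  using continuous_on_scaleR[OF continuous_on_snd[OF continuous_on_id] cont_xu] by (simp add: case_prod_unfold)

lemma Phi_primitive: "0 \<le> u \<Longrightarrow> Phi f x u = - primitive (\<lambda>x \<xi>. \<xi> * f_u f x \<xi>) x u"
  using LBINT_eq_primitive[of u "\<lambda>x \<xi>. \<xi> * f_u f x \<xi>" x] by (simp only: Phi_def)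

lemma Phi_x_primitive: "0 \<le> u \<Longrightarrow> Phi_x f x u = - primitive (\<lambda>x \<xi>. \<xi> *\<^sub>R f_xu f x \<xi>) x u"
  using LBINT_eq_primitive[of u "\<lambda>x \<xi>. \<xi> *\<^sub>R f_xu f x \<xi>" x] by (simp only: Phi_x_def)

lemma Phi_continuous: "continuous_on (\<Omega> \<times> {0..M}) (\<lambda>(x, u). Phi f x u)"
  by (rule continuous_on_eq[OF continuous_on_minus[OF primitive_continuous_on[OF cont_mu w_int w_nonneg dom_u]]])
     (auto simp: Phi_primitive)

lemma Phi_x_continuous: "continuous_on (\<Omega> \<times> {0..M}) (\<lambda>(x, u). Phi_x f x u)"
  by (rule continuous_on_eq[OF continuous_on_minus[OF primitive_continuous_on[OF cont_mxu w_int w_nonneg dom_xu]]])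
     (auto simp: Phi_x_primitive)

lemma int_u: "x \<in> \<Omega> \<Longrightarrow> u \<le> M \<Longrightarrow> integrable lborel (\<lambda>\<xi>. indicator {0<..<u} \<xi> *\<^sub>R (\<xi> * f_u f x \<xi>))"
  by (rule primitive_integrable[OF slice[OF _ cont_mu] w_int dom_u, where u=u])

lemma int_xu: "x \<in> \<Omega> \<Longrightarrow> u \<le> M \<Longrightarrow> integrable lborel (\<lambda>\<xi>. indicator {0<..<u} \<xi> *\<^sub>R (\<xi> *\<^sub>R f_xu f x \<xi>))"
  by (rule primitive_integrable[OF slice[OF _ cont_mxu] w_int dom_xu, where u=u])

lemma f_strict_decreasing: "x \<in> \<Omega> \<Longrightarrow> 0 < u \<Longrightarrow> u < v \<Longrightarrow> f x v < f x u"
  by (rule DERIV_neg_imp_decreasing) (auto intro!: exI[of _ "f_u f x _"] der_u u_neg)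

text \<open>
  The derivative of \<open>Phi f x\<close> is \<open>- \<xi> f_u\<close>, so an increment of \<open>Phi\<close> is an increment of \<open>- f\<close> with weights
  between \<open>u\<close> and \<open>v\<close>.
\<close>
lemma Phi_diff_bounds:
  assumes x: "x \<in> \<Omega>" and uv: "0 < u" "u \<le> v" "v \<le> M"
  shows "u * (f x u - f x v) \<le> Phi f x v - Phi f x u" "Phi f x v - Phi f x u \<le> v * (f x u - f x v)"
proof -
  let ?g = "\<lambda>\<xi>. indicator {u..v} \<xi> * f_u f x \<xi>"
  have c: "continuous_on {u..v} (f_u f x)"
    by (rule continuous_on_subset[OF slice[OF x cont_u]]) (use uv in auto)
  have gi: "integrable lborel ?g"
    using borel_integrable_compact[OF _ c] by (simp add: mult.commute)
  have FTC: "(LINT \<xi>|lborel. ?g \<xi>) = f x v - f x u"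
  proof -
    have d: "(f x has_vector_derivative f_u f x t) (at t within {u..v})" if "u \<le> t" "t \<le> v" for t
      using has_field_derivative_at_within[OF der_u[OF x]] that uv
      by (auto simp: has_real_derivative_iff_has_vector_derivative)
    from integral_FTC_Icc[OF uv(2) d c] show ?thesis by simp
  qed
  have "Phi f x v - Phi f x u = (LINT \<xi>|lborel. indicator {0<..<u} \<xi> *\<^sub>R (\<xi> * f_u f x \<xi>)) -
      (LINT \<xi>|lborel. indicator {0<..<v} \<xi> *\<^sub>R (\<xi> * f_u f x \<xi>))"
    using uv by (simp add: Phi_primitive primitive_def)
  also have "\<dots> = (LINT \<xi>|lborel. indicator {0<..<u} \<xi> *\<^sub>R (\<xi> * f_u f x \<xi>) - indicator {0<..<v} \<xi> *\<^sub>R (\<xi> * f_u f x \<xi>))"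
    using uv by (intro Bochner_Integration.integral_diff[symmetric] int_u x) auto
  finally have eq: "Phi f x v - Phi f x u = \<dots>" .
  have id: "integrable lborel (\<lambda>\<xi>. indicator {0<..<u} \<xi> *\<^sub>R (\<xi> * f_u f x \<xi>) - indicator {0<..<v} \<xi> *\<^sub>R (\<xi> * f_u f x \<xi>))"
    using uv by (intro Bochner_Integration.integrable_diff int_u x) auto
  have neg: "f_u f x \<xi> < 0" if "\<xi> > 0" for \<xi> using u_neg[OF x that] .
  have ae: "AE \<xi> in lborel. \<xi> \<noteq> u \<and> \<xi> \<noteq> v"
    using AE_lborel_singleton[of u] AE_lborel_singleton[of v] by eventually_elim auto
  have scale: "(LINT \<xi>|lborel. c * ?g \<xi>) = c * (f x v - f x u)" for c
    by (subst integral_mult_right_zero) (simp only: FTC)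
  have "u * (f x u - f x v) = (LINT \<xi>|lborel. - u * ?g \<xi>)"
    unfolding scale by (simp add: algebra_simps)
  also have "\<dots> \<le> Phi f x v - Phi f x u"
    unfolding eq
  proof (rule integral_mono_AE)
    show "AE \<xi> in lborel. - u * ?g \<xi> \<le> indicator {0<..<u} \<xi> *\<^sub>R (\<xi> * f_u f x \<xi>) - indicator {0<..<v} \<xi> *\<^sub>R (\<xi> * f_u f x \<xi>)"
      using ae
    proof eventually_elim
      case (elim \<xi>)
      have "\<xi> * f_u f x \<xi> \<le> u * f_u f x \<xi>" if "u \<le> \<xi>"
        using neg[of \<xi>] that uv by (intro mult_right_mono_neg) auto
      with elim uv show ?case by (auto simp: indicator_def)
    qed
  qed (use gi id in auto)
  finally show "u * (f x u - f x v) \<le> Phi f x v - Phi f x u" .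
  have "Phi f x v - Phi f x u \<le> (LINT \<xi>|lborel. - v * ?g \<xi>)"
    unfolding eq
  proof (rule integral_mono_AE)
    show "AE \<xi> in lborel. indicator {0<..<u} \<xi> *\<^sub>R (\<xi> * f_u f x \<xi>) - indicator {0<..<v} \<xi> *\<^sub>R (\<xi> * f_u f x \<xi>) \<le> - v * ?g \<xi>"
      using ae
    proof eventually_elim
      case (elim \<xi>)
      have "v * f_u f x \<xi> \<le> \<xi> * f_u f x \<xi>" if "u \<le> \<xi>" "\<xi> \<le> v"
        using neg[of \<xi>] that uv by (intro mult_right_mono_neg) auto
      with elim uv show ?case by (auto simp: indicator_def)
    qed
  qed (use gi id in auto)
  also have "\<dots> = v * (f x u - f x v)"
    unfolding scale by (simp add: algebra_simps)
  finally show "Phi f x v - Phi f x u \<le> v * (f x u - f x v)" .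
qed

text \<open>
  This is what allows the density to be recovered from \<open>Phi\<close>, for which alone a weak gradient is
  given.
\<close>
lemma Phi_strict_mono:
  assumes x: "x \<in> \<Omega>" and uv: "0 \<le> u" "u < v" "v \<le> M"
  shows "Phi f x u < Phi f x v"
proof -
  define c where "c = (u + v) / 2"
  have c: "0 < c" "u < c" "c < v" using uv by (auto simp: c_def)
  have "0 < c * (f x c - f x v)" using f_strict_decreasing[OF x c(1,3)] c by simp
  also have "\<dots> \<le> Phi f x v - Phi f x c" using Phi_diff_bounds(1)[OF x c(1), of v] c uv by simp
  finally have 1: "Phi f x c < Phi f x v" by simp
  have "Phi f x u \<le> Phi f x c"
  proof (cases "u = 0")
    case True
    have "0 \<le> (LINT \<xi>|lborel. - (indicator {0<..<c} \<xi> *\<^sub>R (\<xi> * f_u f x \<xi>)))"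
    proof (rule Bochner_Integration.integral_nonneg)
      fix \<xi> show "0 \<le> - (indicator {0<..<c} \<xi> *\<^sub>R (\<xi> * f_u f x \<xi>))"
        using mult_nonneg_nonpos[of \<xi> "f_u f x \<xi>"] u_neg[OF x, of \<xi>] by (auto simp: indicator_def)
    qed
    then show ?thesis using True c by (simp add: Phi_primitive primitive_def)
  next
    case False
    have "0 \<le> u * (f x u - f x c)" using f_strict_decreasing[OF x, of u c] False uv c by simp
    also have "\<dots> \<le> Phi f x c - Phi f x u" using Phi_diff_bounds(1)[OF x, of u c] False c uv by simp
    finally show ?thesis by simp
  qed
  with 1 show ?thesis by simp
qed

lemma f_along_segment:
  assumes seg: "x \<in> segment_dom \<Omega> h" and ab: "0 \<le> a" "a \<le> b" "b \<le> 1" and u: "0 < u"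
  shows "((\<lambda>t. f_x f (x + t *\<^sub>R h) u \<bullet> h) has_integral f (x + b *\<^sub>R h) u - f (x + a *\<^sub>R h) u) {a..b}"
proof (rule fundamental_theorem_of_calculus[OF ab(2)])
  fix t assume t: "t \<in> {a..b}"
  then have xt: "x + t *\<^sub>R h \<in> \<Omega>" using segment_domD[OF seg, of t] ab by auto
  have "((\<lambda>t. x + t *\<^sub>R h) has_derivative (\<lambda>s. s *\<^sub>R h)) (at t within {a..b})"
    by (auto intro!: derivative_eq_intros)
  from has_derivative_compose[OF this der_x[OF xt u]]
  show "((\<lambda>t. f (x + t *\<^sub>R h) u) has_vector_derivative f_x f (x + t *\<^sub>R h) u \<bullet> h) (at t within {a..b})"
    by (simp add: has_vector_derivative_def)
qed

text \<open>
  Obtained by differentiating \<open>f_along_segment\<close> with respect to \<open>u\<close> under the integral sign.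
\<close>
lemma f_u_along_segment:
  assumes seg: "x \<in> segment_dom \<Omega> h" and ab: "0 \<le> a" "a \<le> b" "b \<le> 1" and u: "0 < u"
  shows "f_u f (x + b *\<^sub>R h) u - f_u f (x + a *\<^sub>R h) u =
    integral {a..b} (\<lambda>t. f_xu f (x + t *\<^sub>R h) u \<bullet> h)"
proof -
  have xt: "x + t *\<^sub>R h \<in> \<Omega>" if "t \<in> {a..b}" for t using segment_domD[OF seg, of t] ab that by auto
  have "((\<lambda>v. integral (cbox a b) (\<lambda>t. f_x f (x + t *\<^sub>R h) v \<bullet> h)) has_field_derivative
      integral (cbox a b) (\<lambda>t. f_xu f (x + t *\<^sub>R h) u \<bullet> h)) (at u within {0<..})"
  proof (rule leibniz_rule_field_derivative)
    show "((\<lambda>v. f_x f (x + t *\<^sub>R h) v \<bullet> h) has_field_derivative f_xu f (x + t *\<^sub>R h) v \<bullet> h) (at v within {0<..})"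
      if "v \<in> {0<..}" "t \<in> cbox a b" for v t :: real
    proof -
      have "((\<lambda>v. f_x f (x + t *\<^sub>R h) v \<bullet> h) has_vector_derivative f_xu f (x + t *\<^sub>R h) v \<bullet> h) (at v)"
        using der_xu[OF xt, of t v] that
        by (intro bounded_linear.has_vector_derivative[OF bounded_linear_inner_left]) auto
      then show ?thesis
        by (simp add: has_real_derivative_iff_has_vector_derivative has_vector_derivative_at_within)
    qed
    show "(\<lambda>t. f_x f (x + t *\<^sub>R h) v \<bullet> h) integrable_on cbox a b" if "v \<in> {0<..}" for v
      using f_along_segment[OF seg ab, of v] that by auto
    have "continuous_on ({0<..} \<times> cbox a b) (\<lambda>p. f_xu f (x + snd p *\<^sub>R h) (fst p))"
      by (rule continuous_on_subst2[OF cont_xu]) (auto intro!: continuous_intros xt)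
    then show "continuous_on ({0<..} \<times> cbox a b) (\<lambda>(v, t). f_xu f (x + t *\<^sub>R h) v \<bullet> h)"
      by (auto intro!: continuous_intros simp: case_prod_unfold)
  qed (use u in auto)
  then have 1: "((\<lambda>v. integral {a..b} (\<lambda>t. f_x f (x + t *\<^sub>R h) v \<bullet> h)) has_field_derivative
      integral {a..b} (\<lambda>t. f_xu f (x + t *\<^sub>R h) u \<bullet> h)) (at u)"
    using u by (simp add: at_within_open[of u "{0<..}"])
  have "((\<lambda>v. f (x + b *\<^sub>R h) v - f (x + a *\<^sub>R h) v) has_field_derivative
     f_u f (x + b *\<^sub>R h) u - f_u f (x + a *\<^sub>R h) u) (at u)"
    using ab u by (intro DERIV_diff der_u xt) auto
  then have "((\<lambda>v. integral {a..b} (\<lambda>t. f_x f (x + t *\<^sub>R h) v \<bullet> h)) has_field_derivative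
     f_u f (x + b *\<^sub>R h) u - f_u f (x + a *\<^sub>R h) u) (at u)"
    by (rule has_field_derivative_transform_within_open[where S="{0<..}"])
       (use u integral_unique[OF f_along_segment[OF seg ab]] in auto)
  from DERIV_unique[OF this 1] show ?thesis .
qed

text \<open>
  Insert \<open>f_u_along_segment\<close> into the definition of \<open>Phi\<close> and apply Fubini, with \<open>w\<close> as a majorant
  at each point of the segment.
\<close>
lemma Phi_along_segment:
  assumes seg: "x \<in> segment_dom \<Omega> h" and ab: "0 \<le> a" "a \<le> b" "b \<le> 1" and u: "0 \<le> u" "u \<le> M"
  shows "((\<lambda>t. Phi_x f (x + t *\<^sub>R h) u \<bullet> h) has_integral Phi f (x + b *\<^sub>R h) u - Phi f (x + a *\<^sub>R h) u) {a..b}"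
proof -
  have xt: "x + t *\<^sub>R h \<in> \<Omega>" if "t \<in> {a..b}" for t using segment_domD[OF seg, of t] ab that by auto
  define H where "H = (\<lambda>(t, \<xi>). indicator ({a..b} \<times> {0<..<u}) (t, \<xi>) *\<^sub>R (\<xi> *\<^sub>R f_xu f (x + t *\<^sub>R h) \<xi>))"
  have Hs: "H (t, \<xi>) = indicator {a..b} t *\<^sub>R (indicator {0<..<u} \<xi> *\<^sub>R (\<xi> *\<^sub>R f_xu f (x + t *\<^sub>R h) \<xi>))" for t \<xi>
    by (auto simp: H_def indicator_def)
  have "continuous_on ({a..b} \<times> {0<..<u}) (\<lambda>p. snd p *\<^sub>R f_xu f (x + fst p *\<^sub>R h) (snd p))"
    by (intro continuous_on_scaleR continuous_on_subst2[OF cont_xu]) (auto intro!: continuous_intros xt)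
  moreover have "{a..b} \<times> {0<..<u} \<in> sets borel" by (intro borel_Times) auto
  ultimately have "(\<lambda>p. indicator ({a..b} \<times> {0<..<u}) p *\<^sub>R (snd p *\<^sub>R f_xu f (x + fst p *\<^sub>R h) (snd p))) \<in> borel_measurable borel"
    by (intro borel_measurable_continuous_on_indicator)
  then have Hm: "H \<in> borel_measurable (lborel \<Otimes>\<^sub>M lborel)"
    by (simp add: H_def case_prod_unfold lborel_prod)
  have Hint: "integrable (lborel \<Otimes>\<^sub>M lborel) H"
  proof -
    have "(\<integral>\<^sup>+p. ennreal (norm (H p)) \<partial>(lborel \<Otimes>\<^sub>M lborel)) = (\<integral>\<^sup>+t. \<integral>\<^sup>+\<xi>. ennreal (norm (H (t, \<xi>))) \<partial>lborel \<partial>lborel)"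
      using Hm by (subst lborel.nn_integral_fst[symmetric]) auto
    also have "\<dots> \<le> (\<integral>\<^sup>+t. indicator {a..b} t * (\<integral>\<^sup>+\<xi>. ennreal (w \<xi>) \<partial>lborel) \<partial>lborel)"
    proof (rule nn_integral_mono)
      fix t :: real
      show "(\<integral>\<^sup>+\<xi>. ennreal (norm (H (t, \<xi>))) \<partial>lborel) \<le> indicator {a..b} t * (\<integral>\<^sup>+\<xi>. ennreal (w \<xi>) \<partial>lborel)"
      proof (cases "t \<in> {a..b}")
        case True
        have "AE \<xi> in lborel. ennreal (norm (H (t, \<xi>))) \<le> ennreal (w \<xi>)"
          using dom_xu[OF xt[OF True]] by eventually_elim (use u w_nonneg in \<open>auto simp: Hs indicator_def intro!: ennreal_leI\<close>)
        then show ?thesis using True by (auto intro: nn_integral_mono_AE)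
      qed (simp add: Hs)
    qed
    also have "\<dots> = ennreal (b - a) * (\<integral>\<^sup>+\<xi>. ennreal (w \<xi>) \<partial>lborel)"
      using ab w_int by (subst nn_integral_multc) auto
    also have "\<dots> < \<infinity>"
      using w_int w_nonneg by (auto simp: integrable_iff_bounded ennreal_mult_less_top)
    finally show ?thesis using Hm by (simp add: integrable_iff_bounded)
  qed
  have Hh: "integrable (lborel \<Otimes>\<^sub>M lborel) (\<lambda>(t, \<xi>). H (t, \<xi>) \<bullet> h)"
    using integrable_inner_left[OF Hint, of h] by (simp add: case_prod_unfold)
  have inner: "(LINT \<xi>|lborel. H (t, \<xi>) \<bullet> h) = indicator {a..b} t *\<^sub>R - (Phi_x f (x + t *\<^sub>R h) u \<bullet> h)" for t
  proof (cases "t \<in> {a..b}")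
    case True
    then show ?thesis
      using integral_inner_left[OF int_xu[OF xt[OF True] u(2)], of h] u
      by (simp add: Hs Phi_x_primitive primitive_def)
  qed (simp add: Hs)
  have intP: "integrable lborel (\<lambda>t. indicator {a..b} t *\<^sub>R - (Phi_x f (x + t *\<^sub>R h) u \<bullet> h))"
    using lborel_pair.integrable_fst'[OF Hh] by (simp add: inner)
  have "(LINT t|lborel. indicator {a..b} t *\<^sub>R - (Phi_x f (x + t *\<^sub>R h) u \<bullet> h)) = (LINT t|lborel. LINT \<xi>|lborel. H (t, \<xi>) \<bullet> h)"
    by (simp add: inner)
  also have "\<dots> = (LINT \<xi>|lborel. LINT t|lborel. H (t, \<xi>) \<bullet> h)"
    by (rule lborel_pair.Fubini_integral[OF Hh, symmetric])
  also have "\<dots> = (LINT \<xi>|lborel. indicator {0<..<u} \<xi> *\<^sub>R (\<xi> * f_u f (x + b *\<^sub>R h) \<xi>) - indicator {0<..<u} \<xi> *\<^sub>R (\<xi> * f_u f (x + a *\<^sub>R h) \<xi>))"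
  proof (rule Bochner_Integration.integral_cong[OF refl])
    fix \<xi> :: real
    show "(LINT t|lborel. H (t, \<xi>) \<bullet> h) = indicator {0<..<u} \<xi> *\<^sub>R (\<xi> * f_u f (x + b *\<^sub>R h) \<xi>) - indicator {0<..<u} \<xi> *\<^sub>R (\<xi> * f_u f (x + a *\<^sub>R h) \<xi>)"
    proof (cases "\<xi> \<in> {0<..<u}")
      case True
      have c: "continuous_on {a..b} (\<lambda>t. f_xu f (x + t *\<^sub>R h) \<xi> \<bullet> h)"
        using True by (intro continuous_on_inner continuous_on_subst2[OF cont_xu]) (auto intro!: continuous_intros xt)
      have "set_integrable lborel {a..b} (\<lambda>t. f_xu f (x + t *\<^sub>R h) \<xi> \<bullet> h)"
        using borel_integrable_compact[OF _ c] by (simp add: set_integrable_def indicator_def)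
      then have "(LINT t|lborel. indicator {a..b} t *\<^sub>R (f_xu f (x + t *\<^sub>R h) \<xi> \<bullet> h)) = f_u f (x + b *\<^sub>R h) \<xi> - f_u f (x + a *\<^sub>R h) \<xi>"
        using f_u_along_segment[OF seg ab, of \<xi>] True
        by (subst set_borel_integral_eq_integral(2)[unfolded set_lebesgue_integral_def]) auto
      moreover have "(LINT t|lborel. H (t, \<xi>) \<bullet> h) = (LINT t|lborel. \<xi> * (indicator {a..b} t *\<^sub>R (f_xu f (x + t *\<^sub>R h) \<xi> \<bullet> h)))"
        using True by (intro Bochner_Integration.integral_cong) (auto simp: Hs)
      ultimately show ?thesis using True by (simp add: right_diff_distrib)
    qed (simp add: Hs)
  qed
  also have "\<dots> = Phi f (x + a *\<^sub>R h) u - Phi f (x + b *\<^sub>R h) u"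
    using u ab xt by (subst Bochner_Integration.integral_diff) (auto simp: Phi_primitive primitive_def simp del: real_scaleR_def intro!: int_u)
  finally have val: "(LINT t|lborel. indicator {a..b} t *\<^sub>R (Phi_x f (x + t *\<^sub>R h) u \<bullet> h)) = Phi f (x + b *\<^sub>R h) u - Phi f (x + a *\<^sub>R h) u"
    by simp
  have "set_integrable lborel {a..b} (\<lambda>t. Phi_x f (x + t *\<^sub>R h) u \<bullet> h)"
    using integrable_minus[OF intP] by (simp add: set_integrable_def)
  from set_borel_integral_eq_integral[OF this] val
  show ?thesis by (simp add: has_integral_integrable_integral set_lebesgue_integral_def)
qed

end

section \<open>Variation of the fitness along one segment\<close>

text \<open>
  Both the integral and the error \<open>e * (s' - s)\<close> are additive, so the bound on short intervals adds up
  to the bound on \<open>{a..b}\<close> with error \<open>e * (b - a)\<close>, and \<open>e\<close> is arbitrary.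
\<close>
lemma increment_bound_local_to_global:
  fixes k N :: "real \<Rightarrow> real"
  assumes ab: "a \<le> b" and N: "N integrable_on {a..b}"
    and loc: "\<And>e. e > 0 \<Longrightarrow> \<exists>d>0. \<forall>s s'. a \<le> s \<and> s \<le> s' \<and> s' \<le> b \<and> s' - s < d \<longrightarrow>
      \<bar>k s' - k s\<bar> \<le> integral {s..s'} N + e * (s' - s)"
  shows "\<bar>k b - k a\<bar> \<le> integral {a..b} N"
proof -
  have *: "\<bar>k b - k a\<bar> \<le> integral {a..b} N + e * (b - a)" if e: "e > 0" for e
  proof -
    obtain d where d: "d > 0" and
      step: "\<And>s s'. a \<le> s \<Longrightarrow> s \<le> s' \<Longrightarrow> s' \<le> b \<Longrightarrow> s' - s < d \<Longrightarrow>
        \<bar>k s' - k s\<bar> \<le> integral {s..s'} N + e * (s' - s)"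
      using loc[OF e] by blast
    have *: "\<bar>k s' - k s\<bar> \<le> integral {s..s'} N + e * (s' - s)"
      if "a \<le> s" "s \<le> s'" "s' \<le> b" "s' - s \<le> real n * (d / 2)" for n s s'
      using that
    proof (induction n arbitrary: s)
      case 0
      then show ?case using step[of s s'] d by simp
    next
      case (Suc n)
      show ?case
      proof (cases "s' - s < d")
        case True
        with step Suc.prems show ?thesis by blast
      next
        case False
        define c where "c = s + d / 2"
        have c: "s \<le> c" "c \<le> s'" "c - s < d" using False d by (auto simp: c_def)
        have "s' - c \<le> real n * (d / 2)" using Suc.prems(4) by (simp add: c_def algebra_simps)
        then have 1: "\<bar>k s' - k c\<bar> \<le> integral {c..s'} N + e * (s' - c)"
          using Suc.IH[of c] Suc.prems c by simp
        have 2: "\<bar>k c - k s\<bar> \<le> integral {s..c} N + e * (c - s)"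
          using step[of s c] Suc.prems c by simp
        have "N integrable_on {s..s'}"
          by (rule integrable_on_subinterval[OF N]) (use Suc.prems in auto)
        from Henstock_Kurzweil_Integration.integral_combine[OF c(1,2) this] 1 2
        show ?thesis by (simp add: algebra_simps)
      qed
    qed
    obtain n :: nat where "(b - a) / (d / 2) \<le> real n" using real_arch_simple by blast
    then have "b - a \<le> real n * (d / 2)" using d by (simp add: field_simps)
    with *[of a b n] ab show ?thesis by simp
  qed
  have "\<bar>k b - k a\<bar> \<le> integral {a..b} N + e" if "e > 0" for e
  proof (cases "a = b")
    case False
    then show ?thesis using *[of "e / (b - a)"] that ab by simp
  qed (use that in simp)
  then show ?thesis by (rule field_le_epsilon)
qed

lemma first_passage:
  fixes k :: "real \<Rightarrow> real"
  assumes ab: "a \<le> b" and k: "continuous_on {a..b} k" "e \<le> k a" "k b \<le> e"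
  obtains s where "a \<le> s" "s \<le> b" "k s = e" "\<And>t. a \<le> t \<Longrightarrow> t \<le> s \<Longrightarrow> e \<le> k t"
proof -
  define Z where "Z = {a..b} \<inter> k -` {..e}"
  have "closed Z" unfolding Z_def by (rule continuous_closed_preimage[OF k(1)]) auto
  then have "compact ({a..b} \<inter> Z)" by (intro compact_Int_closed) auto
  moreover have "{a..b} \<inter> Z = Z" by (auto simp: Z_def)
  moreover have "b \<in> Z" using ab k by (simp add: Z_def)
  ultimately obtain s where "s \<in> Z" "\<And>t. t \<in> Z \<Longrightarrow> s \<le> t"
    using compact_attains_inf[of Z] by auto
  then have s: "s \<in> {a..b}" "k s \<le> e" "\<And>t. t \<in> {a..b} \<Longrightarrow> k t \<le> e \<Longrightarrow> s \<le> t"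
    by (auto simp: Z_def)
  have above: "e < k t" if "a \<le> t" "t < s" for t
    using s(1) s(3)[of t] that by force
  have "k s = e"
  proof (rule ccontr)
    assume "k s \<noteq> e"
    then obtain t where "a \<le> t" "t \<le> s" "k t = e"
      using IVT2'[of k s e a] k(2) s continuous_on_subset[OF k(1), of "{a..s}"] by auto
    with above[of t] \<open>k s \<noteq> e\<close> show False by (cases "t = s") auto
  qed
  moreover have "e \<le> k t" if "a \<le> t" "t \<le> s" for t
    using above[of t] that \<open>k s = e\<close> by (cases "t = s") auto
  ultimately show ?thesis using s(1) by (intro that[of s]) auto
qed

context regular_fitness
begin

lemma Phi_diff_mvt:
  assumes x: "x \<in> \<Omega>" and u: "0 < u" "u \<le> M" and v: "0 < v" "v \<le> M"
  obtains \<xi> where "min u v \<le> \<xi>" "\<xi> \<le> max u v" "Phi f x v - Phi f x u = \<xi> * (f x u - f x v)"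
proof -
  have *: "\<exists>\<xi>. u \<le> \<xi> \<and> \<xi> \<le> v \<and> Phi f x v - Phi f x u = \<xi> * (f x u - f x v)"
    if u: "0 < u" and uv: "u < v" "v \<le> M" for u v
  proof -
    have pos: "f x u - f x v > 0" using f_strict_decreasing[OF x u uv(1)] by simp
    show ?thesis
      using Phi_diff_bounds[OF x u _ uv(2)] uv pos
      by (intro exI[of _ "(Phi f x v - Phi f x u) / (f x u - f x v)"]) (auto simp: field_simps)
  qed
  consider "u = v" | "u < v" | "v < u" by linarith
  then show ?thesis
  proof cases
    case 1 then show ?thesis by (intro that[of u]) auto
  next
    case 2 then show ?thesis using *[of u v] u v that by auto
  next
    case 3
    then obtain \<xi> where "v \<le> \<xi>" "\<xi> \<le> u" "Phi f x u - Phi f x v = \<xi> * (f x v - f x u)"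
      using *[of v u] u v by auto
    with 3 show ?thesis by (intro that[of \<xi>]) (auto simp: algebra_simps)
  qed
qed

text \<open>
  A chain rule for the fitness along a segment: formally its derivative is \<open>W / \<upsilon>\<close>.  Here \<open>\<upsilon>\<close> is merely
  continuous, while \<open>Phi\<close> along the segment is the integral of an \<open>L\<^sup>1\<close> function \<open>\<gamma>\<close>.  Splitting an increment of
  \<open>Phi\<close> into its \<open>x\<close>-part and its \<open>u\<close>-part, and writing the latter as \<open>\<xi>\<close> times an increment of
  \<open>- f\<close>, gives the exact identity
  \<open>\<xi> * (f (x + s' h) u' - f (x + s h) u) = \<integral> - \<gamma> + Phi_x (x + t h) u' \<bullet> h + \<xi> * (f_x (x + t h) u' \<bullet> h)\<close>
  over \<open>{s..s'}\<close>, with \<open>\<xi>\<close> between \<open>u = \<upsilon> s\<close> and \<open>u' = \<upsilon> s'\<close>.  On short intervals \<open>\<xi>\<close> and \<open>u'\<close> may be replaced by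
  \<open>\<upsilon> t\<close> at the cost of a uniformly small error.
\<close>
lemma fitness_increment_along_segment:
  fixes \<gamma> \<upsilon> :: "real \<Rightarrow> real"
  assumes seg: "x \<in> segment_dom \<Omega> h" and ab: "0 \<le> a" "a \<le> b" "b \<le> 1"
    and cont: "continuous_on {a..b} \<upsilon>" and range: "\<And>t. t \<in> {a..b} \<Longrightarrow> \<delta> \<le> \<upsilon> t \<and> \<upsilon> t \<le> M" and \<delta>: "0 < \<delta>"
    and \<gamma>: "set_integrable lborel {a..b} \<gamma>"
    and eq: "\<And>s s'. a \<le> s \<Longrightarrow> s \<le> s' \<Longrightarrow> s' \<le> b \<Longrightarrow>
      Phi f (x + s' *\<^sub>R h) (\<upsilon> s') - Phi f (x + s *\<^sub>R h) (\<upsilon> s) = integral {s..s'} \<gamma>"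
  defines "W \<equiv> \<lambda>t. - \<gamma> t + Phi_x f (x + t *\<^sub>R h) (\<upsilon> t) \<bullet> h + \<upsilon> t * (f_x f (x + t *\<^sub>R h) (\<upsilon> t) \<bullet> h)"
  shows "set_integrable lborel {a..b} W"
    and "\<delta> * \<bar>f (x + b *\<^sub>R h) (\<upsilon> b) - f (x + a *\<^sub>R h) (\<upsilon> a)\<bar> \<le> integral {a..b} (\<lambda>t. \<bar>W t\<bar>)"
proof -
  have xt: "x + t *\<^sub>R h \<in> \<Omega>" if "a \<le> t" "t \<le> b" for t using segment_domD[OF seg, of t] ab that by auto
  define B where "B = (\<lambda>(t, u, \<xi>). Phi_x f (x + t *\<^sub>R h) u \<bullet> h + \<xi> * (f_x f (x + t *\<^sub>R h) u \<bullet> h))"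
  define K where "K = {a..b} \<times> {\<delta>..M} \<times> {\<delta>..M}"
  have contB: "continuous_on K B"
    unfolding B_def K_def case_prod_unfold
    by (intro continuous_on_add continuous_on_mult continuous_on_inner
          continuous_on_subst2[OF Phi_x_continuous] continuous_on_subst2[OF cont_x])
       (use \<delta> in \<open>auto intro!: continuous_intros xt\<close>)
  have Wdiag: "W t = - \<gamma> t + B (t, \<upsilon> t, \<upsilon> t)" for t by (simp add: W_def B_def)
  have contD: "continuous_on {a..b} (\<lambda>t. B (t, \<upsilon> t, \<upsilon> t))"
    by (rule continuous_on_compose2[OF contB]) (use range in \<open>auto intro!: continuous_intros cont simp: K_def\<close>)
  have "set_integrable lborel {a..b} (\<lambda>t. B (t, \<upsilon> t, \<upsilon> t))"
    using borel_integrable_compact[OF _ contD] by (simp add: set_integrable_def indicator_def)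
  moreover have "W = (\<lambda>t. B (t, \<upsilon> t, \<upsilon> t) - \<gamma> t)" by (simp add: fun_eq_iff Wdiag)
  ultimately show Wint: "set_integrable lborel {a..b} W"
    using \<gamma> by (simp only: set_integral_diff(1))
  have Nint: "(\<lambda>t. \<bar>W t\<bar>) integrable_on {a..b}"
    by (rule set_borel_integral_eq_integral(1)[OF set_integrable_abs[OF Wint]])
  have \<gamma>int: "\<gamma> integrable_on {a..b}" by (rule set_borel_integral_eq_integral(1)[OF \<gamma>])
  have "\<bar>\<delta> * f (x + b *\<^sub>R h) (\<upsilon> b) - \<delta> * f (x + a *\<^sub>R h) (\<upsilon> a)\<bar> \<le> integral {a..b} (\<lambda>t. \<bar>W t\<bar>)"
  proof (rule increment_bound_local_to_global[OF ab(2) Nint, of "\<lambda>s. \<delta> * f (x + s *\<^sub>R h) (\<upsilon> s)"])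
    fix e :: real assume e: "e > 0"
    have "compact K" unfolding K_def by (intro compact_Times) auto
    from compact_uniformly_continuous[OF contB this] e
    obtain d where d: "d > 0" "\<And>p q. p \<in> K \<Longrightarrow> q \<in> K \<Longrightarrow> dist q p < d \<Longrightarrow> dist (B q) (B p) < e"
      unfolding uniformly_continuous_on_def by metis
    from compact_uniformly_continuous[OF cont] d(1)
    obtain \<eta> where \<eta>: "\<eta> > 0" "\<And>s t. s \<in> {a..b} \<Longrightarrow> t \<in> {a..b} \<Longrightarrow> dist t s < \<eta> \<Longrightarrow> dist (\<upsilon> t) (\<upsilon> s) < d / 4"
      unfolding uniformly_continuous_on_def by (metis compact_Icc divide_pos_pos zero_less_numeral)
    show "\<exists>d>0. \<forall>s s'. a \<le> s \<and> s \<le> s' \<and> s' \<le> b \<and> s' - s < d \<longrightarrow>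
       \<bar>\<delta> * f (x + s' *\<^sub>R h) (\<upsilon> s') - \<delta> * f (x + s *\<^sub>R h) (\<upsilon> s)\<bar> \<le> integral {s..s'} (\<lambda>t. \<bar>W t\<bar>) + e * (s' - s)"
    proof (intro exI[of _ \<eta>] conjI allI impI, rule \<eta>(1), elim conjE)
      fix s s' assume s: "a \<le> s" "s \<le> s'" "s' \<le> b" "s' - s < \<eta>"
      define u u' where "u = \<upsilon> s" and "u' = \<upsilon> s'"
      have u: "\<delta> \<le> u" "u \<le> M" "\<delta> \<le> u'" "u' \<le> M" using range[of s] range[of s'] s by (auto simp: u_def u'_def)
      obtain \<xi> where \<xi>: "min u u' \<le> \<xi>" "\<xi> \<le> max u u'"
        "Phi f (x + s *\<^sub>R h) u' - Phi f (x + s *\<^sub>R h) u = \<xi> * (f (x + s *\<^sub>R h) u - f (x + s *\<^sub>R h) u')"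
        using Phi_diff_mvt[OF xt[of s], of u u'] u s \<delta> by auto
      have \<xi>\<delta>: "\<delta> \<le> \<xi>" "\<xi> \<le> M" using \<xi>(1,2) u by auto
      have s01: "0 \<le> s" "s' \<le> 1" using s ab by auto
      define g where "g = (\<lambda>t. - \<gamma> t + (Phi_x f (x + t *\<^sub>R h) u' \<bullet> h + \<xi> * (f_x f (x + t *\<^sub>R h) u' \<bullet> h)))"
      have gB: "g t = - \<gamma> t + B (t, u', \<xi>)" for t by (simp add: g_def B_def)
      have hP: "((\<lambda>t. Phi_x f (x + t *\<^sub>R h) u' \<bullet> h) has_integral Phi f (x + s' *\<^sub>R h) u' - Phi f (x + s *\<^sub>R h) u') {s..s'}"
        by (rule Phi_along_segment[OF seg s01(1) s(2) s01(2)]) (use u \<delta> in auto)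
      have hf: "((\<lambda>t. f_x f (x + t *\<^sub>R h) u' \<bullet> h) has_integral f (x + s' *\<^sub>R h) u' - f (x + s *\<^sub>R h) u') {s..s'}"
        by (rule f_along_segment[OF seg s01(1) s(2) s01(2)]) (use u \<delta> in auto)
      have "\<gamma> integrable_on {s..s'}" by (rule integrable_on_subinterval[OF \<gamma>int]) (use s in auto)
      then have h\<gamma>: "(\<gamma> has_integral Phi f (x + s' *\<^sub>R h) u' - Phi f (x + s *\<^sub>R h) u) {s..s'}"
        using eq[OF s(1,2,3)] by (simp add: u_def u'_def has_integral_integrable_integral)
      have "(g has_integral - (Phi f (x + s' *\<^sub>R h) u' - Phi f (x + s *\<^sub>R h) u) +
         ((Phi f (x + s' *\<^sub>R h) u' - Phi f (x + s *\<^sub>R h) u') + \<xi> * (f (x + s' *\<^sub>R h) u' - f (x + s *\<^sub>R h) u'))) {s..s'}"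
        unfolding g_def by (intro has_integral_add has_integral_neg has_integral_mult_right h\<gamma> hP hf)
      also have "- (Phi f (x + s' *\<^sub>R h) u' - Phi f (x + s *\<^sub>R h) u) +
         ((Phi f (x + s' *\<^sub>R h) u' - Phi f (x + s *\<^sub>R h) u') + \<xi> * (f (x + s' *\<^sub>R h) u' - f (x + s *\<^sub>R h) u'))
         = \<xi> * (f (x + s' *\<^sub>R h) u' - f (x + s *\<^sub>R h) u)"
        using \<xi>(3) by (simp add: algebra_simps)
      finally have hg: "(g has_integral \<xi> * (f (x + s' *\<^sub>R h) u' - f (x + s *\<^sub>R h) u)) {s..s'}" .
      have Ns: "(\<lambda>t. \<bar>W t\<bar>) integrable_on {s..s'}" by (rule integrable_on_subinterval[OF Nint]) (use s in auto)
      have "((\<lambda>t. e) has_integral e * (s' - s)) {s..s'}"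
        using has_integral_const_real[of e s s'] s by (simp add: mult.commute)
      with Ns have hN: "((\<lambda>t. \<bar>W t\<bar> + e) has_integral integral {s..s'} (\<lambda>t. \<bar>W t\<bar>) + e * (s' - s)) {s..s'}"
        by (intro has_integral_add) auto
      have "norm (g t) \<le> \<bar>W t\<bar> + e" if t: "t \<in> {s..s'}" for t
      proof -
        have tab: "t \<in> {a..b}" using t s by auto
        have "dist (\<upsilon> t) u < d / 4" "dist (\<upsilon> t) u' < d / 4"
          using \<eta>(2)[of s t] \<eta>(2)[of s' t] t s by (auto simp: u_def u'_def dist_real_def)
        then have "\<bar>\<upsilon> t - u\<bar> < d / 4" "\<bar>\<upsilon> t - u'\<bar> < d / 4" by (simp_all only: dist_real_def)
        moreover have "u \<le> \<xi> \<and> \<xi> \<le> u' \<or> u' \<le> \<xi> \<and> \<xi> \<le> u"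
          using \<xi>(1,2) by (auto simp: min_def max_def split: if_splits)
        ultimately have d2: "\<bar>u' - \<upsilon> t\<bar> < d / 4" "\<bar>\<xi> - \<upsilon> t\<bar> < d / 4" by linarith+
        have "dist (t, u', \<xi>) (t, \<upsilon> t, \<upsilon> t) \<le> \<bar>u' - \<upsilon> t\<bar> + \<bar>\<xi> - \<upsilon> t\<bar>"
          by (simp add: dist_Pair_Pair dist_real_def sqrt_sum_squares_le_sum_abs[of "u' - \<upsilon> t" "\<xi> - \<upsilon> t", simplified])
        also have "\<dots> < d" using d2 d(1) by linarith
        finally have "dist (B (t, u', \<xi>)) (B (t, \<upsilon> t, \<upsilon> t)) < e"
          by (intro d(2)) (use tab range[OF tab] u \<xi>\<delta> in \<open>auto simp: K_def\<close>)
        then show ?thesis by (simp add: gB Wdiag dist_real_def)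
      qed
      then have "norm (integral {s..s'} g) \<le> integral {s..s'} (\<lambda>t. \<bar>W t\<bar> + e)"
        using hg hN by (intro integral_norm_bound_integral) auto
      then have le: "\<bar>\<xi> * (f (x + s' *\<^sub>R h) u' - f (x + s *\<^sub>R h) u)\<bar> \<le> integral {s..s'} (\<lambda>t. \<bar>W t\<bar>) + e * (s' - s)"
        using integral_unique[OF hg] integral_unique[OF hN] by simp
      have "\<bar>\<delta> * f (x + s' *\<^sub>R h) (\<upsilon> s') - \<delta> * f (x + s *\<^sub>R h) (\<upsilon> s)\<bar> = \<delta> * \<bar>f (x + s' *\<^sub>R h) u' - f (x + s *\<^sub>R h) u\<bar>"
        using \<delta> by (simp add: u_def u'_def abs_mult flip: right_diff_distrib)
      also have "\<dots> \<le> \<xi> * \<bar>f (x + s' *\<^sub>R h) u' - f (x + s *\<^sub>R h) u\<bar>"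
        using \<xi>\<delta> by (intro mult_right_mono) auto
      also have "\<dots> \<le> integral {s..s'} (\<lambda>t. \<bar>W t\<bar>) + e * (s' - s)"
        using le \<xi>\<delta> \<delta> by (simp add: abs_mult)
      finally show "\<bar>\<delta> * f (x + s' *\<^sub>R h) (\<upsilon> s') - \<delta> * f (x + s *\<^sub>R h) (\<upsilon> s)\<bar> \<le> integral {s..s'} (\<lambda>t. \<bar>W t\<bar>) + e * (s' - s)" .
    qed
  qed
  then show "\<delta> * \<bar>f (x + b *\<^sub>R h) (\<upsilon> b) - f (x + a *\<^sub>R h) (\<upsilon> a)\<bar> \<le> integral {a..b} (\<lambda>t. \<bar>W t\<bar>)"
    using \<delta> by (simp add: abs_mult flip: right_diff_distrib)
qed

text \<open>
  The set \<open>C\<close> of all \<open>(s, u)\<close> in \<open>{0..1} \<times> {0..M}\<close> with \<open>Phi f (x + s h) u = g s\<close> is compact, and its projection to the parameter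
  contains almost all of \<open>{0..1}\<close>, hence all of it.  Since \<open>Phi\<close> is strictly monotone in \<open>u\<close>, the set \<open>C\<close> is a
  graph, and a function with compact graph is continuous.
\<close>
lemma continuous_representative_along_segment:
  fixes \<upsilon> g :: "real \<Rightarrow> real"
  assumes seg: "x \<in> segment_dom \<Omega> h" and g: "continuous_on {0..1} g"
    and ae: "AE s in lborel. s \<in> {0..1} \<longrightarrow> 0 \<le> \<upsilon> s \<and> \<upsilon> s \<le> M \<and> Phi f (x + s *\<^sub>R h) (\<upsilon> s) = g s"
    and ends: "\<And>s. s = 0 \<or> s = 1 \<Longrightarrow> 0 \<le> \<upsilon> s \<and> \<upsilon> s \<le> M \<and> Phi f (x + s *\<^sub>R h) (\<upsilon> s) = g s"
  obtains \<nu> where "continuous_on {0..1} \<nu>"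
    and "\<And>s. s \<in> {0..1} \<Longrightarrow> 0 \<le> \<nu> s \<and> \<nu> s \<le> M \<and> Phi f (x + s *\<^sub>R h) (\<nu> s) = g s"
    and "AE s in lborel. s \<in> {0..1} \<longrightarrow> \<nu> s = \<upsilon> s" and "\<nu> 0 = \<upsilon> 0" and "\<nu> 1 = \<upsilon> 1"
proof -
  have xt: "x + t *\<^sub>R h \<in> \<Omega>" if "0 \<le> t" "t \<le> 1" for t using segment_domD[OF seg, of t] that by auto
  define C where "C = {p \<in> {0..1} \<times> {0..M}. Phi f (x + fst p *\<^sub>R h) (snd p) - g (fst p) \<in> {0}}"
  have "closed C"
    unfolding C_def
    by (intro continuous_closed_preimage[unfolded vimage_def Int_def, simplified Collect_conj_eq[symmetric] mem_Collect_eq]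
        continuous_on_diff continuous_on_subst2[OF Phi_continuous] continuous_on_compose2[OF g])
       (auto intro!: continuous_intros xt closed_Times)
  moreover have "C \<subseteq> {0..1} \<times> {0..M}" by (auto simp: C_def)
  ultimately have C: "compact C"
    by (metis compact_Icc compact_Int_closed compact_Times inf.absorb_iff2)
  have uniq: "u = v" if "(s, u) \<in> C" "(s, v) \<in> C" for s u v
  proof (rule ccontr)
    assume "u \<noteq> v"
    then consider "u < v" | "v < u" by linarith
    then show False
      using that xt[of s] Phi_strict_mono[of "x + s *\<^sub>R h" u v] Phi_strict_mono[of "x + s *\<^sub>R h" v u]
      by cases (auto simp: C_def)
  qed
  have "compact (fst ` C)" by (intro compact_continuous_image C continuous_on_fst continuous_on_id)
  then have cl: "closed (fst ` C)" by (rule compact_imp_closed)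
  have inC: "(s, \<upsilon> s) \<in> C" if "0 \<le> \<upsilon> s \<and> \<upsilon> s \<le> M \<and> Phi f (x + s *\<^sub>R h) (\<upsilon> s) = g s" "s \<in> {0..1}" for s
    using that by (auto simp: C_def)
  have aeC: "AE s in lborel. s \<in> {0..1} \<longrightarrow> (s, \<upsilon> s) \<in> C"
    using ae by eventually_elim (use inC in blast)
  then have "AE s in lborel. s \<in> {0<..<1} \<longrightarrow> s \<in> fst ` C"
    by eventually_elim force
  then have "AE s\<in>{0<..<1} in lebesgue. s \<in> fst ` C"
    by (rule AE_completion)
  then have "s \<in> fst ` C" if "s \<in> {0<..<1}" for s
    using mem_closed_if_AE_lebesgue_open[OF open_greaterThanLessThan cl] that by blast
  moreover have "0 \<in> fst ` C" "1 \<in> fst ` C"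
    using inC[of 0] inC[of 1] ends by force+
  ultimately have all: "s \<in> fst ` C" if "s \<in> {0..1}" for s
    using that by (cases "s = 0 \<or> s = 1") auto
  then have "\<forall>s\<in>{0..1}. \<exists>u. (s, u) \<in> C" by force
  then obtain \<nu> where \<nu>: "\<And>s. s \<in> {0..1} \<Longrightarrow> (s, \<nu> s) \<in> C" by metis
  have graph: "(\<lambda>s. (s, \<nu> s)) ` {0..1} = C"
  proof
    show "C \<subseteq> (\<lambda>s. (s, \<nu> s)) ` {0..1}"
    proof
      fix p assume p: "p \<in> C"
      then have "fst p \<in> {0..1}" by (auto simp: C_def)
      with \<nu>[OF this] p uniq[of "fst p" "snd p" "\<nu> (fst p)"] show "p \<in> (\<lambda>s. (s, \<nu> s)) ` {0..1}"
        by (intro image_eqI[of _ _ "fst p"]) (auto simp: prod_eq_iff)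
    qed
  qed (use \<nu> in auto)
  show ?thesis
  proof (rule that[of \<nu>])
    show "continuous_on {0..1} \<nu>"
    proof (rule continuous_from_closed_graph)
      show "compact {0..M}" by simp
      show "\<nu> \<in> {0..1} \<rightarrow> {0..M}" using \<nu> by (auto simp: C_def)
      show "closed ((\<lambda>s. (s, \<nu> s)) ` {0..1})" using graph C compact_imp_closed by auto
    qed
    show "0 \<le> \<nu> s \<and> \<nu> s \<le> M \<and> Phi f (x + s *\<^sub>R h) (\<nu> s) = g s" if "s \<in> {0..1}" for s
      using \<nu>[OF that] by (auto simp: C_def)
    show "AE s in lborel. s \<in> {0..1} \<longrightarrow> \<nu> s = \<upsilon> s"
      using aeC by eventually_elim (use \<nu> uniq in blast)
    show "\<nu> 0 = \<upsilon> 0" "\<nu> 1 = \<upsilon> 1"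
      using \<nu>[of 0] \<nu>[of 1] inC[of 0] inC[of 1] ends[of 0] ends[of 1] uniq by auto
  qed
qed

text \<open>
  Let \<open>a\<close> be the last parameter where the continuous representative equals \<open>\<delta>\<close>, and \<open>b\<close> the first one after
  \<open>a\<close> where the fitness equals \<open>e1\<close>.  On \<open>{a..b}\<close> the density lies between \<open>\<delta>\<close> and \<open>R\<close>, and the fitness drops by at
  least \<open>e2 - e1\<close>.
\<close>
lemma crossing_estimate_on_segment:
  fixes \<upsilon> :: "real \<Rightarrow> real" and G :: "real \<Rightarrow> 'a"
  assumes seg: "x \<in> segment_dom \<Omega> h"
    and G: "integrable lborel (\<lambda>t. indicator {0..1} t *\<^sub>R G t)"
    and ae: "AE s in lborel. s \<in> {0..1} \<longrightarrow> 0 \<le> \<upsilon> s \<and> \<upsilon> s \<le> M \<and>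
        Phi f (x + s *\<^sub>R h) (\<upsilon> s) = v0 + (LINT t|lborel. indicator {0..s} t * (G t \<bullet> h))"
    and ends: "\<And>s. s = 0 \<or> s = 1 \<Longrightarrow> 0 \<le> \<upsilon> s \<and> \<upsilon> s \<le> M \<and>
        Phi f (x + s *\<^sub>R h) (\<upsilon> s) = v0 + (LINT t|lborel. indicator {0..s} t * (G t \<bullet> h))"
    and \<delta>: "0 < \<delta>" "\<delta> \<le> R" "R \<le> M" and lev: "e1 < e2"
    and at_\<delta>: "\<And>y. y \<in> \<Omega> \<Longrightarrow> e2 \<le> f y \<delta>" and at_R: "\<And>y. y \<in> \<Omega> \<Longrightarrow> f y R \<le> e1"
    and start: "\<upsilon> 0 < \<delta>" and finish: "0 < \<upsilon> 1" "f (x + h) (\<upsilon> 1) \<le> e1"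
  shows "ennreal (\<delta> * (e2 - e1)) \<le> (\<integral>\<^sup>+t. indicator {t \<in> {0..1}. \<delta> \<le> \<upsilon> t \<and> \<upsilon> t \<le> R} t *
      ennreal (\<bar>(- G t + Phi_x f (x + t *\<^sub>R h) (\<upsilon> t) + \<upsilon> t *\<^sub>R f_x f (x + t *\<^sub>R h) (\<upsilon> t)) \<bullet> h\<bar>) \<partial>lborel)"
proof -
  have xt: "x + t *\<^sub>R h \<in> \<Omega>" if "0 \<le> t" "t \<le> 1" for t using segment_domD[OF seg, of t] that by auto
  define \<gamma> where "\<gamma> = (\<lambda>t. G t \<bullet> h)"
  have \<gamma>: "set_integrable lborel {0..1} \<gamma>"
    using integrable_inner_left[OF G, of h] by (simp add: set_integrable_def \<gamma>_def)
  have \<gamma>sub: "set_integrable lborel {a..b} \<gamma>" if "0 \<le> a" "b \<le> 1" for a b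
    by (rule set_integrable_subset[OF \<gamma>]) (use that in auto)
  have \<gamma>on: "\<gamma> integrable_on {0..1}" by (rule set_borel_integral_eq_integral(1)[OF \<gamma>])
  have LI: "(LINT t|lborel. indicator {0..s} t * (G t \<bullet> h)) = integral {0..s} \<gamma>" if "s \<le> 1" for s
    using set_borel_integral_eq_integral(2)[OF \<gamma>sub[of 0 s]] that
    by (simp add: set_lebesgue_integral_def \<gamma>_def)
  define g where "g = (\<lambda>s. v0 + integral {0..s} \<gamma>)"
  have gc: "continuous_on {0..1} g"
    unfolding g_def by (intro continuous_intros indefinite_integral_continuous_1 \<gamma>on)
  have ae': "AE s in lborel. s \<in> {0..1} \<longrightarrow> 0 \<le> \<upsilon> s \<and> \<upsilon> s \<le> M \<and> Phi f (x + s *\<^sub>R h) (\<upsilon> s) = g s"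
    using ae by eventually_elim (auto simp: LI g_def)
  have ends': "0 \<le> \<upsilon> s \<and> \<upsilon> s \<le> M \<and> Phi f (x + s *\<^sub>R h) (\<upsilon> s) = g s" if "s = 0 \<or> s = 1" for s
  proof -
    have "s \<le> 1" using that by auto
    from LI[OF this] ends[OF that] show ?thesis by (simp add: g_def)
  qed
  obtain \<nu> where \<nu>: "continuous_on {0..1} \<nu>"
    "\<And>s. s \<in> {0..1} \<Longrightarrow> 0 \<le> \<nu> s \<and> \<nu> s \<le> M \<and> Phi f (x + s *\<^sub>R h) (\<nu> s) = g s"
    "AE s in lborel. s \<in> {0..1} \<longrightarrow> \<nu> s = \<upsilon> s" "\<nu> 0 = \<upsilon> 0" "\<nu> 1 = \<upsilon> 1"
    using continuous_representative_along_segment[OF seg gc ae' ends'] by blast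
  have anti: "f y v \<le> f y u" if "y \<in> \<Omega>" "0 < u" "u \<le> v" for y u v
    using f_strict_decreasing[OF that(1,2), of v] that(3) by (cases "u = v") auto
  have \<nu>1: "\<nu> 1 > \<delta>"
  proof (rule ccontr)
    assume "\<not> \<nu> 1 > \<delta>"
    then have "f (x + h) \<delta> \<le> f (x + h) (\<upsilon> 1)" using anti[of "x + h" "\<upsilon> 1" \<delta>] xt[of 1] finish \<nu>(5) by simp
    with at_\<delta>[of "x + h"] xt[of 1] finish(2) lev show False by simp
  qed
  obtain a where a: "0 \<le> a" "a \<le> 1" "\<nu> a = \<delta>" "\<And>t. a \<le> t \<Longrightarrow> t \<le> 1 \<Longrightarrow> \<delta> \<le> \<nu> t"
  proof -
    \<comment> \<open>the last passage is a first passage of the reversed function\<close>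
    have "continuous_on {0..1} (\<lambda>t. \<nu> (1 - t))"
      by (rule continuous_on_compose2[OF \<nu>(1)]) (auto intro!: continuous_intros)
    then obtain s where s: "0 \<le> s" "s \<le> 1" "\<nu> (1 - s) = \<delta>" "\<And>t. 0 \<le> t \<Longrightarrow> t \<le> s \<Longrightarrow> \<delta> \<le> \<nu> (1 - t)"
      by (rule first_passage[OF zero_le_one, of "\<lambda>t. \<nu> (1 - t)" \<delta>]) (use \<nu>1 start \<nu>(4) in auto)
    show ?thesis using s(1-3) s(4)[of "1 - _"] by (intro that[of "1 - s"]) auto
  qed
  define k where "k = (\<lambda>s. f (x + s *\<^sub>R h) (\<nu> s))"
  have kc: "continuous_on {a..1} k"
    unfolding k_def
    by (rule continuous_on_subst2[OF cont_f])
       (use a \<delta> in \<open>auto intro!: continuous_intros continuous_on_subset[OF \<nu>(1)] xt less_le_trans[OF \<delta>(1)]\<close>)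
  have ka: "e2 \<le> k a" using at_\<delta>[OF xt[OF a(1,2)]] a(3) by (simp add: k_def)
  have k1: "k 1 \<le> e1" using finish \<nu>(5) by (simp add: k_def)
  obtain b where b: "a \<le> b" "b \<le> 1" "k b = e1" "\<And>t. a \<le> t \<Longrightarrow> t \<le> b \<Longrightarrow> e1 \<le> k t"
    by (rule first_passage[OF a(2) kc _ k1]) (use ka lev in auto)
  have \<nu>R: "\<delta> \<le> \<nu> t \<and> \<nu> t \<le> R" if "t \<in> {a..b}" for t
  proof
    show 1: "\<delta> \<le> \<nu> t" using a(4)[of t] b that by auto
    show "\<nu> t \<le> R"
    proof (rule ccontr)
      assume "\<not> \<nu> t \<le> R"
      then have "k t < f (x + t *\<^sub>R h) R"
        unfolding k_def using \<delta> a b that by (intro f_strict_decreasing xt) auto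
      also have "\<dots> \<le> e1" using a b that by (intro at_R xt) auto
      finally show False using b(4)[of t] that by auto
    qed
  qed
  define W where "W = (\<lambda>t. - \<gamma> t + Phi_x f (x + t *\<^sub>R h) (\<nu> t) \<bullet> h + \<nu> t * (f_x f (x + t *\<^sub>R h) (\<nu> t) \<bullet> h))"
  have eq: "Phi f (x + s' *\<^sub>R h) (\<nu> s') - Phi f (x + s *\<^sub>R h) (\<nu> s) = integral {s..s'} \<gamma>"
    if "a \<le> s" "s \<le> s'" "s' \<le> b" for s s'
  proof -
    have "\<gamma> integrable_on {0..s'}" by (rule integrable_on_subinterval[OF \<gamma>on]) (use that b in auto)
    from Henstock_Kurzweil_Integration.integral_combine[OF _ _ this, of s]
    show ?thesis using \<nu>(2)[of s] \<nu>(2)[of s'] that a b by (auto simp: g_def)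
  qed
  have \<nu>c: "continuous_on {a..b} \<nu>" by (rule continuous_on_subset[OF \<nu>(1)]) (use a b in auto)
  have \<nu>M: "\<delta> \<le> \<nu> t \<and> \<nu> t \<le> M" if "t \<in> {a..b}" for t using \<nu>R[OF that] \<delta> by auto
  note inc = fitness_increment_along_segment[OF seg a(1) b(1,2) \<nu>c \<nu>M \<delta>(1) \<gamma>sub[OF a(1) b(2)] eq]
  have Wint: "set_integrable lborel {a..b} W" using inc(1) by (simp add: W_def)
  have "\<delta> * (e2 - e1) \<le> \<delta> * \<bar>k b - k a\<bar>"
    using \<delta>(1) ka b(3) lev by (intro mult_left_mono) auto
  also have "\<dots> \<le> integral {a..b} (\<lambda>t. \<bar>W t\<bar>)"
    using inc(2) by (simp add: k_def W_def)
  also have "\<dots> = (LINT t|lborel. indicator {a..b} t * \<bar>W t\<bar>)"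
    using set_borel_integral_eq_integral(2)[OF set_integrable_abs[OF Wint]] by (simp add: set_lebesgue_integral_def)
  finally have "ennreal (\<delta> * (e2 - e1)) \<le> ennreal (LINT t|lborel. indicator {a..b} t * \<bar>W t\<bar>)"
    by (rule ennreal_leI)
  also have "\<dots> = (\<integral>\<^sup>+t. ennreal (indicator {a..b} t * \<bar>W t\<bar>) \<partial>lborel)"
    using set_integrable_abs[OF Wint] by (intro nn_integral_eq_integral[symmetric]) (auto simp: set_integrable_def)
  also have "\<dots> \<le> (\<integral>\<^sup>+t. indicator {t \<in> {0..1}. \<delta> \<le> \<upsilon> t \<and> \<upsilon> t \<le> R} t *
      ennreal (\<bar>(- G t + Phi_x f (x + t *\<^sub>R h) (\<upsilon> t) + \<upsilon> t *\<^sub>R f_x f (x + t *\<^sub>R h) (\<upsilon> t)) \<bullet> h\<bar>) \<partial>lborel)"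
  proof (rule nn_integral_mono_AE)
    show "AE t in lborel. ennreal (indicator {a..b} t * \<bar>W t\<bar>) \<le> indicator {t \<in> {0..1}. \<delta> \<le> \<upsilon> t \<and> \<upsilon> t \<le> R} t *
      ennreal (\<bar>(- G t + Phi_x f (x + t *\<^sub>R h) (\<upsilon> t) + \<upsilon> t *\<^sub>R f_x f (x + t *\<^sub>R h) (\<upsilon> t)) \<bullet> h\<bar>)"
      using \<nu>(3)
    proof eventually_elim
      case (elim t)
      show ?case
      proof (cases "t \<in> {a..b}")
        case True
        then have "t \<in> {0..1}" using a b by auto
        with elim \<nu>R[OF True] True show ?thesis by (simp add: W_def \<gamma>_def inner_add_left inner_diff_left)
      qed simp
    qed
  qed
  finally show ?thesis .
qed

end

section \<open>Transitions from low to high density\<close>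

lemma AE_along_segments:
  fixes P :: "'a::euclidean_space \<Rightarrow> bool"
  assumes "AE x in lborel. P x"
  shows "AE x in lborel. AE s in lborel. P (x + s *\<^sub>R h)"
proof -
  from assms obtain N where N: "{x. \<not> P x} \<subseteq> N" "N \<in> null_sets lborel"
    by (auto simp: eventually_ae_filter)
  then have [measurable]: "N \<in> sets borel" by auto
  have "AE x in lborel. AE s in lborel. x + s *\<^sub>R h \<notin> N"
  proof (subst lborel_pair.AE_commute)
    show "{p \<in> space (lborel \<Otimes>\<^sub>M lborel). fst p + snd p *\<^sub>R h \<notin> N} \<in> sets (lborel \<Otimes>\<^sub>M lborel)"
      by measurable
    show "AE s in lborel. AE x in lborel. x + s *\<^sub>R h \<notin> N"
      by (intro AE_I2 AE_lborel_shift AE_not_in N(2))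
  qed
  then show ?thesis
  proof eventually_elim
    case (elim x)
    then show ?case by eventually_elim (use N(1) in auto)
  qed
qed

lemma nn_integral_along_segments:
  fixes F :: "'a::euclidean_space \<Rightarrow> ennreal"
  assumes [measurable]: "F \<in> borel_measurable borel"
  shows "(\<integral>\<^sup>+x. \<integral>\<^sup>+t. indicator {0..1::real} t * F (x + t *\<^sub>R h) \<partial>lborel \<partial>lborel) = (\<integral>\<^sup>+x. F x \<partial>lborel)"
proof -
  have "(\<integral>\<^sup>+x. \<integral>\<^sup>+t. indicator {0..1::real} t * F (x + t *\<^sub>R h) \<partial>lborel \<partial>lborel) =
    (\<integral>\<^sup>+t. \<integral>\<^sup>+x. indicator {0..1::real} t * F (x + t *\<^sub>R h) \<partial>lborel \<partial>lborel)"
    by (rule lborel_pair.Fubini') measurable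
  also have "\<dots> = (\<integral>\<^sup>+t. indicator {0..1::real} t * (\<integral>\<^sup>+x. F x \<partial>lborel) \<partial>lborel)"
    by (intro nn_integral_cong, subst nn_integral_cmult) (simp_all add: nn_integral_lborel_shift)
  also have "\<dots> = (\<integral>\<^sup>+x. F x \<partial>lborel)"
    by (subst nn_integral_multc) auto
  finally show ?thesis .
qed

context regular_fitness
begin

text \<open>
  Write \<open>\<kappa>\<close> for the drop \<open>\<delta> * (e2 - e1)\<close>, which is at most the integral of \<open>y = \<bar>W \<bullet> h\<bar>\<close> over the part of the segment with
  \<open>\<delta> \<le> u \<le> R\<close>.  From \<open>y \<le> \<kappa> / 2 + y\<^sup>2 / (2 * \<kappa>)\<close> and \<open>y\<^sup>2 \<le> R * (norm h)\<^sup>2 * ((norm W)\<^sup>2 / u)\<close> one gets that the integral of \<open>Q\<close> over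
  each segment starting in \<open>S\<close> is bounded below; integration over the starting point concludes.  The function \<open>Q\<close>
  stands for a Borel majorant of \<open>(norm W)\<^sup>2 / u\<close>.
\<close>
lemma transition_set_measure:
  fixes u V :: "'a \<Rightarrow> real" and G :: "'a \<Rightarrow> 'a" and Q :: "'a \<Rightarrow> ennreal"
  assumes V: "integrable lborel V" and G: "integrable lborel G"
    and weak: "\<And>\<phi> b. test_function \<Omega> \<phi> \<Longrightarrow> b \<in> Basis \<Longrightarrow>
      (LINT x|lborel. V x * frechet_derivative \<phi> (at x) b) = - (LINT x|lborel. (G x \<bullet> b) * \<phi> x)"
    and rep: "AE x in lborel. x \<in> \<Omega> \<longrightarrow> 0 \<le> u x \<and> u x \<le> M \<and> V x = Phi f x (u x)"
    and \<delta>: "0 < \<delta>" "\<delta> \<le> R" "R \<le> M" and lev: "e1 < e2"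
    and at_\<delta>: "\<And>y. y \<in> \<Omega> \<Longrightarrow> e2 \<le> f y \<delta>" and at_R: "\<And>y. y \<in> \<Omega> \<Longrightarrow> f y R \<le> e1"
    and Q[measurable]: "Q \<in> borel_measurable borel"
    and WQ: "AE x in lborel. x \<in> \<Omega> \<longrightarrow> \<delta> \<le> u x \<longrightarrow>
      ennreal (1 / u x * (norm (- G x + Phi_x f x (u x) + u x *\<^sub>R f_x f x (u x)))\<^sup>2) \<le> Q x"
    and S: "S \<in> sets borel"
    and SD: "\<And>x. x \<in> S \<Longrightarrow> x \<in> segment_dom \<Omega> h \<and> u x < \<delta> \<and> 0 < u (x + h) \<and> f (x + h) (u (x + h)) \<le> e1"
  shows "emeasure lborel S \<le> ennreal (R * (norm h)\<^sup>2 / (\<delta> * (e2 - e1))\<^sup>2) * (\<integral>\<^sup>+x. Q x \<partial>lborel)"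
proof -
  define \<kappa> where "\<kappa> = \<delta> * (e2 - e1)"
  have \<kappa>: "\<kappa> > 0" using \<delta> lev by (simp add: \<kappa>_def)
  define c where "c = R * (norm h)\<^sup>2 / (2 * \<kappa>)"
  have R: "R > 0" using \<delta> by simp
  have c: "c \<ge> 0" using R \<kappa> by (simp add: c_def)
  define I where "I = (\<lambda>x. \<integral>\<^sup>+t. indicator {0..1::real} t * Q (x + t *\<^sub>R h) \<partial>lborel)"
  have [measurable]: "I \<in> borel_measurable borel" unfolding I_def by measurable
  have lines: "AE x in lborel. x \<in> segment_dom \<Omega> h \<longrightarrow>
      integrable lborel (\<lambda>t::real. indicator {0..1} t *\<^sub>R G (x + t *\<^sub>R h)) \<and>
      V (x + h) = V x + (LINT t|lborel. indicator {0..1} t * (G (x + t *\<^sub>R h) \<bullet> h)) \<and>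
      (AE s in lborel. s \<in> {0..1} \<longrightarrow>
        V (x + s *\<^sub>R h) = V x + (LINT t|lborel. indicator {0..s} t * (G (x + t *\<^sub>R h) \<bullet> h)))"
    using V G open_dom weak by (rule weak_gradient_AE_lines)
  have "AE x in lborel. x \<in> S \<longrightarrow> 1 \<le> ennreal (2 * c / \<kappa>) * I x"
    using lines AE_along_segments[OF rep, of h]
      AE_along_segments[OF WQ, of h] rep AE_lborel_shift[OF rep, of h]
  proof eventually_elim
    case (elim x)
    note E = this
    show ?case
    proof
      assume x: "x \<in> S"
      then have seg: "x \<in> segment_dom \<Omega> h" and xs: "u x < \<delta>" "0 < u (x + h)" "f (x + h) (u (x + h)) \<le> e1"
        using SD by auto
      have xt: "x + t *\<^sub>R h \<in> \<Omega>" if "0 \<le> t" "t \<le> 1" for t using segment_domD[OF seg, of t] that by auto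
      define y where "y = (\<lambda>t. (- G (x + t *\<^sub>R h) + Phi_x f (x + t *\<^sub>R h) (u (x + t *\<^sub>R h)) +
          u (x + t *\<^sub>R h) *\<^sub>R f_x f (x + t *\<^sub>R h) (u (x + t *\<^sub>R h))) \<bullet> h)"
      have L: "integrable lborel (\<lambda>t::real. indicator {0..1} t *\<^sub>R G (x + t *\<^sub>R h))"
        "V (x + h) = V x + (LINT t|lborel. indicator {0..1} t * (G (x + t *\<^sub>R h) \<bullet> h))"
        "AE s in lborel. s \<in> {0..1} \<longrightarrow>
          V (x + s *\<^sub>R h) = V x + (LINT t|lborel. indicator {0..s} t * (G (x + t *\<^sub>R h) \<bullet> h))"
        using E(1) seg by auto
      have "ennreal \<kappa> \<le> (\<integral>\<^sup>+t. indicator {t \<in> {0..1}. \<delta> \<le> u (x + t *\<^sub>R h) \<and> u (x + t *\<^sub>R h) \<le> R} t * ennreal \<bar>y t\<bar> \<partial>lborel)"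
        unfolding \<kappa>_def y_def
      proof (rule crossing_estimate_on_segment[OF seg L(1) _ _ \<delta> lev at_\<delta> at_R])
        show "AE s in lborel. s \<in> {0..1} \<longrightarrow> 0 \<le> u (x + s *\<^sub>R h) \<and> u (x + s *\<^sub>R h) \<le> M \<and>
           Phi f (x + s *\<^sub>R h) (u (x + s *\<^sub>R h)) = V x + (LINT t|lborel. indicator {0..s} t * (G (x + t *\<^sub>R h) \<bullet> h))"
          using L(3) E(2)
        proof eventually_elim
          case (elim s)
          then show ?case using xt[of s] by auto
        qed
        show "0 \<le> u (x + s *\<^sub>R h) \<and> u (x + s *\<^sub>R h) \<le> M \<and>
           Phi f (x + s *\<^sub>R h) (u (x + s *\<^sub>R h)) = V x + (LINT t|lborel. indicator {0..s} t * (G (x + t *\<^sub>R h) \<bullet> h))"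
          if s: "s = 0 \<or> s = 1" for s
        proof (cases "s = 0")
          case True
          have "(LINT t|lborel. indicator {0..0::real} t * (G (x + t *\<^sub>R h) \<bullet> h)) = 0"
          proof (rule integral_eq_zero_AE)
            show "AE t in lborel. indicator {0..0::real} t * (G (x + t *\<^sub>R h) \<bullet> h) = 0"
              using AE_lborel_singleton[of "0::real"] by eventually_elim (auto simp: indicator_def)
          qed
          then show ?thesis using True E(4) xt[of 0] by simp
        next
          case False
          then show ?thesis using s E(5) L(2) xt[of 1] by simp
        qed
      qed (use xs in auto)
      also have "\<dots> \<le> (\<integral>\<^sup>+t. ennreal (\<kappa> / 2) * indicator {0..1::real} t + ennreal c * (indicator {0..1::real} t * Q (x + t *\<^sub>R h)) \<partial>lborel)"
      proof (rule nn_integral_mono_AE)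
        show "AE t in lborel. indicator {t \<in> {0..1}. \<delta> \<le> u (x + t *\<^sub>R h) \<and> u (x + t *\<^sub>R h) \<le> R} t * ennreal \<bar>y t\<bar> \<le>
          ennreal (\<kappa> / 2) * indicator {0..1::real} t + ennreal c * (indicator {0..1::real} t * Q (x + t *\<^sub>R h))"
          using E(3)
        proof eventually_elim
          case (elim t)
          show ?case
          proof (cases "t \<in> {0..1} \<and> \<delta> \<le> u (x + t *\<^sub>R h) \<and> u (x + t *\<^sub>R h) \<le> R")
            case True
            define \<omega> where "\<omega> = - G (x + t *\<^sub>R h) + Phi_x f (x + t *\<^sub>R h) (u (x + t *\<^sub>R h)) +
              u (x + t *\<^sub>R h) *\<^sub>R f_x f (x + t *\<^sub>R h) (u (x + t *\<^sub>R h))"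
            have q: "ennreal (1 / u (x + t *\<^sub>R h) * (norm \<omega>)\<^sup>2) \<le> Q (x + t *\<^sub>R h)"
              using elim True xt[of t] by (simp add: \<omega>_def)
            have u: "0 < u (x + t *\<^sub>R h)" "u (x + t *\<^sub>R h) \<le> R" using True \<delta> by auto
            have "0 \<le> (\<bar>y t\<bar> - \<kappa>)\<^sup>2" by simp
            then have "2 * \<kappa> * \<bar>y t\<bar> \<le> \<kappa>\<^sup>2 + \<bar>y t\<bar>\<^sup>2" by (simp add: power2_diff algebra_simps)
            then have "\<bar>y t\<bar> \<le> (\<kappa>\<^sup>2 + \<bar>y t\<bar>\<^sup>2) / (2 * \<kappa>)" using \<kappa> by (simp add: field_simps)
            also have "\<dots> = \<kappa> / 2 + \<bar>y t\<bar>\<^sup>2 / (2 * \<kappa>)" using \<kappa> by (simp add: field_simps power2_eq_square)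
            finally have y1: "\<bar>y t\<bar> \<le> \<kappa> / 2 + \<bar>y t\<bar>\<^sup>2 / (2 * \<kappa>)" .
            have "\<bar>y t\<bar>\<^sup>2 \<le> (norm \<omega> * norm h)\<^sup>2"
              unfolding y_def \<omega>_def by (intro power_mono Cauchy_Schwarz_ineq2) auto
            also have "\<dots> = (norm h)\<^sup>2 * (norm \<omega>)\<^sup>2" by (simp add: power_mult_distrib)
            also have "\<dots> \<le> (norm h)\<^sup>2 * (R * (1 / u (x + t *\<^sub>R h) * (norm \<omega>)\<^sup>2))"
              using mult_right_mono[OF u(2), of "(norm \<omega>)\<^sup>2"] u
              by (intro mult_left_mono) (simp_all add: field_simps)
            finally have "\<bar>y t\<bar>\<^sup>2 / (2 * \<kappa>) \<le> c * (1 / u (x + t *\<^sub>R h) * (norm \<omega>)\<^sup>2)"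
              using divide_right_mono[of "\<bar>y t\<bar>\<^sup>2" _ "2 * \<kappa>"] \<kappa> by (fastforce simp: c_def mult_ac)
            with y1 have "\<bar>y t\<bar> \<le> \<kappa> / 2 + c * (1 / u (x + t *\<^sub>R h) * (norm \<omega>)\<^sup>2)" by linarith
            then have "ennreal \<bar>y t\<bar> \<le> ennreal (\<kappa> / 2 + c * (1 / u (x + t *\<^sub>R h) * (norm \<omega>)\<^sup>2))"
              by (rule ennreal_leI)
            also have "\<dots> = ennreal (\<kappa> / 2) + ennreal c * ennreal (1 / u (x + t *\<^sub>R h) * (norm \<omega>)\<^sup>2)"
              using \<kappa> c u by (subst ennreal_plus) (auto simp flip: ennreal_mult)
            also have "\<dots> \<le> ennreal (\<kappa> / 2) + ennreal c * Q (x + t *\<^sub>R h)"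
              by (intro add_left_mono mult_left_mono q) auto
            finally show ?thesis using True by simp
          qed (auto simp: indicator_def)
        qed
      qed
      also have "\<dots> = ennreal (\<kappa> / 2) + ennreal c * I x"
        by (subst nn_integral_add) (auto simp: nn_integral_cmult I_def)
      finally have "ennreal \<kappa> \<le> ennreal (\<kappa> / 2) + ennreal c * I x" .
      moreover have "ennreal \<kappa> = ennreal (\<kappa> / 2) + ennreal (\<kappa> / 2)"
        using \<kappa> by (simp flip: ennreal_plus)
      ultimately have "ennreal (\<kappa> / 2) \<le> ennreal c * I x"
        by (simp add: ennreal_add_left_cancel_le)
      then have "ennreal (2 / \<kappa>) * ennreal (\<kappa> / 2) \<le> ennreal (2 / \<kappa>) * (ennreal c * I x)"
        by (rule mult_left_mono) simp
      then show "1 \<le> ennreal (2 * c / \<kappa>) * I x"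
        using \<kappa> c by (simp add: ennreal_mult[symmetric] mult.assoc[symmetric])
    qed
  qed
  then have "AE x in lborel. indicator S x \<le> ennreal (2 * c / \<kappa>) * I x"
    by eventually_elim (auto simp: indicator_def)
  then have "(\<integral>\<^sup>+x. indicator S x \<partial>lborel) \<le> (\<integral>\<^sup>+x. ennreal (2 * c / \<kappa>) * I x \<partial>lborel)"
    by (rule nn_integral_mono_AE)
  also have "(\<integral>\<^sup>+x. indicator S x \<partial>lborel) = emeasure lborel S" using S by simp
  also have "(\<integral>\<^sup>+x. ennreal (2 * c / \<kappa>) * I x \<partial>lborel) = ennreal (2 * c / \<kappa>) * (\<integral>\<^sup>+x. Q x \<partial>lborel)"
    by (subst nn_integral_cmult) (auto simp: I_def nn_integral_along_segments)
  also have "2 * c / \<kappa> = R * (norm h)\<^sup>2 / \<kappa>\<^sup>2" using \<kappa> by (simp add: c_def field_simps power2_eq_square)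
  finally show ?thesis by (simp add: \<kappa>_def)
qed

end

section \<open>From transitions to the whole domain\<close>

text \<open>
  In the application, \<open>A\<close> and \<open>B\<close> are the sets of low and of high density and \<open>D\<close> is a multiple of the
  entropy production; points of \<open>A\<close> that a translation inside \<open>\<Omega>\<close> moves to \<open>B\<close> are rare.
\<close>
definition transition_controlled :: "'a::euclidean_space set \<Rightarrow> 'a set \<Rightarrow> 'a set \<Rightarrow> real \<Rightarrow> bool" where
  "transition_controlled \<Omega> A B D \<longleftrightarrow>
     A \<in> sets borel \<and> B \<in> sets borel \<and> A \<subseteq> \<Omega> \<and> B \<subseteq> \<Omega> \<and> 0 \<le> D \<and>
     measure lborel (\<Omega> - (A \<union> B)) \<le> D \<and>
     (\<forall>h. measure lborel {x \<in> A. x \<in> segment_dom \<Omega> h \<and> x + h \<in> B} \<le> D)"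

lemma bounded_borel_fmeasurable:
  fixes X :: "'a::euclidean_space set"
  assumes "X \<in> sets borel" "bounded X" shows "X \<in> fmeasurable lborel"
  by (rule fmeasurableI) (use assms emeasure_bounded_finite[OF assms(2)] in simp_all)

lemma measure_lborel_shift:
  fixes X :: "'a::euclidean_space set"
  assumes [measurable]: "X \<in> sets borel"
  shows "measure lborel {x. x + h \<in> X} = measure lborel X"
proof -
  have [measurable]: "{x. x + h \<in> X} \<in> sets borel" by measurable
  have "emeasure lborel {x. x + h \<in> X} = (\<integral>\<^sup>+x. indicator {x. x + h \<in> X} x \<partial>lborel)" by simp
  also have "\<dots> = (\<integral>\<^sup>+x. indicator X (x + h) \<partial>lborel)" by (simp add: indicator_def)
  also have "\<dots> = emeasure lborel X" by (subst nn_integral_lborel_shift) auto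
  finally show ?thesis by (simp add: measure_def)
qed

text \<open>
  A point of \<open>A \<inter> S\<close> is moved by \<open>h\<close> into \<open>B\<close>, into the set outside \<open>A \<union> B\<close>, or into \<open>A \<inter> T\<close>; the first two cases
  have measure at most \<open>D\<close> each.
\<close>
lemma transition_translate:
  fixes \<Omega> :: "'a::euclidean_space set"
  assumes \<Omega>: "open \<Omega>" "bounded \<Omega>" and tc: "transition_controlled \<Omega> A B D"
    and S[measurable]: "S \<in> sets borel" and seg: "S \<subseteq> segment_dom \<Omega> h"
    and T[measurable]: "T \<in> sets borel" and ST: "\<And>x. x \<in> S \<Longrightarrow> x + h \<in> T"
  shows "measure lborel (A \<inter> S) \<le> measure lborel (A \<inter> T) + 2 * D"
proof -
  have [measurable]: "A \<in> sets borel" "B \<in> sets borel" "\<Omega> \<in> sets borel"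
    using tc \<Omega> by (auto simp: transition_controlled_def)
  have [measurable]: "segment_dom \<Omega> h \<in> sets borel" by (rule borel_open[OF open_segment_dom[OF \<Omega>(1)]])
  have sub: "segment_dom \<Omega> h \<subseteq> \<Omega>" by (auto simp: segment_dom_def dest: bspec[of _ _ 0])
  let ?X = "{x \<in> A. x \<in> segment_dom \<Omega> h \<and> x + h \<in> B}"
  let ?Y = "{x. x + h \<in> A \<inter> T}"
  let ?Z = "{x. x + h \<in> \<Omega> - (A \<union> B)}"
  have bY: "bounded {x. x + h \<in> Z}" if "Z \<subseteq> \<Omega>" for Z
  proof -
    have "{x. x + h \<in> Z} \<subseteq> (\<lambda>x. - h + x) ` \<Omega>" using that by (force simp: image_iff)
    then show ?thesis using bounded_translation[OF \<Omega>(2)] bounded_subset by blast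
  qed
  have "A \<inter> S \<subseteq> ?X \<union> ?Y \<union> ?Z"
    using seg ST segment_domD[of _ \<Omega> h 1] by (auto simp: subset_eq)
  moreover have fm: "?X \<in> fmeasurable lborel" "?Y \<in> fmeasurable lborel" "?Z \<in> fmeasurable lborel"
    by (intro bounded_borel_fmeasurable bY bounded_subset[OF \<Omega>(2)]; use sub tc in \<open>auto simp: transition_controlled_def\<close>)+
  ultimately have "measure lborel (A \<inter> S) \<le> measure lborel (?X \<union> ?Y \<union> ?Z)"
    by (intro measure_mono_fmeasurable fmeasurable.Un) auto
  also have "\<dots> \<le> measure lborel ?X + measure lborel ?Y + measure lborel ?Z"
    using measure_Un_le[of "?X \<union> ?Y" lborel ?Z] measure_Un_le[of ?X lborel ?Y] by simp
  also have "measure lborel ?Y = measure lborel (A \<inter> T)" by (rule measure_lborel_shift) simp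
  also have "measure lborel ?Z = measure lborel (\<Omega> - (A \<union> B))" by (rule measure_lborel_shift) simp
  finally show ?thesis using tc by (auto simp: transition_controlled_def dest: spec[of _ h])
qed

text \<open>
  Tonelli in the variables \<open>x\<close> and \<open>h = y - x\<close>: the left-hand side is the integral over \<open>h\<close> of the measure of all
  \<open>x \<in> A\<close> with \<open>x + h \<in> B\<close>, both in the ball, and only \<open>h\<close> shorter than the diameter contribute.
\<close>
lemma transition_product:
  fixes \<Omega> :: "'a::euclidean_space set"
  assumes \<Omega>: "open \<Omega>" "bounded \<Omega>" and tc: "transition_controlled \<Omega> A B D" and ball: "ball c r \<subseteq> \<Omega>"
  shows "measure lborel (A \<inter> ball c r) * measure lborel (B \<inter> ball c r) \<le> measure lborel (ball (0::'a) (2 * r)) * D"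
proof -
  have [measurable]: "A \<in> sets borel" "B \<in> sets borel" and D: "D \<ge> 0"
    using tc by (auto simp: transition_controlled_def)
  have [measurable]: "segment_dom \<Omega> h \<in> sets borel" for h using open_segment_dom[OF \<Omega>(1)] by auto
  have sub: "segment_dom \<Omega> h \<subseteq> \<Omega>" for h by (auto simp: segment_dom_def dest: bspec[of _ _ 0])
  let ?A = "A \<inter> ball c r" and ?B = "B \<inter> ball c r"
  have [measurable]: "?A \<in> sets borel" "?B \<in> sets borel" by (simp_all add: sets.Int borel_open)
  have fm: "?A \<in> fmeasurable lborel" "?B \<in> fmeasurable lborel" "ball (0::'a) (2 * r) \<in> fmeasurable lborel"
    by (auto intro!: bounded_borel_fmeasurable bounded_Int)
  have "emeasure lborel ?A * emeasure lborel ?B = (\<integral>\<^sup>+x. indicator ?A x * (\<integral>\<^sup>+h. indicator ?B h \<partial>lborel) \<partial>lborel)"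
    by (subst nn_integral_multc) auto
  also have "\<dots> = (\<integral>\<^sup>+x. \<integral>\<^sup>+h. indicator ?A x * indicator ?B (x + h) \<partial>lborel \<partial>lborel)"
  proof (rule nn_integral_cong)
    fix x
    have "(\<integral>\<^sup>+h. indicator ?B (h + x) \<partial>lborel) = (\<integral>\<^sup>+h. indicator ?B h \<partial>lborel)"
      by (subst nn_integral_lborel_shift) auto
    then show "indicator ?A x * (\<integral>\<^sup>+h. indicator ?B h \<partial>lborel) = (\<integral>\<^sup>+h. indicator ?A x * indicator ?B (x + h) \<partial>lborel)"
      by (subst nn_integral_cmult) (auto simp: add.commute)
  qed
  also have "\<dots> = (\<integral>\<^sup>+h. \<integral>\<^sup>+x. indicator ?A x * indicator ?B (x + h) \<partial>lborel \<partial>lborel)"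
    by (rule lborel_pair.Fubini') measurable
  also have "\<dots> \<le> (\<integral>\<^sup>+h. ennreal D * indicator (ball (0::'a) (2 * r)) h \<partial>lborel)"
  proof (rule nn_integral_mono)
    fix h :: 'a
    let ?X = "{x \<in> A. x \<in> segment_dom \<Omega> h \<and> x + h \<in> B}"
    have "?X \<in> fmeasurable lborel"
      by (intro bounded_borel_fmeasurable bounded_subset[OF \<Omega>(2)]; use sub in auto)
    then have X: "emeasure lborel ?X \<le> ennreal D"
      using tc by (auto simp: transition_controlled_def emeasure_eq_measure2 intro: ennreal_leI)
    have "indicator ?A x * indicator ?B (x + h) \<le> indicator (ball (0::'a) (2 * r)) h * (indicator ?X x :: ennreal)" for x
    proof (cases "x \<in> ?A \<and> x + h \<in> ?B")
      case True
      have "x + t *\<^sub>R h \<in> ball c r" if "t \<in> {0..1}" for t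
      proof -
        have "(1 - t) *\<^sub>R x + t *\<^sub>R (x + h) \<in> ball c r"
          using convex_ball[of c r] True that by (intro convexD) auto
        then show ?thesis by (simp add: algebra_simps)
      qed
      then have "x \<in> segment_dom \<Omega> h" using ball by (auto simp: segment_dom_def)
      moreover have "norm h < 2 * r"
      proof -
        have "norm h = dist x (x + h)" by (simp add: dist_norm)
        also have "\<dots> \<le> dist c x + dist c (x + h)" by (rule dist_triangle3)
        also have "\<dots> < 2 * r" using True by auto
        finally show ?thesis .
      qed
      ultimately show ?thesis using True by (auto simp: indicator_def)
    qed (auto simp: indicator_def)
    then have "(\<integral>\<^sup>+x. indicator ?A x * indicator ?B (x + h) \<partial>lborel) \<le> (\<integral>\<^sup>+x. indicator (ball (0::'a) (2 * r)) h * indicator ?X x \<partial>lborel)"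
      by (intro nn_integral_mono)
    also have "\<dots> = indicator (ball (0::'a) (2 * r)) h * emeasure lborel ?X"
      by (subst nn_integral_cmult) auto
    also have "\<dots> \<le> indicator (ball (0::'a) (2 * r)) h * ennreal D" by (intro mult_left_mono X) auto
    finally show "(\<integral>\<^sup>+x. indicator ?A x * indicator ?B (x + h) \<partial>lborel) \<le> ennreal D * indicator (ball (0::'a) (2 * r)) h"
      by (simp add: mult.commute)
  qed
  also have "\<dots> = ennreal D * emeasure lborel (ball (0::'a) (2 * r))"
    by (rule nn_integral_cmult_indicator) auto
  finally show ?thesis
    using fm D by (simp add: emeasure_eq_measure2 ennreal_mult[symmetric] mult.commute)
qed

definition low_set_bound :: "'a::euclidean_space set \<Rightarrow> real \<Rightarrow> 'a set \<Rightarrow> real \<Rightarrow> bool" where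
  "low_set_bound \<Omega> \<eta> S C \<longleftrightarrow> (\<forall>A B D. transition_controlled \<Omega> A B D \<longrightarrow> \<eta> \<le> measure lborel B \<longrightarrow>
     measure lborel (A \<inter> S) \<le> C * D)"

lemma low_set_bound_compact:
  fixes \<Omega> :: "'a::euclidean_space set"
  assumes "compact K" and loc: "\<And>p. p \<in> K \<Longrightarrow> \<exists>r>0. \<exists>C. low_set_bound \<Omega> \<eta> (ball p r) C"
  shows "\<exists>C. low_set_bound \<Omega> \<eta> K C"
proof -
  obtain r C where rC: "\<And>p. p \<in> K \<Longrightarrow> r p > 0" "\<And>p. p \<in> K \<Longrightarrow> low_set_bound \<Omega> \<eta> (ball p (r p)) (C p)"
    using loc by metis
  have "K \<subseteq> (\<Union>p\<in>K. ball p (r p))" using rC(1) by force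
  then obtain F where F: "F \<subseteq> K" "finite F" "K \<subseteq> (\<Union>p\<in>F. ball p (r p))"
    using compactE_image[OF assms(1), of K "\<lambda>p. ball p (r p)"] by auto
  show ?thesis
  proof (intro exI[of _ "\<Sum>p\<in>F. C p"], unfold low_set_bound_def, intro allI impI)
    fix A B D assume tc: "transition_controlled \<Omega> A B D" and \<eta>: "\<eta> \<le> measure lborel B"
    have [measurable]: "A \<in> sets borel" using tc by (auto simp: transition_controlled_def)
    have "measure lborel (A \<inter> K) \<le> measure lborel (\<Union>p\<in>F. A \<inter> ball p (r p))"
      using F borel_compact[OF \<open>compact K\<close>]
      by (intro measure_mono_fmeasurable fmeasurable.finite_UN bounded_borel_fmeasurable)
         (auto intro!: sets.Int bounded_Int)
    also have "\<dots> \<le> (\<Sum>p\<in>F. measure lborel (A \<inter> ball p (r p)))"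
      using F(2) by (intro measure_UNION_le) auto
    also have "\<dots> \<le> (\<Sum>p\<in>F. C p * D)"
      using F(1) rC(2) tc \<eta> by (intro sum_mono) (auto simp: low_set_bound_def)
    finally show "measure lborel (A \<inter> K) \<le> (\<Sum>p\<in>F. C p) * D" by (simp add: sum_distrib_right)
  qed
qed

text \<open>
  The relation between \<open>a\<close> and \<open>b\<close> stated here, symmetrised, is an equivalence relation with open classes: nearby balls are
  compared by \<open>transition_translate\<close>.  The radii for which it holds depend on \<open>a\<close> and \<open>b\<close>, but not on the sets.
\<close>
lemma transition_chain:
  fixes \<Omega> :: "'a::euclidean_space set"
  assumes \<Omega>: "open \<Omega>" "connected \<Omega>" "bounded \<Omega>" and ab: "a \<in> \<Omega>" "b \<in> \<Omega>"
  shows "\<exists>r0>0. \<exists>C. \<forall>r A B D. 0 < r \<longrightarrow> r \<le> r0 \<longrightarrow> transition_controlled \<Omega> A B D \<longrightarrow>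
    measure lborel (A \<inter> ball b r) \<le> measure lborel (A \<inter> ball a r) + C * D"
proof -
  define R where "R = (\<lambda>a b. \<exists>r0>0. \<exists>C. \<forall>r A B D. 0 < r \<longrightarrow> r \<le> r0 \<longrightarrow> transition_controlled \<Omega> A B D \<longrightarrow>
    measure lborel (A \<inter> ball b r) \<le> measure lborel (A \<inter> ball a r) + C * D)"
  have local: "R y x" if xy: "ball c \<rho> \<subseteq> \<Omega>" "dist c x < \<rho> / 2" "dist c y < \<rho> / 2" for c x y \<rho>
  proof -
    have \<rho>: "\<rho> > 0" using xy(2) zero_le_dist[of c x] by linarith
    show ?thesis unfolding R_def
    proof (rule exI[of _ "\<rho> / 2"], rule conjI, rule half_gt_zero[OF \<rho>], rule exI[of _ 2], intro allI impI)
      fix r A B D assume r: "0 < r" "r \<le> \<rho> / 2" and tc: "transition_controlled \<Omega> A B D"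
      show "measure lborel (A \<inter> ball x r) \<le> measure lborel (A \<inter> ball y r) + 2 * D"
      proof (rule transition_translate[OF \<Omega>(1,3) tc])
        show "z + (y - x) \<in> ball y r" if "z \<in> ball x r" for z
          using that by (simp add: dist_norm algebra_simps)
        show "ball x r \<subseteq> segment_dom \<Omega> (y - x)"
        proof
          fix z assume z: "z \<in> ball x r"
          have "z + t *\<^sub>R (y - x) \<in> ball c \<rho>" if t: "t \<in> {0..1}" for t
          proof -
            have "(1 - t) *\<^sub>R x + t *\<^sub>R y \<in> ball c (\<rho> / 2)"
              using convex_ball[of c "\<rho> / 2"] xy t by (intro convexD) auto
            moreover have "dist ((1 - t) *\<^sub>R x + t *\<^sub>R y) (z + t *\<^sub>R (y - x)) = dist x z"
              by (simp add: dist_norm algebra_simps)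
            ultimately show ?thesis
              using dist_triangle[of c "z + t *\<^sub>R (y - x)" "(1 - t) *\<^sub>R x + t *\<^sub>R y"] z r by simp
          qed
          then show "z \<in> segment_dom \<Omega> (y - x)" using xy(1) by (auto simp: segment_dom_def)
        qed
      qed auto
    qed
  qed
  have trans: "R a c" if "R a b" "R b c" for a b c
  proof -
    obtain r1 C1 where 1: "r1 > 0" "\<And>r A B D. 0 < r \<Longrightarrow> r \<le> r1 \<Longrightarrow> transition_controlled \<Omega> A B D \<Longrightarrow>
      measure lborel (A \<inter> ball b r) \<le> measure lborel (A \<inter> ball a r) + C1 * D"
      using \<open>R a b\<close> unfolding R_def by blast
    obtain r2 C2 where 2: "r2 > 0" "\<And>r A B D. 0 < r \<Longrightarrow> r \<le> r2 \<Longrightarrow> transition_controlled \<Omega> A B D \<Longrightarrow>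
      measure lborel (A \<inter> ball c r) \<le> measure lborel (A \<inter> ball b r) + C2 * D"
      using \<open>R b c\<close> unfolding R_def by blast
    show ?thesis unfolding R_def
    proof (rule exI[of _ "min r1 r2"], rule conjI, use 1 2 in simp, rule exI[of _ "C1 + C2"], intro allI impI)
      fix r A B D assume "0 < r" "r \<le> min r1 r2" "transition_controlled \<Omega> A B D"
      with 1(2)[of r A B D] 2(2)[of r A B D]
      show "measure lborel (A \<inter> ball c r) \<le> measure lborel (A \<inter> ball a r) + (C1 + C2) * D"
        by (simp add: distrib_right)
    qed
  qed
  have "R a b \<and> R b a"
  proof (rule connected_equivalence_relation[OF \<Omega>(2) ab])
    fix x assume x: "x \<in> \<Omega>"
    obtain \<rho> where \<rho>: "\<rho> > 0" "ball x \<rho> \<subseteq> \<Omega>" by (rule openE[OF \<Omega>(1) x])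
    show "\<exists>T. openin (top_of_set \<Omega>) T \<and> x \<in> T \<and> (\<forall>y\<in>T. R x y \<and> R y x)"
    proof (intro exI[of _ "ball x (\<rho> / 2)"] conjI ballI)
      have "ball x (\<rho> / 2) \<subseteq> ball x \<rho>" using \<rho>(1) by (intro subset_ball) simp
      then have "ball x (\<rho> / 2) \<subseteq> \<Omega>" using \<rho>(2) by blast
      then show "openin (top_of_set \<Omega>) (ball x (\<rho> / 2))" using \<Omega>(1) by (simp add: openin_open_eq)
      show "x \<in> ball x (\<rho> / 2)" using \<rho>(1) by simp
      show "R x y" "R y x" if "y \<in> ball x (\<rho> / 2)" for y
        using local[OF \<rho>(2)] \<rho>(1) that by auto
    qed
  qed (use trans in blast)+
  then show ?thesis unfolding R_def by blast
qed

text \<open>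
  Cover a compact set that exhausts \<open>\<Omega>\<close> up to measure \<open>\<eta> / 2\<close> by finitely many balls.  One of them contains a fixed
  fraction of \<open>B\<close>, so \<open>A\<close> is small there by \<open>transition_product\<close>, and hence near \<open>a\<close> by \<open>transition_chain\<close>.  Which ball this
  is depends on the sets; the radius \<open>\<rho>\<close> and the summed constants serve for all of them.
\<close>
lemma low_set_bound_interior_point:
  fixes \<Omega> :: "'a::euclidean_space set"
  assumes \<Omega>: "open \<Omega>" "connected \<Omega>" "bounded \<Omega>" and \<eta>: "\<eta> > 0" and a: "a \<in> \<Omega>"
  shows "\<exists>r>0. \<exists>C. low_set_bound \<Omega> \<eta> (ball a r) C"
proof -
  have "\<Omega> \<in> sets lebesgue" using \<Omega>(1) by auto
  then obtain K where K: "closed K" "K \<subseteq> \<Omega>" "\<Omega> - K \<in> lmeasurable" "emeasure lebesgue (\<Omega> - K) < ennreal (\<eta> / 2)"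
    using sets_lebesgue_inner_closed[of \<Omega> "\<eta> / 2"] \<eta> by (metis half_gt_zero)
  have cK: "compact K" using K \<Omega>(3) bounded_subset compact_eq_bounded_closed by blast
  have [measurable]: "K \<in> sets borel" "\<Omega> \<in> sets borel" using K(1) \<Omega>(1) by auto
  have mK: "measure lborel (\<Omega> - K) < \<eta> / 2"
  proof -
    have "emeasure lborel (\<Omega> - K) < ennreal (\<eta> / 2)" using K(4) by (simp add: emeasure_completion)
    moreover have "\<Omega> - K \<in> fmeasurable lborel"
      using \<Omega>(3) by (intro bounded_borel_fmeasurable) (auto intro: bounded_subset)
    ultimately show ?thesis using \<eta> by (simp add: emeasure_eq_measure2 ennreal_less_iff)
  qed
  have "\<exists>r C. 0 < r \<and> ball x r \<subseteq> \<Omega> \<and> (\<forall>A B D. transition_controlled \<Omega> A B D \<longrightarrow>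
      measure lborel (A \<inter> ball a r) \<le> measure lborel (A \<inter> ball x r) + C * D)" if x: "x \<in> K" for x
  proof -
    have x': "x \<in> \<Omega>" using x K(2) by auto
    obtain \<rho> where \<rho>: "\<rho> > 0" "ball x \<rho> \<subseteq> \<Omega>" by (rule openE[OF \<Omega>(1) x'])
    obtain r0 C where r0: "r0 > 0" "\<And>r A B D. 0 < r \<Longrightarrow> r \<le> r0 \<Longrightarrow> transition_controlled \<Omega> A B D \<Longrightarrow>
      measure lborel (A \<inter> ball a r) \<le> measure lborel (A \<inter> ball x r) + C * D"
      using transition_chain[OF \<Omega> x' a] by blast
    have "ball x (min r0 \<rho>) \<subseteq> \<Omega>" using \<rho>(2) subset_ball[of "min r0 \<rho>" \<rho> x] by auto
    with \<rho>(1) r0(1) r0(2)[of "min r0 \<rho>"] show ?thesis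
      by (intro exI[of _ "min r0 \<rho>"] exI[of _ C]) auto
  qed
  then obtain r C where rC: "\<And>x. x \<in> K \<Longrightarrow> 0 < r x" "\<And>x. x \<in> K \<Longrightarrow> ball x (r x) \<subseteq> \<Omega>"
    "\<And>x A B D. x \<in> K \<Longrightarrow> transition_controlled \<Omega> A B D \<Longrightarrow>
      measure lborel (A \<inter> ball a (r x)) \<le> measure lborel (A \<inter> ball x (r x)) + C x * D"
    by metis
  have "K \<subseteq> (\<Union>p\<in>K. ball p (r p))" using rC(1) by force
  then obtain F where F: "F \<subseteq> K" "finite F" "K \<subseteq> (\<Union>p\<in>F. ball p (r p))"
    using compactE_image[OF cK, of K "\<lambda>p. ball p (r p)"] by auto
  define N where "N = real (card F) + 1"
  have N: "N > 0" by (simp add: N_def)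
  define \<rho> where "\<rho> = Min (insert 1 (r ` F))"
  have \<rho>: "\<rho> > 0" "\<And>x. x \<in> F \<Longrightarrow> \<rho> \<le> r x" using F rC(1) by (auto simp: \<rho>_def)
  define C' where "C' = (\<lambda>x. measure lborel (ball (0::'a) (2 * r x)) * (2 * N / \<eta>) + \<bar>C x\<bar>)"
  have C'0: "C' x \<ge> 0" for x using N \<eta> by (auto simp: C'_def)
  have "low_set_bound \<Omega> \<eta> (ball a \<rho>) (\<Sum>x\<in>F. C' x)"
    unfolding low_set_bound_def
  proof (intro allI impI)
    fix A B D assume tc: "transition_controlled \<Omega> A B D" and \<eta>B: "\<eta> \<le> measure lborel B"
    have [measurable]: "A \<in> sets borel" "B \<in> sets borel" and sub: "A \<subseteq> \<Omega>" "B \<subseteq> \<Omega>" and D: "D \<ge> 0"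
      using tc by (auto simp: transition_controlled_def)
    have fm: "X \<in> fmeasurable lborel" if "X \<in> sets borel" "X \<subseteq> \<Omega>" for X
      using that \<Omega>(3) by (intro bounded_borel_fmeasurable) (auto intro: bounded_subset)
    have "\<exists>x\<in>F. \<eta> / (2 * N) \<le> measure lborel (B \<inter> ball x (r x))"
    proof (rule ccontr)
      assume "\<not> ?thesis"
      then have small: "measure lborel (B \<inter> ball x (r x)) \<le> \<eta> / (2 * N)" if "x \<in> F" for x
        using that by force
      have "measure lborel B \<le> measure lborel ((\<Omega> - K) \<union> (\<Union>x\<in>F. B \<inter> ball x (r x)))"
        using F sub by (intro measure_mono_fmeasurable fm sets.Un sets.finite_UN) auto
      also have "\<dots> \<le> measure lborel (\<Omega> - K) + measure lborel (\<Union>x\<in>F. B \<inter> ball x (r x))"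
        using F(2) by (intro measure_Un_le sets.finite_UN) auto
      also have "measure lborel (\<Union>x\<in>F. B \<inter> ball x (r x)) \<le> (\<Sum>x\<in>F. measure lborel (B \<inter> ball x (r x)))"
        using F(2) by (intro measure_UNION_le) auto
      also have "\<dots> \<le> (\<Sum>x\<in>F. \<eta> / (2 * N))" by (intro sum_mono small)
      also have "\<dots> \<le> N * (\<eta> / (2 * N))"
        unfolding sum_constant by (intro mult_right_mono) (use \<eta> N in \<open>auto simp: N_def\<close>)
      also have "\<dots> = \<eta> / 2" using N by simp
      finally show False using mK \<eta>B by simp
    qed
    then obtain x where x: "x \<in> F" "\<eta> / (2 * N) \<le> measure lborel (B \<inter> ball x (r x))" by blast
    have xK: "x \<in> K" using x F by auto
    have "measure lborel (A \<inter> ball x (r x)) * (\<eta> / (2 * N)) \<le> measure lborel (A \<inter> ball x (r x)) * measure lborel (B \<inter> ball x (r x))"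
      by (intro mult_left_mono x) auto
    also have "\<dots> \<le> measure lborel (ball (0::'a) (2 * r x)) * D"
      by (rule transition_product[OF \<Omega>(1,3) tc rC(2)[OF xK]])
    finally have 1: "measure lborel (A \<inter> ball x (r x)) \<le> measure lborel (ball (0::'a) (2 * r x)) * (2 * N / \<eta>) * D"
      using N \<eta> by (simp add: field_simps)
    have "measure lborel (A \<inter> ball a \<rho>) \<le> measure lborel (A \<inter> ball a (r x))"
      using \<rho>(2)[OF x(1)] sub by (intro measure_mono_fmeasurable fm) auto
    also have "\<dots> \<le> measure lborel (A \<inter> ball x (r x)) + C x * D" by (rule rC(3)[OF xK tc])
    also have "\<dots> \<le> C' x * D"
      using 1 mult_right_mono[OF abs_ge_self[of "C x"] D] by (simp add: C'_def distrib_right)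
    also have "\<dots> \<le> (\<Sum>x\<in>F. C' x) * D"
      using x(1) F(2) C'0 by (intro mult_right_mono D member_le_sum) auto
    finally show "measure lborel (A \<inter> ball a \<rho>) \<le> (\<Sum>x\<in>F. C' x) * D" .
  qed
  with \<rho>(1) show ?thesis by blast
qed

text \<open>
  A translation by \<open>h\<close> along \<open>n\<close> leaves the argument of \<open>\<gamma>\<close> unchanged and raises the height by \<open>r / 4\<close>.  So it
  maps the part of \<open>\<Omega>\<close> near \<open>p\<close> into the compact set \<open>K\<close>, where interior points have already been treated.
\<close>
lemma low_set_bound_boundary_point:
  fixes \<Omega> :: "'a::euclidean_space set"
  assumes \<Omega>: "open \<Omega>" "bounded \<Omega>" and bd: "Ck_boundary k \<Omega>"
    and int: "\<And>a. a \<in> \<Omega> \<Longrightarrow> \<exists>r>0. \<exists>C. low_set_bound \<Omega> \<eta> (ball a r) C"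
    and p: "p \<in> frontier \<Omega>"
  shows "\<exists>r>0. \<exists>C. low_set_bound \<Omega> \<eta> (ball p r) C"
proof -
  obtain r n \<gamma> where r: "r > 0" and n: "norm n = 1" and \<gamma>: "Ck_ext k UNIV UNIV \<gamma>"
    and graph: "\<Omega> \<inter> ball p r = {x \<in> ball p r. \<gamma> (x - (x \<bullet> n) *\<^sub>R n) < x \<bullet> n}"
    using bd p unfolding Ck_boundary_def by blast
  have \<gamma>c: "continuous_on UNIV \<gamma>" by (rule Ck_ext_imp_continuous[OF \<gamma>])
  define h where "h = (r / 4) *\<^sub>R n"
  have nn: "n \<bullet> n = 1" using n by (simp add: dot_square_norm)
  define K where "K = {y \<in> cball p (3 * r / 4). \<gamma> (y - (y \<bullet> n) *\<^sub>R n) \<le> y \<bullet> n - r / 4}"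
  have "closed {y. \<gamma> (y - (y \<bullet> n) *\<^sub>R n) \<le> y \<bullet> n - r / 4}"
    by (intro closed_Collect_le continuous_on_compose2[OF \<gamma>c]) (auto intro!: continuous_intros)
  moreover have "K = cball p (3 * r / 4) \<inter> {y. \<gamma> (y - (y \<bullet> n) *\<^sub>R n) \<le> y \<bullet> n - r / 4}"
    by (auto simp: K_def)
  ultimately have cK: "compact K" by (simp add: compact_Int_closed)
  have K\<Omega>: "K \<subseteq> \<Omega>"
  proof
    fix y assume "y \<in> K"
    then have "y \<in> {x \<in> ball p r. \<gamma> (x - (x \<bullet> n) *\<^sub>R n) < x \<bullet> n}" using r by (auto simp: K_def)
    then show "y \<in> \<Omega>" using graph by blast
  qed
  obtain C where C: "low_set_bound \<Omega> \<eta> K C"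
    using low_set_bound_compact[OF cK int] K\<Omega> by blast
  have flat: "x + t *\<^sub>R h - ((x + t *\<^sub>R h) \<bullet> n) *\<^sub>R n = x - (x \<bullet> n) *\<^sub>R n" for x t
    using nn by (simp add: h_def inner_add_left algebra_simps)
  have height: "(x + t *\<^sub>R h) \<bullet> n = x \<bullet> n + t * (r / 4)" for x t
    using nn by (simp add: h_def inner_add_left)
  have near: "dist p (x + t *\<^sub>R h) \<le> dist p x + r / 4" if "t \<in> {0..1}" for x t
  proof -
    have "dist p (x + t *\<^sub>R h) \<le> dist p x + dist x (x + t *\<^sub>R h)" by (rule dist_triangle)
    also have "dist x (x + t *\<^sub>R h) = t * (r / 4)" using that r n by (simp add: h_def dist_norm)
    also have "\<dots> \<le> 1 * (r / 4)" using that r by (intro mult_right_mono) auto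
    finally show ?thesis by simp
  qed
  have "low_set_bound \<Omega> \<eta> (ball p (r / 2)) (C + 2)"
    unfolding low_set_bound_def
  proof (intro allI impI)
    fix A B D assume tc: "transition_controlled \<Omega> A B D" and \<eta>B: "\<eta> \<le> measure lborel B"
    have "A \<inter> ball p (r / 2) = A \<inter> (\<Omega> \<inter> ball p (r / 2))" using tc by (auto simp: transition_controlled_def)
    also have "measure lborel \<dots> \<le> measure lborel (A \<inter> K) + 2 * D"
    proof (rule transition_translate[OF \<Omega> tc, where h=h])
      have up: "\<gamma> (x - (x \<bullet> n) *\<^sub>R n) < x \<bullet> n" if "x \<in> \<Omega> \<inter> ball p (r / 2)" for x
      proof -
        have "x \<in> \<Omega> \<inter> ball p r" using that r by auto
        then show ?thesis using graph by blast
      qed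
      show "\<Omega> \<inter> ball p (r / 2) \<subseteq> segment_dom \<Omega> h"
      proof
        fix x assume x: "x \<in> \<Omega> \<inter> ball p (r / 2)"
        have "x + t *\<^sub>R h \<in> \<Omega>" if t: "t \<in> {0..1}" for t
        proof -
          have "0 \<le> t * (r / 4)" using t r by simp
          then have "\<gamma> (x + t *\<^sub>R h - ((x + t *\<^sub>R h) \<bullet> n) *\<^sub>R n) < (x + t *\<^sub>R h) \<bullet> n"
            unfolding flat[of x t] using up[OF x] height[of x t] by linarith
          moreover have "x + t *\<^sub>R h \<in> ball p r" using near[OF t, of x] x r by auto
          ultimately have "x + t *\<^sub>R h \<in> {x \<in> ball p r. \<gamma> (x - (x \<bullet> n) *\<^sub>R n) < x \<bullet> n}" by blast
          then show ?thesis using graph by blast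
        qed
        then show "x \<in> segment_dom \<Omega> h" by (simp add: segment_dom_def)
      qed
      show "x + h \<in> K" if x: "x \<in> \<Omega> \<inter> ball p (r / 2)" for x
      proof -
        have flat1: "x + h - ((x + h) \<bullet> n) *\<^sub>R n = x - (x \<bullet> n) *\<^sub>R n"
          using flat[of x 1] by (simp only: scaleR_one)
        have "(x + h) \<bullet> n = x \<bullet> n + r / 4" using height[of x 1] by simp
        then have "\<gamma> (x + h - ((x + h) \<bullet> n) *\<^sub>R n) \<le> (x + h) \<bullet> n - r / 4"
          unfolding flat1 using up[OF x] by linarith
        moreover have "x + h \<in> cball p (3 * r / 4)" using near[of 1 x] x by simp
        ultimately show ?thesis unfolding K_def by blast
      qed
      show "\<Omega> \<inter> ball p (r / 2) \<in> sets borel" using \<Omega>(1) by auto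
      show "K \<in> sets borel" using cK by (rule borel_compact)
    qed
    also have "measure lborel (A \<inter> K) \<le> C * D" using C tc \<eta>B by (auto simp: low_set_bound_def)
    finally show "measure lborel (A \<inter> ball p (r / 2)) \<le> (C + 2) * D" by (simp add: distrib_right)
  qed
  with r show ?thesis by (metis half_gt_zero)
qed

theorem low_set_bound_domain:
  fixes \<Omega> :: "'a::euclidean_space set"
  assumes \<Omega>: "open \<Omega>" "connected \<Omega>" "bounded \<Omega>" and bd: "Ck_boundary k \<Omega>" and \<eta>: "\<eta> > 0"
  obtains C where "C \<ge> 0" "\<And>A B D. transition_controlled \<Omega> A B D \<Longrightarrow> \<eta> \<le> measure lborel B \<Longrightarrow> measure lborel A \<le> C * D"
proof -
  note int = low_set_bound_interior_point[OF \<Omega> \<eta>]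
  have "\<exists>r>0. \<exists>C. low_set_bound \<Omega> \<eta> (ball p r) C" if "p \<in> closure \<Omega>" for p
  proof (cases "p \<in> \<Omega>")
    case False
    then have "p \<in> frontier \<Omega>" using that \<Omega>(1) by (simp add: frontier_def interior_open)
    with low_set_bound_boundary_point[OF \<Omega>(1,3) bd, of \<eta> p] int show ?thesis by blast
  qed (rule int)
  then obtain C where C: "low_set_bound \<Omega> \<eta> (closure \<Omega>) C"
    using low_set_bound_compact[of "closure \<Omega>"] \<Omega>(3) by (metis compact_closure)
  show ?thesis
  proof (rule that[of "\<bar>C\<bar>"])
    fix A B D assume tc: "transition_controlled \<Omega> A B D" and "\<eta> \<le> measure lborel B"
    then have "measure lborel (A \<inter> closure \<Omega>) \<le> C * D" using C by (auto simp: low_set_bound_def)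
    moreover have "A \<inter> closure \<Omega> = A" using tc closure_subset by (fastforce simp: transition_controlled_def)
    moreover have "C * D \<le> \<bar>C\<bar> * D" using tc by (intro mult_right_mono) (auto simp: transition_controlled_def)
    ultimately show "measure lborel A \<le> \<bar>C\<bar> * D" by simp
  qed simp
qed

section \<open>The entropy density\<close>

lemma L1_loc_borel_majorant:
  fixes g :: "real \<Rightarrow> real"
  assumes "L1_loc {0..} g"
  obtains w where "integrable lborel w" "\<And>t. 0 \<le> w t" "AE t in lborel. 0 < t \<and> t \<le> M \<longrightarrow> g t \<le> w t"
proof -
  have "compact {0..M}" "{0..M} \<subseteq> {0..}" by auto
  then have "set_integrable lebesgue {0..M} g" using assms by (auto simp: L1_loc_def)
  then have I: "integrable lebesgue (\<lambda>t. indicator {0..M} t *\<^sub>R g t)" by (simp add: set_integrable_def)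
  obtain v where v: "v \<in> borel_measurable lborel" "AE t in lborel. indicator {0..M} t *\<^sub>R g t = v t"
    using completion_ex_borel_measurable_real[OF borel_measurable_integrable[OF I]] by metis
  have "integrable lebesgue v"
    by (rule integrable_cong_AE_imp[OF I measurable_completion[OF v(1)] AE_completion])
       (use v(2) in \<open>eventually_elim, simp\<close>)
  then have "integrable lborel v" using integrable_completion[OF v(1)] by simp
  show ?thesis
  proof (rule that[of "\<lambda>t. \<bar>v t\<bar>"])
    show "integrable lborel (\<lambda>t. \<bar>v t\<bar>)" using \<open>integrable lborel v\<close> by simp
    show "AE t in lborel. 0 < t \<and> t \<le> M \<longrightarrow> g t \<le> \<bar>v t\<bar>"
      using v(2) by eventually_elim auto
  qed simp
qed

lemma AE_lebesgue_on_greaterThan: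
  "(AE t in lebesgue_on {0::real<..}. P t) \<longleftrightarrow> (AE t in lborel. 0 < t \<longrightarrow> P t)"
  by (subst AE_restrict_space_iff) (auto simp: AE_completion_iff)

locale fitness_entropy =
  fixes \<Omega> :: "'a::euclidean_space set"
    and f :: "'a \<Rightarrow> real \<Rightarrow> real"
    and m :: "'a \<Rightarrow> real"
    and g1 g2 :: "real \<Rightarrow> real"
  assumes dom: "open \<Omega>" "connected \<Omega>" "bounded \<Omega>" "\<Omega> \<noteq> {}" "Ck_boundary 1 \<Omega>"
    and f_C2: "Ck_closed 2 (\<Omega> \<times> {0<..}) (closure \<Omega> \<times> {0<..}) (\<lambda>(x, u). f x u)"
    and fu_neg: "\<And>x u. x \<in> closure \<Omega> \<Longrightarrow> 0 < u \<Longrightarrow> f_u f x u < 0"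
    and g1: "L1_loc {0..} g1"
    and f_bound: "\<And>x. x \<in> closure \<Omega> \<Longrightarrow> AE u in lebesgue_on {0<..}. \<bar>f x u\<bar> \<le> g1 u"
    and g2: "L1_loc {0..} g2"
    and fu_fxu_bound: "\<And>x. x \<in> \<Omega> \<Longrightarrow> AE u in lebesgue_on {0<..}.
                         u * \<bar>f_u f x u\<bar> + u * norm (f_xu f x u) \<le> g2 u"
    and m_C2: "Ck_closed 2 \<Omega> (closure \<Omega>) m"
    and m_pos: "\<And>x. x \<in> closure \<Omega> \<Longrightarrow> 0 < m x"
    and m_density: "prob_density_on \<Omega> m"
    and f_m: "\<And>x. x \<in> closure \<Omega> \<Longrightarrow> f x (m x) = 0"
    and f_lim: "\<And>K. \<forall>\<^sub>F u in at_top. \<forall>x\<in>closure \<Omega>. f x u \<le> K"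
begin

lemma cont_closure: "continuous_on (closure \<Omega> \<times> {0<..}) (\<lambda>(x, u). f x u)"
  using f_C2 by (simp add: Ck_closed_def)

lemmas interior_regularity = C2_interior_regularity[OF dom(1) f_C2]

lemma der: "x \<in> closure \<Omega> \<Longrightarrow> 0 < u \<Longrightarrow> (f x has_real_derivative f_u f x u) (at u)"
  and cont_fu_closure: "continuous_on (closure \<Omega> \<times> {0<..}) (\<lambda>(x, u). f_u f x u)"
  using C1_extension_derivative_closure[OF cont_closure interior_regularity(1,4)] by blast+

lemma in_closure: "x \<in> \<Omega> \<Longrightarrow> x \<in> closure \<Omega>" using closure_subset by blast

lemma regular_fitness_exists: "\<exists>w. regular_fitness \<Omega> f w M"
proof -
  obtain w where w: "integrable lborel w" "\<And>t. 0 \<le> w t" "AE t in lborel. 0 < t \<and> t \<le> M \<longrightarrow> g2 t \<le> w t"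
    using L1_loc_borel_majorant[OF g2] by metis
  have sub: "\<Omega> \<times> {0::real<..} \<subseteq> closure \<Omega> \<times> {0<..}" using closure_subset by auto
  have "regular_fitness \<Omega> f w M"
  proof
    show "AE \<xi> in lborel. 0 < \<xi> \<and> \<xi> \<le> M \<longrightarrow> \<xi> * \<bar>f_u f x \<xi>\<bar> + \<xi> * norm (f_xu f x \<xi>) \<le> w \<xi>" if "x \<in> \<Omega>" for x
      using fu_fxu_bound[OF that, unfolded AE_lebesgue_on_greaterThan] w(3) by eventually_elim auto
    show "continuous_on (\<Omega> \<times> {0<..}) (\<lambda>(x, u). f x u)" by (rule continuous_on_subset[OF cont_closure sub])
    show "continuous_on (\<Omega> \<times> {0<..}) (\<lambda>(x, u). f_u f x u)" by (rule continuous_on_subset[OF cont_fu_closure sub])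
  qed (use dom w interior_regularity fu_neg in_closure in auto)
  then show ?thesis by blast
qed

lemma decreasing: "x \<in> closure \<Omega> \<Longrightarrow> 0 < u \<Longrightarrow> u \<le> v \<Longrightarrow> f x v \<le> f x u"
  by (rule DERIV_nonpos_imp_decreasing_open[of u v "f x"])
     (auto intro!: exI[of _ "f_u f x _"] der less_imp_le[OF fu_neg] DERIV_atLeastAtMost_imp_continuous_on)

lemma compact_closure_dom: "compact (closure \<Omega>)" using dom(3) by simp

lemma m_bounds:
  obtains m0 m1 where "0 < m0" "\<And>x. x \<in> closure \<Omega> \<Longrightarrow> m0 \<le> m x \<and> m x \<le> m1"
proof -
  have c: "continuous_on (closure \<Omega>) m" using m_C2 by (simp add: Ck_closed_def)
  have ne: "closure \<Omega> \<noteq> {}" using dom(4) by simp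
  obtain x0 where "x0 \<in> closure \<Omega>" "\<And>x. x \<in> closure \<Omega> \<Longrightarrow> m x0 \<le> m x"
    using continuous_attains_inf[OF compact_closure_dom ne c] by blast
  moreover obtain x1 where "x1 \<in> closure \<Omega>" "\<And>x. x \<in> closure \<Omega> \<Longrightarrow> m x \<le> m x1"
    using continuous_attains_sup[OF compact_closure_dom ne c] by blast
  ultimately show ?thesis using m_pos by (intro that[of "m x0" "m x1"]) auto
qed

text \<open>
  By compactness \<open>f_u\<close> is bounded and bounded away from \<open>0\<close> on \<open>closure \<Omega> \<times> {a..b}\<close>; the derivative at boundary points comes from
  \<open>C1_extension_derivative_closure\<close>.
\<close>
lemma uniform_slopes:
  assumes ab: "0 < a" "a \<le> b"
  obtains \<kappa> L where "0 < \<kappa>" "0 < L"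
    "\<And>x u v. x \<in> closure \<Omega> \<Longrightarrow> a \<le> u \<Longrightarrow> u \<le> v \<Longrightarrow> v \<le> b \<Longrightarrow> \<kappa> * (v - u) \<le> f x u - f x v"
    "\<And>x u v. x \<in> closure \<Omega> \<Longrightarrow> a \<le> u \<Longrightarrow> u \<le> v \<Longrightarrow> v \<le> b \<Longrightarrow> f x u - f x v \<le> L * (v - u)"
proof -
  let ?X = "closure \<Omega> \<times> {a..b}" and ?g = "\<lambda>(x, u). f_u f x u"
  have X: "compact ?X" using compact_closure_dom by (intro compact_Times) auto
  have ne: "?X \<noteq> {}" using dom(4) ab by auto
  have c: "continuous_on ?X ?g"
    by (rule continuous_on_subset[OF cont_fu_closure]) (use ab in auto)
  obtain p where p: "p \<in> ?X" "\<And>z. z \<in> ?X \<Longrightarrow> ?g z \<le> ?g p"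
    using continuous_attains_sup[OF X ne c] by metis
  obtain q where q: "q \<in> ?X" "\<And>z. z \<in> ?X \<Longrightarrow> ?g q \<le> ?g z"
    using continuous_attains_inf[OF X ne c] by metis
  have bounds: "- ?g p * (v - u) \<le> f x u - f x v \<and> f x u - f x v \<le> - ?g q * (v - u)"
    if x: "x \<in> closure \<Omega>" and uv: "a \<le> u" "u \<le> v" "v \<le> b" for x u v
  proof (cases "u = v")
    case False
    then obtain \<xi> where \<xi>: "u < \<xi>" "\<xi> < v" "f x v - f x u = (v - u) * f_u f x \<xi>"
      using MVT2[of u v "f x" "f_u f x"] der[OF x] uv ab by fastforce
    have "f_u f x \<xi> \<le> ?g p" "?g q \<le> f_u f x \<xi>" using p(2)[of "(x, \<xi>)"] q(2)[of "(x, \<xi>)"] x \<xi> uv by simp_all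
    then have "(v - u) * f_u f x \<xi> \<le> (v - u) * ?g p" "(v - u) * ?g q \<le> (v - u) * f_u f x \<xi>"
      using uv by (auto intro!: mult_left_mono)
    with \<xi>(3) show ?thesis by (simp add: mult.commute minus_mult_left[symmetric])
  qed simp
  show ?thesis
    by (rule that[of "- ?g p" "- ?g q"]) (use p(1) q(1) fu_neg ab bounds in auto)
qed

lemma E_dens_derivative:
  assumes x: "x \<in> closure \<Omega>" and u: "0 < u"
  shows "(E_dens f m x has_real_derivative - f x u) (at u)"
proof -
  define a b where "a = min u (m x) / 2" and "b = max u (m x) + 1"
  have ab: "0 < a" "a < u" "u < b" "a \<le> m x" "m x \<le> b" using u m_pos[OF x] by (auto simp: a_def b_def)
  have c: "continuous_on {a..b} (f x)"
    by (intro continuous_at_imp_continuous_on ballI DERIV_isCont[OF der[OF x]]) (use ab in auto)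
  have "((\<lambda>v. LBINT y=m x..v. f x y) has_vector_derivative f x u) (at u within {a..b})"
    by (rule interval_integral_FTC2) (use ab c in auto)
  then have "((\<lambda>v. LBINT y=m x..v. f x y) has_real_derivative f x u) (at u)"
    using ab by (simp add: has_real_derivative_iff_has_vector_derivative at_within_Icc_at)
  from DERIV_minus[OF this] show ?thesis by (simp add: E_dens_def[abs_def])
qed

lemma E_dens_at_m: "E_dens f m x (m x) = 0"
  by (simp add: E_dens_def)

lemma E_dens_mvt:
  assumes x: "x \<in> closure \<Omega>" and uv: "0 < u" "0 < v"
  obtains \<xi> where "min u v \<le> \<xi>" "\<xi> \<le> max u v" "E_dens f m x v - E_dens f m x u = - (v - u) * f x \<xi>"
proof -
  have *: "\<exists>\<xi>. u < \<xi> \<and> \<xi> < v \<and> E_dens f m x v - E_dens f m x u = (v - u) * (- f x \<xi>)"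
    if "0 < u" "u < v" for u v
    by (rule MVT2) (use that in \<open>auto intro!: E_dens_derivative x\<close>)
  consider "u = v" | "u < v" | "v < u" by linarith
  then show ?thesis
  proof cases
    case 1 then show ?thesis by (intro that[of u]) auto
  next
    case 2
    with *[of u v] uv obtain \<xi> where "u < \<xi>" "\<xi> < v" "E_dens f m x v - E_dens f m x u = (v - u) * (- f x \<xi>)" by blast
    with 2 show ?thesis by (intro that[of \<xi>]) (auto simp: algebra_simps)
  next
    case 3
    with *[of v u] uv obtain \<xi> where "v < \<xi>" "\<xi> < u" "E_dens f m x u - E_dens f m x v = (u - v) * (- f x \<xi>)" by blast
    with 3 show ?thesis by (intro that[of \<xi>]) (auto simp: algebra_simps)
  qed
qed

lemma f_sign:
  assumes "x \<in> closure \<Omega>"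
  shows "0 < u \<Longrightarrow> u \<le> m x \<Longrightarrow> 0 \<le> f x u" and "m x \<le> u \<Longrightarrow> f x u \<le> 0"
  using decreasing[OF assms, of u "m x"] decreasing[OF assms m_pos[OF assms], of u] f_m[OF assms] by auto

lemma E_dens_below_m:
  assumes "0 \<le> u" "u \<le> m x"
  shows "E_dens f m x u = (LINT t|lborel. indicator {u<..<m x} t *\<^sub>R f x t)"
proof -
  have "E_dens f m x u = (LBINT \<xi>=ereal u..ereal (m x). f x \<xi>)"
    unfolding E_dens_def by (subst interval_integral_endpoints_reverse) simp
  then show ?thesis
    using assms by (simp add: interval_lebesgue_integral_le_eq set_lebesgue_integral_def)
qed

lemma E_dens_nonneg:
  assumes x: "x \<in> closure \<Omega>" and u: "0 \<le> u"
  shows "0 \<le> E_dens f m x u"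
proof (cases "u = 0")
  case True
  have "0 \<le> (LINT t|lborel. indicator {0<..<m x} t *\<^sub>R f x t)"
    using f_sign(1)[OF x] by (intro Bochner_Integration.integral_nonneg) (auto simp: indicator_def)
  then show ?thesis using True E_dens_below_m[of 0 x] m_pos[OF x] by simp
next
  case False
  with u have u: "0 < u" by simp
  obtain \<xi> where \<xi>: "min (m x) u \<le> \<xi>" "\<xi> \<le> max (m x) u" "E_dens f m x u - E_dens f m x (m x) = - (u - m x) * f x \<xi>"
    using E_dens_mvt[OF x m_pos[OF x] u] by blast
  have "0 < \<xi>" using \<xi>(1) u m_pos[OF x] by linarith
  have "0 \<le> - (u - m x) * f x \<xi>"
  proof (cases "u \<le> m x")
    case True
    then show ?thesis using f_sign(1)[OF x \<open>0 < \<xi>\<close>] \<xi> by (intro mult_nonneg_nonneg) auto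
  next
    case False
    then show ?thesis using f_sign(2)[OF x] \<xi> by (intro mult_nonpos_nonpos) auto
  qed
  then show ?thesis using \<xi>(3) by (simp add: E_dens_at_m)
qed

lemma E_dens_upper:
  assumes x: "x \<in> closure \<Omega>" and u: "0 < u"
  shows "E_dens f m x u \<le> (m x - u) * f x u"
proof -
  obtain \<xi> where \<xi>: "min (m x) u \<le> \<xi>" "\<xi> \<le> max (m x) u" "E_dens f m x u - E_dens f m x (m x) = - (u - m x) * f x \<xi>"
    using E_dens_mvt[OF x m_pos[OF x] u] by blast
  have "0 < \<xi>" using \<xi>(1) u m_pos[OF x] by linarith
  have "(m x - u) * f x \<xi> \<le> (m x - u) * f x u"
  proof (cases "u \<le> m x")
    case True
    then show ?thesis using decreasing[OF x u, of \<xi>] \<xi> by (intro mult_left_mono) auto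
  next
    case False
    then show ?thesis using decreasing[OF x \<open>0 < \<xi>\<close>, of u] \<xi> by (intro mult_left_mono_neg) auto
  qed
  then show ?thesis using \<xi>(3) by (simp add: E_dens_at_m)
qed

text \<open>
  The difference of \<open>E_dens\<close> and the parabola vanishes at \<open>m x\<close>, decreases before and increases after it.
\<close>
lemma E_dens_quadratic_lower:
  assumes x: "x \<in> closure \<Omega>" and a: "0 < a" and u: "a \<le> u" "u \<le> b" and mx: "a \<le> m x" "m x \<le> b"
    and \<kappa>: "\<And>u v. a \<le> u \<Longrightarrow> u \<le> v \<Longrightarrow> v \<le> b \<Longrightarrow> \<kappa> * (v - u) \<le> f x u - f x v"
  shows "\<kappa> / 2 * (m x - u)\<^sup>2 \<le> E_dens f m x u"
proof -
  define q where "q = (\<lambda>u. E_dens f m x u - \<kappa> / 2 * (m x - u)\<^sup>2)"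
  have dq: "(q has_real_derivative - f x v + \<kappa> * (m x - v)) (at v)" if "0 < v" for v
    unfolding q_def using that
    by (auto intro!: derivative_eq_intros E_dens_derivative x simp: field_simps)
  have qm: "q (m x) = 0" by (simp add: q_def E_dens_at_m)
  have fm: "f x (m x) = 0" by (rule f_m[OF x])
  have "0 \<le> q u"
  proof (cases "u < m x")
    case True
    then obtain \<xi> where \<xi>: "u < \<xi>" "\<xi> < m x" "q (m x) - q u = (m x - u) * (- f x \<xi> + \<kappa> * (m x - \<xi>))"
      using MVT2[of u "m x" q "\<lambda>v. - f x v + \<kappa> * (m x - v)"] dq a u by fastforce
    have "- f x \<xi> + \<kappa> * (m x - \<xi>) \<le> 0" using \<kappa>[of \<xi> "m x"] \<xi> u mx fm by simp
    then have "(m x - u) * (- f x \<xi> + \<kappa> * (m x - \<xi>)) \<le> 0" using True by (intro mult_nonneg_nonpos) auto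
    then show ?thesis using \<xi>(3) qm by simp
  next
    case False
    show ?thesis
    proof (cases "u = m x")
      case False
      with \<open>\<not> u < m x\<close> have "m x < u" by simp
      then obtain \<xi> where \<xi>: "m x < \<xi>" "\<xi> < u" "q u - q (m x) = (u - m x) * (- f x \<xi> + \<kappa> * (m x - \<xi>))"
        using MVT2[of "m x" u q "\<lambda>v. - f x v + \<kappa> * (m x - v)"] dq m_pos[OF x] by fastforce
      have "0 \<le> - f x \<xi> + \<kappa> * (m x - \<xi>)" using \<kappa>[of "m x" \<xi>] \<xi> u mx fm by (simp add: algebra_simps)
      then have "0 \<le> (u - m x) * (- f x \<xi> + \<kappa> * (m x - \<xi>))" using \<open>m x < u\<close> by (intro mult_nonneg_nonneg) auto
      then show ?thesis using \<xi>(3) qm by simp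
    qed (simp add: qm)
  qed
  then show ?thesis by (simp add: q_def)
qed

lemma E_dens_linear_lower:
  assumes x: "x \<in> closure \<Omega>" and K: "0 < K" "f x K \<le> - T" and u: "K \<le> u"
  shows "T * (u - K) \<le> E_dens f m x u"
proof -
  have "0 < u" using K u by simp
  then obtain \<xi> where \<xi>: "min K u \<le> \<xi>" "E_dens f m x u - E_dens f m x K = - (u - K) * f x \<xi>"
    using E_dens_mvt[OF x K(1), of u] by blast
  have "f x \<xi> \<le> - T" using decreasing[OF x K(1), of \<xi>] \<xi>(1) u K by simp
  then have "(u - K) * f x \<xi> \<le> (u - K) * - T" using u by (intro mult_left_mono) auto
  with \<xi>(2) E_dens_nonneg[OF x less_imp_le[OF K(1)]] show ?thesis by (simp add: algebra_simps)
qed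

text \<open>
  Below \<open>m x\<close> the entropy density is an integral of \<open>f x\<close> over a part of \<open>(0, m x)\<close>, where \<open>g1\<close> is a majorant uniformly in \<open>x\<close>; the
  bound persists at \<open>u = 0\<close>, near which \<open>f x\<close> may be unbounded.
\<close>
lemma E_dens_bounded_below_m:
  obtains C where "0 \<le> C" "\<And>x u. x \<in> closure \<Omega> \<Longrightarrow> 0 \<le> u \<Longrightarrow> u \<le> m x \<Longrightarrow> E_dens f m x u \<le> C"
proof -
  obtain m0 m1 where m01: "\<And>x. x \<in> closure \<Omega> \<Longrightarrow> m0 \<le> m x \<and> m x \<le> m1" using m_bounds by metis
  obtain w where w: "integrable lborel w" "\<And>t. 0 \<le> w t" "AE t in lborel. 0 < t \<and> t \<le> m1 \<longrightarrow> g1 t \<le> w t"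
    using L1_loc_borel_majorant[OF g1] by metis
  show ?thesis
  proof (rule that[of "LINT t|lborel. w t"])
    show "0 \<le> (LINT t|lborel. w t)" using w(2) by simp
    fix x u assume x: "x \<in> closure \<Omega>" and u: "0 \<le> u" "u \<le> m x"
    have "E_dens f m x u = (LINT t|lborel. indicator {u<..<m x} t *\<^sub>R f x t)"
      using u by (rule E_dens_below_m)
    also have "\<dots> \<le> (LINT t|lborel. w t)"
    proof (rule integral_mono_AE'[OF w(1)])
      show "AE t in lborel. indicator {u<..<m x} t *\<^sub>R f x t \<le> w t"
        using f_bound[OF x, unfolded AE_lebesgue_on_greaterThan] w(3)
      proof eventually_elim
        case (elim t)
        show ?case
        proof (cases "t \<in> {u<..<m x}")
          case True
          then have "0 < t" "t \<le> m1" using u m01[OF x] by auto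
          with elim True show ?thesis by auto
        qed (use w(2) in simp)
      qed
    qed (use w(2) in auto)
    finally show "E_dens f m x u \<le> (LINT t|lborel. w t)" .
  qed
qed

text \<open>
  For moderate densities this is the quadratic growth of \<open>E_dens\<close> around \<open>m x\<close>, and \<open>u \<ge> \<delta>\<close>.  Beyond \<open>2 * K\<close> the left-hand side
  is at most \<open>u * u\<close>, while \<open>E_dens\<close> grows at least linearly.
\<close>
lemma deviation_bound:
  assumes \<delta>: "0 < \<delta>" "\<And>x. x \<in> closure \<Omega> \<Longrightarrow> \<delta> \<le> m x" and K: "0 < K" "\<And>x. x \<in> closure \<Omega> \<Longrightarrow> m x \<le> K"
    and T: "0 < T" "\<And>x. x \<in> closure \<Omega> \<Longrightarrow> f x K \<le> - T"
  obtains C where "0 < C"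
    "\<And>x u. x \<in> closure \<Omega> \<Longrightarrow> \<delta> \<le> u \<Longrightarrow> (m x - u)\<^sup>2 \<le> C * u * E_dens f m x u"
proof -
  have \<delta>K: "\<delta> \<le> 2 * K"
  proof -
    obtain x where "x \<in> closure \<Omega>" using dom(4) in_closure by blast
    then show ?thesis using \<delta>(2)[of x] K by force
  qed
  obtain \<kappa> where \<kappa>: "0 < \<kappa>" "\<And>x u v. x \<in> closure \<Omega> \<Longrightarrow> \<delta> \<le> u \<Longrightarrow> u \<le> v \<Longrightarrow> v \<le> 2 * K \<Longrightarrow> \<kappa> * (v - u) \<le> f x u - f x v"
    by (rule uniform_slopes[OF \<delta>(1) \<delta>K]) (rule that; blast)
  show ?thesis
  proof (rule that[of "max (2 / (\<kappa> * \<delta>)) (2 / T)"])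
    show "0 < max (2 / (\<kappa> * \<delta>)) (2 / T)" using \<kappa> \<delta> by (simp add: less_max_iff_disj)
    fix x u assume x: "x \<in> closure \<Omega>" and u: "\<delta> \<le> u"
    have E0: "0 \<le> E_dens f m x u" using E_dens_nonneg[OF x] u \<delta> by simp
    then have uE: "0 \<le> u * E_dens f m x u" using u \<delta> by simp
    show "(m x - u)\<^sup>2 \<le> max (2 / (\<kappa> * \<delta>)) (2 / T) * u * E_dens f m x u"
    proof (cases "u \<le> 2 * K")
      case True
      have "\<kappa> / 2 * (m x - u)\<^sup>2 \<le> E_dens f m x u"
        using E_dens_quadratic_lower[OF x \<delta>(1) u True \<delta>(2)[OF x] _ \<kappa>(2)[OF x]] K(2)[OF x] K(1) by simp
      then have "(m x - u)\<^sup>2 \<le> 2 / \<kappa> * E_dens f m x u" using \<kappa>(1) by (simp add: field_simps)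
      also have "\<dots> = 2 / (\<kappa> * \<delta>) * (\<delta> * E_dens f m x u)" using \<delta> by simp
      also have "\<dots> \<le> 2 / (\<kappa> * \<delta>) * (u * E_dens f m x u)"
        using \<kappa> \<delta> u E0 by (intro mult_left_mono mult_right_mono) auto
      also have "\<dots> \<le> max (2 / (\<kappa> * \<delta>)) (2 / T) * (u * E_dens f m x u)"
        using uE by (intro mult_right_mono) auto
      finally show ?thesis by (simp add: mult.assoc)
    next
      case False
      have "T * (u / 2) \<le> T * (u - K)" using T(1) False by (intro mult_left_mono) auto
      also have "\<dots> \<le> E_dens f m x u" using E_dens_linear_lower[OF x K(1) T(2)[OF x]] False K(1) by simp
      finally have uT: "u \<le> 2 / T * E_dens f m x u" using T(1) by (simp add: field_simps)
      have "(m x - u)\<^sup>2 = (u - m x)\<^sup>2" by (rule power2_commute)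
      also have "\<dots> \<le> u\<^sup>2" using False K(2)[OF x] K(1) m_pos[OF x] by (intro power_mono) auto
      also have "\<dots> = u * u" by (simp add: power2_eq_square)
      also have "\<dots> \<le> u * (2 / T * E_dens f m x u)" using uT False K(1) by (intro mult_left_mono) auto
      also have "u * (2 / T * E_dens f m x u) = 2 / T * (u * E_dens f m x u)" by simp
      also have "\<dots> \<le> max (2 / (\<kappa> * \<delta>)) (2 / T) * (u * E_dens f m x u)"
        using uE by (intro mult_right_mono) auto
      finally show ?thesis using False K(1) by (simp add: mult.assoc)
    qed
  qed
qed

text \<open>
  Young's inequality for \<open>(m x - u) * (f x u - c)\<close>, with weights chosen so that \<open>(m x - u)\<^sup>2\<close> contributes at most half of
  \<open>E_dens\<close>.  The last term integrates to \<open>0\<close> when \<open>u\<close> and \<open>m\<close> have the same mass.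
\<close>
lemma absorbed_entropy_estimate:
  assumes x: "x \<in> closure \<Omega>" and u: "0 < u" and C: "0 < C" "(m x - u)\<^sup>2 \<le> C * u * E_dens f m x u"
  shows "E_dens f m x u / 2 \<le> C / 2 * (u * (f x u - c)\<^sup>2) + c * (m x - u)"
proof -
  have Cu: "C * u > 0" using C u by simp
  have "0 \<le> ((m x - u) - C * u * (f x u - c))\<^sup>2" by simp
  also have "\<dots> = (m x - u)\<^sup>2 - 2 * (C * u) * ((m x - u) * (f x u - c)) + (C * u) * (C * (u * (f x u - c)\<^sup>2))"
    by (simp add: power2_eq_square algebra_simps)
  also have "\<dots> \<le> (C * u) * (E_dens f m x u - 2 * ((m x - u) * (f x u - c)) + C * (u * (f x u - c)\<^sup>2))"
    using C(2) by (simp add: algebra_simps)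
  finally have "0 \<le> E_dens f m x u - 2 * ((m x - u) * (f x u - c)) + C * (u * (f x u - c)\<^sup>2)"
    using Cu by (simp add: zero_le_mult_iff)
  moreover have "E_dens f m x u \<le> (m x - u) * (f x u - c) + c * (m x - u)"
    using E_dens_upper[OF x u] by (simp add: algebra_simps)
  ultimately show ?thesis by simp
qed

end

section \<open>The entropy--entropy production inequality\<close>

context fitness_entropy
begin

definition fisher_part :: "('a \<Rightarrow> real) \<Rightarrow> ennreal" where
  "fisher_part u = (\<integral>\<^sup>+x. (if u x > 0 then ennreal (1 / u x *
         (norm (- weak_grad \<Omega> (\<lambda>y. Phi f y (u y)) x + Phi_x f x (u x) + u x *\<^sub>R f_x f x (u x)))\<^sup>2)
       else 0) \<partial>lebesgue_on \<Omega>)"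

text \<open>
  The superpositions with \<open>u\<close> are replaced by Borel functions of \<open>u1\<close>, the vector \<open>weak_grad\<close> by a Borel representative; as \<open>u\<close> and
  \<open>u1\<close> agree almost everywhere, the integral is unchanged.
\<close>
lemma transition_bound:
  fixes u u1 :: "'a \<Rightarrow> real"
  assumes u1[measurable]: "u1 \<in> borel_measurable borel" and range: "\<And>x. 0 \<le> u1 x" "\<And>x. u1 x \<le> M"
    and rep: "AE x in lborel. x \<in> \<Omega> \<longrightarrow> u1 x = u x"
    and H1: "H1_on \<Omega> (\<lambda>x. Phi f x (u x))"
    and \<delta>: "0 < \<delta>" "\<delta> \<le> R" "R \<le> M" and lev: "e1 < e2"
    and at_\<delta>: "\<And>y. y \<in> \<Omega> \<Longrightarrow> e2 \<le> f y \<delta>" and at_R: "\<And>y. y \<in> \<Omega> \<Longrightarrow> f y R \<le> e1"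
    and S: "S \<in> sets borel"
    and SD: "\<And>x. x \<in> S \<Longrightarrow> x \<in> segment_dom \<Omega> h \<and> u1 x < \<delta> \<and> 0 < u1 (x + h) \<and> f (x + h) (u1 (x + h)) \<le> e1"
  shows "emeasure lborel S \<le> ennreal (R * (norm h)\<^sup>2 / (\<delta> * (e2 - e1))\<^sup>2) * fisher_part u"
proof -
  obtain w where "regular_fitness \<Omega> f w M" using regular_fitness_exists by blast
  then interpret rf: regular_fitness \<Omega> f w M .
  let ?V = "\<lambda>x. Phi f x (u x)"
  define G where "G = weak_grad \<Omega> ?V"
  have L2: "L2_on \<Omega> ?V" and wg: "L2_weak_gradient \<Omega> ?V G"
    using H1 someI_ex[of "L2_weak_gradient \<Omega> ?V"] by (auto simp: H1_on_def G_def weak_grad_def)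
  obtain V1 G1 where V1: "integrable lborel V1" "AE x in lborel. x \<in> \<Omega> \<longrightarrow> V1 x = ?V x"
    and G1: "integrable lborel G1" "AE x in lborel. x \<in> \<Omega> \<longrightarrow> G1 x = G x"
    and weak: "\<And>\<phi> b. test_function \<Omega> \<phi> \<Longrightarrow> b \<in> Basis \<Longrightarrow>
      (LINT x|lborel. V1 x * frechet_derivative \<phi> (at x) b) = - (LINT x|lborel. (G1 x \<bullet> b) * \<phi> x)"
    by (rule weak_gradient_borel_representatives[OF dom(1,3) L2 wg]) (rule that; (assumption | blast))
  have [measurable]: "G1 \<in> borel_measurable borel" "\<Omega> \<in> sets borel" using G1 dom(1) by auto
  define P where "P = (\<lambda>x. indicator (\<Omega> \<times> {0..M}) (x, u1 x) *\<^sub>R Phi_x f x (u1 x))"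
  define X where "X = (\<lambda>x. indicator (\<Omega> \<times> {0<..}) (x, u1 x) *\<^sub>R f_x f x (u1 x))"
  have S1: "\<Omega> \<times> {0..M} \<in> sets borel" "\<Omega> \<times> {0::real<..} \<in> sets borel" by (intro borel_Times; simp)+
  have [measurable]: "P \<in> borel_measurable borel" "X \<in> borel_measurable borel"
    using borel_measurable_superposition[OF rf.Phi_x_continuous S1(1) u1]
      borel_measurable_superposition[OF rf.cont_x S1(2) u1] by (simp_all only: P_def X_def)
  define Q where "Q = (\<lambda>x. if x \<in> \<Omega> \<and> 0 < u1 x then ennreal (1 / u1 x * (norm (- G1 x + P x + u1 x *\<^sub>R X x))\<^sup>2) else 0)"
  have Qm: "Q \<in> borel_measurable borel" unfolding Q_def by measurable
  have "emeasure lborel S \<le> ennreal (R * (norm h)\<^sup>2 / (\<delta> * (e2 - e1))\<^sup>2) * (\<integral>\<^sup>+x. Q x \<partial>lborel)"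
  proof (rule rf.transition_set_measure[OF V1(1) G1(1) weak _ \<delta> lev at_\<delta> at_R Qm _ S SD])
    show "AE x in lborel. x \<in> \<Omega> \<longrightarrow> 0 \<le> u1 x \<and> u1 x \<le> M \<and> V1 x = Phi f x (u1 x)"
      using V1(2) rep
    proof eventually_elim
      case (elim x)
      then show ?case using range[of x] by auto
    qed
    show "AE x in lborel. x \<in> \<Omega> \<longrightarrow> \<delta> \<le> u1 x \<longrightarrow>
      ennreal (1 / u1 x * (norm (- G1 x + Phi_x f x (u1 x) + u1 x *\<^sub>R f_x f x (u1 x)))\<^sup>2) \<le> Q x"
      using \<delta>(1) range by (intro AE_I2) (auto simp: Q_def P_def X_def)
  qed
  also have "(\<integral>\<^sup>+x. Q x \<partial>lborel) = (\<integral>\<^sup>+x. Q x \<partial>lebesgue_on \<Omega>)"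
    by (rule nn_integral_lebesgue_on_borel[symmetric, OF dom(1)]) (simp add: Q_def)
  also have "\<dots> = fisher_part u"
    unfolding fisher_part_def
  proof (rule nn_integral_cong_AE, unfold AE_lebesgue_on_open[OF dom(1)])
    show "AE x in lborel. x \<in> \<Omega> \<longrightarrow> Q x = (if u x > 0 then ennreal (1 / u x *
         (norm (- weak_grad \<Omega> ?V x + Phi_x f x (u x) + u x *\<^sub>R f_x f x (u x)))\<^sup>2) else 0)"
      using G1(2) rep
    proof eventually_elim
      case (elim x)
      show ?case
      proof
        assume x: "x \<in> \<Omega>"
        with elim have e: "G1 x = G x" "u x = u1 x" by auto
        show "Q x = (if u x > 0 then ennreal (1 / u x *
          (norm (- weak_grad \<Omega> ?V x + Phi_x f x (u x) + u x *\<^sub>R f_x f x (u x)))\<^sup>2) else 0)"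
          using x range[of x] by (simp add: Q_def P_def X_def e G_def)
      qed
    qed
  qed
  finally show ?thesis .
qed

text \<open>
  All constants are fixed before \<open>u\<close>.  The slope \<open>T\<close> is so large that the entropy bound leaves at most half of the mass in
  \<open>{u \<ge> 2 * K}\<close>; below the threshold \<open>D0\<close> of the production, \<open>c\<close> lies in \<open>[- 2 * L, e1 / 2]\<close> and \<open>B\<close> has measure at least
  \<open>\<eta>\<close>.  Each of these statements is an inequality for \<open>u\<close> that holds pointwise and is integrated against the masses of \<open>u\<close> and
  \<open>m\<close>.
\<close>
lemma entropy_entropy_production:
  "\<exists>C>0. \<forall>u. Linf_on \<Omega> u \<longrightarrow> prob_density_on \<Omega> u \<longrightarrow> H1_on \<Omega> (\<lambda>x. Phi f x (u x)) \<longrightarrow>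
     rel_entropy \<Omega> f m u \<le> Emax \<longrightarrow> ennreal (rel_entropy \<Omega> f m u) \<le> ennreal C * entropy_production \<Omega> f u"
proof -
  obtain m0 m1 where m0: "0 < m0" and m01: "\<And>x. x \<in> closure \<Omega> \<Longrightarrow> m0 \<le> m x \<and> m x \<le> m1"
    using m_bounds by metis
  obtain x0 where x0: "x0 \<in> \<Omega>" using dom(4) by blast
  have m01': "m0 \<le> m1" using m01[OF in_closure[OF x0]] by simp
  define \<delta> where "\<delta> = m0 / 8"
  have \<delta>: "0 < \<delta>" "\<delta> < m0" "\<And>x. x \<in> closure \<Omega> \<Longrightarrow> \<delta> \<le> m x" using m0 m01 by (force simp: \<delta>_def)+
  define S where "S = \<bar>Emax\<bar> + 1"
  define T where "T = 4 * S"
  have S: "S > 0" "Emax \<le> S" by (auto simp: S_def)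
  then have T: "T > 0" by (simp add: T_def)
  obtain K where K: "1 \<le> K" "m1 \<le> K" "\<And>x. x \<in> closure \<Omega> \<Longrightarrow> f x K \<le> - T"
  proof -
    obtain N where "\<And>u. N \<le> u \<Longrightarrow> \<forall>x\<in>closure \<Omega>. f x u \<le> - T"
      using f_lim[of "- T"] unfolding eventually_at_top_linorder by blast
    then show ?thesis by (intro that[of "max N (max m1 1)"]) auto
  qed
  have K0: "0 < K" using K by simp
  have mK: "\<And>x. x \<in> closure \<Omega> \<Longrightarrow> m x \<le> K" using m01 K by force
  obtain C1 where C1: "0 < C1" "\<And>x u. x \<in> closure \<Omega> \<Longrightarrow> \<delta> \<le> u \<Longrightarrow> (m x - u)\<^sup>2 \<le> C1 * u * E_dens f m x u"
    using deviation_bound[OF \<delta>(1,3) K0 mK T K(3)] by metis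
  obtain C0 where C0: "0 \<le> C0" "\<And>x u. x \<in> closure \<Omega> \<Longrightarrow> 0 \<le> u \<Longrightarrow> u \<le> m x \<Longrightarrow> E_dens f m x u \<le> C0"
    using E_dens_bounded_below_m by metis
  have \<delta>m1: "\<delta> \<le> m1" using \<delta> m01' by simp
  obtain \<kappa>0 where \<kappa>0: "0 < \<kappa>0" "\<And>x u v. x \<in> closure \<Omega> \<Longrightarrow> \<delta> \<le> u \<Longrightarrow> u \<le> v \<Longrightarrow> v \<le> m1 \<Longrightarrow> \<kappa>0 * (v - u) \<le> f x u - f x v"
    by (rule uniform_slopes[OF \<delta>(1) \<delta>m1]) (rule that; blast)
  define e2 where "e2 = \<kappa>0 * (m0 - \<delta>)"
  define e1 where "e1 = e2 / 2"
  have e12: "0 < e1" "e1 < e2" "e2 - e1 = e1" using \<kappa>0 \<delta> by (auto simp: e1_def e2_def)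
  have at_\<delta>: "e2 \<le> f x \<delta>" if x: "x \<in> closure \<Omega>" for x
  proof -
    have "\<kappa>0 * (m0 - \<delta>) \<le> \<kappa>0 * (m x - \<delta>)" using m01[OF x] \<kappa>0 by (intro mult_left_mono) auto
    also have "\<dots> \<le> f x \<delta> - f x (m x)" using m01[OF x] \<delta> x by (intro \<kappa>0) auto
    finally show ?thesis using f_m[OF x] by (simp add: e2_def)
  qed
  have at_R: "f x m1 \<le> e1" if x: "x \<in> closure \<Omega>" for x
    using f_sign(2)[OF x, of m1] m01[OF x] e12 by simp
  have \<delta>2K: "\<delta> \<le> 2 * K" using \<delta>m1 K by simp
  obtain L1 where L1: "0 < L1" "\<And>x u v. x \<in> closure \<Omega> \<Longrightarrow> \<delta> \<le> u \<Longrightarrow> u \<le> v \<Longrightarrow> v \<le> 2 * K \<Longrightarrow> f x u - f x v \<le> L1 * (v - u)"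
    by (rule uniform_slopes[OF \<delta>(1) \<delta>2K]) (rule that; blast)
  define L where "L = L1 * (2 * K)"
  have L0: "0 < L" using L1 K0 by (simp add: L_def)
  have f_lower: "- L \<le> f x u" if x: "x \<in> closure \<Omega>" and u: "0 < u" "u \<le> 2 * K" for x u
  proof -
    have "f x (m x) - f x (2 * K) \<le> L1 * (2 * K - m x)" using x \<delta>(3)[OF x] mK[OF x] K0 by (intro L1(2)) auto
    also have "\<dots> \<le> L" unfolding L_def using L1(1) m_pos[OF x] by (intro mult_left_mono) auto
    finally show ?thesis using f_m[OF x] decreasing[OF x u] by simp
  qed
  define \<kappa> where "\<kappa> = min (m0 - \<delta>) (e1 / (4 * L1))"
  have \<kappa>: "0 < \<kappa>" using \<delta> e12 L1 by (simp add: \<kappa>_def)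
  \<comment> \<open>a fitness above \<open>e1 / 4\<close> keeps the density below \<open>m\<close> by a fixed amount\<close>
  have below_m: "u \<le> m x - \<kappa>" if x: "x \<in> closure \<Omega>" and u: "0 \<le> u" "u = 0 \<or> e1 / 4 < f x u" for x u
  proof (cases "u < \<delta>")
    case True
    have "\<kappa> \<le> m0 - \<delta>" by (simp add: \<kappa>_def)
    then show ?thesis using True m01[OF x] by simp
  next
    case False
    then have fu: "e1 / 4 < f x u" using u \<delta> by auto
    have um: "u < m x" using f_sign(2)[OF x, of u] fu e12 by force
    have "f x u - f x (m x) \<le> L1 * (m x - u)" using x False um mK[OF x] K0 by (intro L1(2)) auto
    with fu f_m[OF x] have "e1 / 4 < L1 * (m x - u)" by simp
    then have "e1 / (4 * L1) \<le> m x - u" using L1(1) by (simp add: field_simps)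
    moreover have "\<kappa> \<le> e1 / (4 * L1)" by (simp add: \<kappa>_def)
    ultimately show ?thesis by simp
  qed
  \<comment> \<open>large densities are paid for by entropy, at a rate proportional to \<open>T\<close>\<close>
  have E_large: "u \<le> 2 / T * E_dens f m x u" if x: "x \<in> closure \<Omega>" and u: "2 * K \<le> u" for x u
  proof -
    have "T * (u / 2) \<le> T * (u - K)" using T u by (intro mult_left_mono) auto
    also have "\<dots> \<le> E_dens f m x u" using u K0 by (intro E_dens_linear_lower x K) auto
    finally show ?thesis using T by (simp add: field_simps)
  qed
  define vol where "vol = measure lborel \<Omega>"
  have borel\<Omega>[measurable]: "\<Omega> \<in> sets borel" using dom(1) by simp
  have vol: "0 < vol"
  proof -
    obtain r where r: "r > 0" "ball x0 r \<subseteq> \<Omega>" by (rule openE[OF dom(1) x0])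
    have "0 < measure lborel (ball x0 r)" using r(1) content_ball_pos by blast
    also have "\<dots> \<le> vol" unfolding vol_def using r(2) dom(3)
      by (intro measure_mono_fmeasurable bounded_borel_fmeasurable) auto
    finally show ?thesis .
  qed
  define D0 where "D0 = min (\<kappa> * vol * e1\<^sup>2 / 32) (min (L\<^sup>2 / 4) (e1\<^sup>2 / 32))"
  have D0: "0 < D0" using \<kappa> vol e12 L0 by (simp add: D0_def)
  define \<eta> where "\<eta> = 1 / (8 * K)"
  have \<eta>: "0 < \<eta>" using K0 by (simp add: \<eta>_def)
  obtain CA where CA: "CA \<ge> 0" "\<And>A B D. transition_controlled \<Omega> A B D \<Longrightarrow> \<eta> \<le> measure lborel B \<Longrightarrow> measure lborel A \<le> CA * D"
    using low_set_bound_domain[OF dom(1,2,3,5) \<eta>] by metis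
  obtain \<rho> where \<rho>: "\<And>x. x \<in> \<Omega> \<Longrightarrow> norm x \<le> \<rho>" using dom(3) bounded_iff by metis
  define c1 where "c1 = 4 / (\<delta> * e1\<^sup>2)"
  define c2 where "c2 = m1 * (2 * \<rho>)\<^sup>2 / (\<delta> * e1)\<^sup>2"
  have c12: "0 \<le> c1" "0 \<le> c2" using \<delta> m0 m01' by (auto simp: c1_def c2_def)
  define C2 where "C2 = C0 / 2 + 2 * L * m1"
  have C2: "0 \<le> C2" using C0 L0 m0 m01' by (simp add: C2_def)
  define C where "C = C1 + 2 * C2 * (CA * (c1 + c2)) + S / D0"
  have Cparts: "0 \<le> 2 * C2 * (CA * (c1 + c2))" "0 < S / D0" using C2 CA(1) c12 S(1) D0 by auto
  then have C: "0 < C" using C1(1) by (simp add: C_def)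
  show ?thesis
  proof (intro exI[of _ C] conjI C allI impI)
    fix u assume Linf: "Linf_on \<Omega> u" and dens: "prob_density_on \<Omega> u"
      and H1: "H1_on \<Omega> (\<lambda>x. Phi f x (u x))" and Emax: "rel_entropy \<Omega> f m u \<le> Emax"
    let ?\<mu> = "lebesgue_on \<Omega>"
    define E where "E = rel_entropy \<Omega> f m u"
    define c where "c = f_bar \<Omega> f u"
    define D1 where "D1 = (\<integral>\<^sup>+x. ennreal (u x * (f x (u x) - c)\<^sup>2) \<partial>?\<mu>)"
    have prod: "entropy_production \<Omega> f u = D1 + fisher_part u"
      by (simp add: entropy_production_def D1_def c_def fisher_part_def)
    show "ennreal E \<le> ennreal C * entropy_production \<Omega> f u"
      unfolding E_def[symmetric]
    \<comment> \<open>if \<open>E_dens f m x (u x)\<close> is not integrable, then \<open>E\<close> is \<open>0\<close> by convention\<close>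
    proof (cases "integrable ?\<mu> (\<lambda>x. E_dens f m x (u x)) \<and> entropy_production \<Omega> f u < \<infinity>")
      case False
      then consider "E = 0" | "entropy_production \<Omega> f u = \<infinity>"
        by (cases "entropy_production \<Omega> f u = \<infinity>")
           (auto simp: E_def rel_entropy_def not_integrable_integral_eq top.not_eq_extremum)
      then show ?thesis using C by cases (auto simp: ennreal_mult_top)
    next
      case True
      then have Eint: "integrable ?\<mu> (\<lambda>x. E_dens f m x (u x))" and fin: "D1 < \<infinity>" "fisher_part u < \<infinity>"
        by (auto simp: prod less_top)
      define d1 d2 where "d1 = enn2real D1" and "d2 = enn2real (fisher_part u)"
      have d: "D1 = ennreal d1" "fisher_part u = ennreal d2" "0 \<le> d1" "0 \<le> d2"
        using fin by (auto simp: d1_def d2_def)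
      have prod_d: "entropy_production \<Omega> f u = ennreal (d1 + d2)"
        using d by (simp add: prod)
      have "E \<le> C * (d1 + d2)"
      proof (cases "d1 + d2 < D0")
        case False
        have "E \<le> S" using Emax S(2) by (simp add: E_def)
        also have "S \<le> S / D0 * (d1 + d2)"
          using mult_left_mono[of D0 "d1 + d2" S] False D0 S(1) by (simp add: field_simps)
        also have "\<dots> \<le> C * (d1 + d2)"
          using d Cparts C1(1) by (intro mult_right_mono) (auto simp: C_def)
        finally show ?thesis .
      next
        case small: True
        then have d1s: "d1 < \<kappa> * vol * e1\<^sup>2 / 16" "d1 < L\<^sup>2 / 2" "d1 \<le> e1\<^sup>2 / 32"
          using d \<kappa> vol e12(1) L0 by (auto simp: D0_def min_less_iff_conj intro: less_le_trans)
        \<comment> \<open>a Borel representative of \<open>u\<close> that satisfies the bounds everywhere\<close>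
        obtain M0 where M0: "AE x in ?\<mu>. \<bar>u x\<bar> \<le> M0" and um: "u \<in> borel_measurable ?\<mu>"
          using Linf by (auto simp: Linf_on_def)
        define M where "M = max M0 m1"
        have Mpos: "m1 \<le> M" "0 \<le> M" using m0 m01' by (auto simp: M_def)
        obtain v where v: "v \<in> borel_measurable borel" "AE x in lborel. x \<in> \<Omega> \<longrightarrow> v x = u x"
          using borel_representative_real[OF dom(1) um] by metis
        define u1 where "u1 = (\<lambda>x. indicator \<Omega> x * max 0 (min M (v x)))"
        have [measurable]: "u1 \<in> borel_measurable borel" unfolding u1_def using v(1) by measurable
        have range: "\<And>x. 0 \<le> u1 x" "\<And>x. u1 x \<le> M" "\<And>x. x \<notin> \<Omega> \<Longrightarrow> u1 x = 0"
          using Mpos by (auto simp: u1_def indicator_def)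
        have u0: "AE x in ?\<mu>. 0 \<le> u x" and ui: "integrable ?\<mu> u" "(LINT x|?\<mu>. u x) = 1"
          using dens by (auto simp: prob_density_on_def)
        have mi: "integrable ?\<mu> m" "(LINT x|?\<mu>. m x) = 1"
          using m_density by (auto simp: prob_density_on_def)
        have rep: "AE x in lborel. x \<in> \<Omega> \<longrightarrow> u1 x = u x"
          using v(2) M0[unfolded AE_lebesgue_on_open[OF dom(1)]] u0[unfolded AE_lebesgue_on_open[OF dom(1)]]
        proof eventually_elim
          case (elim x)
          show ?case
          proof
            assume "x \<in> \<Omega>"
            with elim have "v x = u x" "0 \<le> u x" "u x \<le> M" by (auto simp: M_def)
            with \<open>x \<in> \<Omega>\<close> show "u1 x = u x" by (simp add: u1_def)
          qed
        qed
        have ae: "AE x in ?\<mu>. x \<in> \<Omega> \<and> u x = u1 x"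
          unfolding AE_lebesgue_on_open[OF dom(1)] using rep by eventually_elim auto
        define hf where "hf = (\<lambda>x. indicator (\<Omega> \<times> {0<..}) (x, u1 x) *\<^sub>R f x (u1 x))"
        have sub: "\<Omega> \<times> {0::real<..} \<subseteq> closure \<Omega> \<times> {0<..}" using closure_subset by auto
        have [measurable]: "hf \<in> borel_measurable borel"
          unfolding hf_def
        proof (rule borel_measurable_superposition)
          show "continuous_on (\<Omega> \<times> {0<..}) (\<lambda>(x, u). f x u)" by (rule continuous_on_subset[OF cont_closure sub])
          show "\<Omega> \<times> {0::real<..} \<in> sets borel" by (intro borel_Times; simp)
        qed simp
        define q where "q = (\<lambda>x. u1 x * (hf x - c)\<^sup>2)"
        have qm: "q \<in> borel_measurable borel" unfolding q_def by measurable
        have q_eq: "q x = u1 x * (f x (u1 x) - c)\<^sup>2" if "x \<in> \<Omega>" for x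
          using range(1)[of x] that by (cases "u1 x = 0") (auto simp: q_def hf_def)
        have q0: "0 \<le> q x" for x using range by (simp add: q_def)
        have D1q: "D1 = (\<integral>\<^sup>+x. ennreal (q x) \<partial>?\<mu>)"
          unfolding D1_def by (rule nn_integral_cong_AE) (use ae in \<open>eventually_elim, auto simp: q_eq\<close>)
        have qi: "integrable ?\<mu> q"
          using fin(1) q0 borel_measurable_lebesgue_on[OF qm] unfolding D1q
          by (auto simp: integrable_iff_bounded)
        have qd: "(LINT x|?\<mu>. q x) = d1"
          using integral_eq_nn_integral[OF borel_measurable_lebesgue_on[OF qm]] q0 by (simp add: d1_def D1q)
        note ind = indicator_lebesgue_on[OF dom(1,3)]
        have indO: "integrable ?\<mu> (indicator \<Omega> :: 'a \<Rightarrow> real)" "(LINT x|?\<mu>. indicator \<Omega> x) = vol"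
          using ind[of \<Omega>] by (auto simp: vol_def)
        have EE: "(LINT x|?\<mu>. E_dens f m x (u x)) \<le> S" using Emax S(2) by (simp add: rel_entropy_def)
        have ET: "2 / T * (LINT x|?\<mu>. E_dens f m x (u x)) \<le> 1 / 2"
        proof -
          have "2 / T * (LINT x|?\<mu>. E_dens f m x (u x)) \<le> 2 / T * S" using EE T by (intro mult_left_mono) auto
          also have "\<dots> = 1 / 2" using S(1) by (simp add: T_def)
          finally show ?thesis .
        qed
        \<comment> \<open>otherwise \<open>u \<le> m - \<kappa>\<close> up to a multiple of \<open>q\<close>, and \<open>u\<close> would have too little mass\<close>
        have c_le: "c \<le> e1 / 2"
        proof (rule ccontr)
          assume cc: "\<not> c \<le> e1 / 2"
          have "(LINT x|?\<mu>. u x) \<le> (LINT x|?\<mu>. (m x - \<kappa> * indicator \<Omega> x) + 16 / e1\<^sup>2 * q x)"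
          proof (rule integral_mono_AE[OF ui(1)])
            show "AE x in ?\<mu>. u x \<le> (m x - \<kappa> * indicator \<Omega> x) + 16 / e1\<^sup>2 * q x"
              using ae
            proof eventually_elim
              case (elim x)
              then have x: "x \<in> \<Omega>" "x \<in> closure \<Omega>" and e: "u x = u1 x" using in_closure by auto
              have nn: "0 \<le> 16 / e1\<^sup>2 * q x" using q0 by simp
              show ?case
              proof (cases "u1 x = 0 \<or> e1 / 4 < f x (u1 x)")
                case True
                then show ?thesis using below_m[OF x(2) range(1) True] nn x e by simp
              next
                case False
                have "\<kappa> \<le> m x" using below_m[OF x(2), of 0] by simp
                have "(e1 / 4)\<^sup>2 \<le> (c - f x (u1 x))\<^sup>2" using False cc e12 by (intro power_mono) auto
                then have "e1\<^sup>2 / 16 \<le> (f x (u1 x) - c)\<^sup>2" by (simp add: power_divide power2_commute)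
                then have "u1 x * (e1\<^sup>2 / 16) \<le> q x" unfolding q_eq[OF x(1)] using range by (intro mult_left_mono) auto
                then have "u1 x \<le> 16 / e1\<^sup>2 * q x" using e12 by (simp add: field_simps)
                then show ?thesis using \<open>\<kappa> \<le> m x\<close> x e by simp
              qed
            qed
          qed (use mi qi indO in auto)
          also have "\<dots> = 1 - \<kappa> * vol + 16 / e1\<^sup>2 * d1"
            using mi qi indO qd by simp
          finally have "\<kappa> * vol \<le> 16 / e1\<^sup>2 * d1" using ui by simp
          then show False using d1s(1) e12 by (simp add: field_simps)
        qed
        \<comment> \<open>otherwise \<open>q\<close> dominates \<open>L\<^sup>2 * u\<close> where \<open>u \<le> 2 * K\<close>, and this region carries half of the mass\<close>
        have c_ge: "- 2 * L \<le> c"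
        proof (rule ccontr)
          assume cc: "\<not> - 2 * L \<le> c"
          have "(LINT x|?\<mu>. u x) \<le> (LINT x|?\<mu>. 1 / L\<^sup>2 * q x + 2 / T * E_dens f m x (u x))"
          proof (rule integral_mono_AE[OF ui(1)])
            show "AE x in ?\<mu>. u x \<le> 1 / L\<^sup>2 * q x + 2 / T * E_dens f m x (u x)"
              using ae
            proof eventually_elim
              case (elim x)
              then have x: "x \<in> \<Omega>" "x \<in> closure \<Omega>" and e: "u x = u1 x" using in_closure by auto
              have nn: "0 \<le> 1 / L\<^sup>2 * q x" using q0 by simp
              have nE: "0 \<le> 2 / T * E_dens f m x (u1 x)" using E_dens_nonneg[OF x(2) range(1)] T by simp
              show ?case
              proof (cases "u1 x \<le> 2 * K")
                case False
                then show ?thesis using E_large[OF x(2), of "u1 x"] nn e by simp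
              next
                case True
                have "u1 x \<le> 1 / L\<^sup>2 * q x"
                proof (cases "u1 x = 0")
                  case False
                  then have "0 < u1 x" using range(1)[of x] by simp
                  then have "L \<le> f x (u1 x) - c" using f_lower[OF x(2) _ True] cc by simp
                  then have "L\<^sup>2 \<le> (f x (u1 x) - c)\<^sup>2" using L0 by (intro power_mono) auto
                  then have "u1 x * L\<^sup>2 \<le> q x" unfolding q_eq[OF x(1)] using range by (intro mult_left_mono) auto
                  then show ?thesis using L0 by (simp add: field_simps)
                qed (use nn in simp)
                then show ?thesis using nE e by simp
              qed
            qed
          qed (use qi Eint in auto)
          also have "\<dots> = 1 / L\<^sup>2 * d1 + 2 / T * (LINT x|?\<mu>. E_dens f m x (u x))"
            using qi Eint qd by simp
          finally have "1 / 2 \<le> 1 / L\<^sup>2 * d1" using ui(2) ET by linarith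
          then show False using d1s(2) L0 by (simp add: field_simps)
        qed
        define A where "A = {x \<in> \<Omega>. u1 x < \<delta>}"
        define B where "B = {x \<in> \<Omega>. \<delta> \<le> u1 x \<and> hf x \<le> e1}"
        have sets: "A \<in> sets borel" "B \<in> sets borel" "A \<subseteq> \<Omega>" "B \<subseteq> \<Omega>" "\<Omega> - (A \<union> B) \<in> sets borel"
          by (auto simp: A_def B_def)
        have hf_eq: "hf x = f x (u1 x)" if "x \<in> \<Omega>" "\<delta> \<le> u1 x" for x using that \<delta>(1) by (simp add: hf_def)
        \<comment> \<open>off \<open>A \<union> B\<close> the fitness exceeds \<open>e1\<close>, while \<open>c \<le> e1 / 2\<close>\<close>
        have off: "u1 x * (e1 / 2)\<^sup>2 \<le> q x" if "x \<in> \<Omega> - (A \<union> B)" for x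
        proof -
          have x: "x \<in> \<Omega>" "\<delta> \<le> u1 x" "e1 < f x (u1 x)" using that hf_eq by (auto simp: A_def B_def)
          then have "(e1 / 2)\<^sup>2 \<le> (f x (u1 x) - c)\<^sup>2" using c_le e12 by (intro power_mono) auto
          then show ?thesis unfolding q_eq[OF x(1)] using range by (intro mult_left_mono) auto
        qed
        \<comment> \<open>of the unit mass, \<open>A\<close> carries at most \<open>1 / 8\<close>, the region \<open>u \<ge> 2 * K\<close> at most \<open>1 / 2\<close>, and the set outside
          \<open>A \<union> B\<close> at most \<open>1 / 8\<close>; the rest lies in \<open>B\<close>, where \<open>u \<le> 2 * K\<close>\<close>
        have B_large: "\<eta> \<le> measure lborel B"
        proof -
          have "(LINT x|?\<mu>. u x) \<le> (LINT x|?\<mu>. \<delta> * indicator \<Omega> x + 2 * K * indicator B x + 4 / e1\<^sup>2 * q x + 2 / T * E_dens f m x (u x))"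
          proof (rule integral_mono_AE[OF ui(1)])
            show "AE x in ?\<mu>. u x \<le> \<delta> * indicator \<Omega> x + 2 * K * indicator B x + 4 / e1\<^sup>2 * q x + 2 / T * E_dens f m x (u x)"
              using ae
            proof eventually_elim
              case (elim x)
              then have x: "x \<in> \<Omega>" "x \<in> closure \<Omega>" and e: "u x = u1 x" using in_closure by auto
              have nn: "0 \<le> 4 / e1\<^sup>2 * q x" using q0 by simp
              have nE: "0 \<le> 2 / T * E_dens f m x (u1 x)" using E_dens_nonneg[OF x(2) range(1)] T by simp
              have nB: "0 \<le> 2 * K * indicator B x" using K0 by simp
              consider "x \<in> A" | "x \<in> B" "u1 x \<le> 2 * K" | "2 * K \<le> u1 x" | "x \<in> \<Omega> - (A \<union> B)" using x by fastforce
              then show ?case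
              proof cases
                case 1 then show ?thesis using nn nE nB e x by (simp add: A_def)
              next
                case 2 then show ?thesis using nn nE e x \<delta>(1) by simp
              next
                case 3 then show ?thesis using E_large[OF x(2)] nn nB e x \<delta>(1) by (simp add: add_increasing)
              next
                case 4
                then have "u1 x \<le> 4 / e1\<^sup>2 * q x" using off[OF 4] e12 by (simp add: field_simps power_divide)
                then show ?thesis using nE nB e x \<delta>(1) by simp
              qed
            qed
          qed (use qi Eint indO ind(1)[OF sets(2,4)] in auto)
          also have "\<dots> = \<delta> * vol + 2 * K * measure lborel B + 4 / e1\<^sup>2 * d1 + 2 / T * (LINT x|?\<mu>. E_dens f m x (u x))"
            using qi Eint qd indO ind[OF sets(2,4)] by simp
          finally have "1 \<le> \<delta> * vol + 2 * K * measure lborel B + 4 / e1\<^sup>2 * d1 + 1 / 2"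
            using ui(2) ET by linarith
          moreover have "\<delta> * vol \<le> 1 / 8"
          proof -
            have "(LINT x|?\<mu>. m0 * indicator \<Omega> x) \<le> (LINT x|?\<mu>. m x)"
            proof (rule integral_mono_AE)
              show "AE x in ?\<mu>. m0 * indicator \<Omega> x \<le> m x"
                using ae by eventually_elim (use m01 in_closure in auto)
            qed (use indO mi in auto)
            then show ?thesis using indO mi by (simp add: \<delta>_def)
          qed
          moreover have "4 / e1\<^sup>2 * d1 \<le> 1 / 8"
            using d1s(3) e12 by (simp add: field_simps)
          ultimately have "1 / 4 \<le> 2 * K * measure lborel B" by simp
          then show ?thesis using K0 by (simp add: \<eta>_def field_simps)
        qed
        have middle: "measure lborel (\<Omega> - (A \<union> B)) \<le> c1 * d1"
        proof -
          have "(LINT x|?\<mu>. \<delta> * (e1 / 2)\<^sup>2 * indicator (\<Omega> - (A \<union> B)) x) \<le> (LINT x|?\<mu>. q x)"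
          proof (rule integral_mono)
            fix x
            show "\<delta> * (e1 / 2)\<^sup>2 * indicator (\<Omega> - (A \<union> B)) x \<le> q x"
            proof (cases "x \<in> \<Omega> - (A \<union> B)")
              case True
              then have "\<delta> * (e1 / 2)\<^sup>2 \<le> u1 x * (e1 / 2)\<^sup>2" by (intro mult_right_mono) (auto simp: A_def)
              with off[OF True] True show ?thesis by simp
            qed (use q0 in simp)
          qed (use qi ind(1)[OF sets(5)] in auto)
          then have "\<delta> * (e1 / 2)\<^sup>2 * measure lborel (\<Omega> - (A \<union> B)) \<le> d1"
            using qd ind[OF sets(5)] by (simp add: Diff_subset)
          then show ?thesis using \<delta> e12 by (simp add: c1_def field_simps power_divide)
        qed
        have trans: "measure lborel {x \<in> A. x \<in> segment_dom \<Omega> h \<and> x + h \<in> B} \<le> c2 * d2" for h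
        proof (cases "{x \<in> A. x \<in> segment_dom \<Omega> h \<and> x + h \<in> B} = {}")
          case True
          then have "measure lborel {x \<in> A. x \<in> segment_dom \<Omega> h \<and> x + h \<in> B} = 0" by (metis measure_empty)
          then show ?thesis using c12 d by simp
        next
          case False
          then obtain y where "y \<in> \<Omega>" "y + h \<in> \<Omega>" using sets by blast
          then have "norm h \<le> 2 * \<rho>"
            using \<rho>[of y] \<rho>[of "y + h"] norm_triangle_ineq4[of "y + h" y] by simp
          then have h2: "(norm h)\<^sup>2 \<le> (2 * \<rho>)\<^sup>2" by (intro power_mono) auto
          have [measurable]: "A \<in> sets borel" "B \<in> sets borel" using sets by auto
          have [measurable]: "segment_dom \<Omega> h \<in> sets borel" by (rule borel_open[OF open_segment_dom[OF dom(1)]])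
          have "emeasure lborel {x \<in> A. x \<in> segment_dom \<Omega> h \<and> x + h \<in> B} \<le>
            ennreal (m1 * (norm h)\<^sup>2 / (\<delta> * (e2 - e1))\<^sup>2) * fisher_part u"
          proof (rule transition_bound[of u1 M u \<delta> m1 e1 e2])
            show "e2 \<le> f y \<delta>" "f y m1 \<le> e1" if "y \<in> \<Omega>" for y
              using at_\<delta> at_R in_closure[OF that] by auto
            show "x \<in> segment_dom \<Omega> h \<and> u1 x < \<delta> \<and> 0 < u1 (x + h) \<and> f (x + h) (u1 (x + h)) \<le> e1"
              if "x \<in> {x \<in> A. x \<in> segment_dom \<Omega> h \<and> x + h \<in> B}" for x
              using that hf_eq[of "x + h"] \<delta>(1) by (auto simp: A_def B_def)
          qed (use range rep H1 \<delta>(1) \<delta>m1 Mpos e12 in auto)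
          also have "\<dots> \<le> ennreal c2 * fisher_part u"
            using h2 m0 m01' unfolding c2_def e12(3)
            by (intro mult_right_mono ennreal_leI divide_right_mono mult_left_mono) auto
          also have "\<dots> = ennreal (c2 * d2)" using d c12 by (simp add: ennreal_mult)
          finally show ?thesis unfolding measure_def using c12 d by (intro enn2real_leI) auto
        qed
        have "transition_controlled \<Omega> A B ((c1 + c2) * (d1 + d2))"
          unfolding transition_controlled_def
        proof (intro conjI allI)
          have "c1 * d1 \<le> (c1 + c2) * (d1 + d2)" "c2 * d2 \<le> (c1 + c2) * (d1 + d2)"
            using c12 d by (auto intro!: mult_mono)
          then show "measure lborel (\<Omega> - (A \<union> B)) \<le> (c1 + c2) * (d1 + d2)"
            "measure lborel {x \<in> A. x \<in> segment_dom \<Omega> h \<and> x + h \<in> B} \<le> (c1 + c2) * (d1 + d2)" for h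
            using middle trans[of h] by auto
        qed (use sets c12 d in auto)
        then have A_small: "measure lborel A \<le> CA * ((c1 + c2) * (d1 + d2))"
          using CA(2) B_large by blast
        have "(LINT x|?\<mu>. 1 / 2 * E_dens f m x (u x)) \<le> (LINT x|?\<mu>. C1 / 2 * q x + C2 * indicator A x + c * (m x - u x))"
        proof (rule integral_mono_AE)
          show "AE x in ?\<mu>. 1 / 2 * E_dens f m x (u x) \<le> C1 / 2 * q x + C2 * indicator A x + c * (m x - u x)"
            using ae
          proof eventually_elim
            case (elim x)
            then have x: "x \<in> \<Omega>" "x \<in> closure \<Omega>" and e: "u x = u1 x" using in_closure by auto
            show ?case
            proof (cases "u1 x < \<delta>")
              case False
              then have "E_dens f m x (u1 x) / 2 \<le> C1 / 2 * q x + c * (m x - u1 x)"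
                unfolding q_eq[OF x(1)] using \<delta>(1) C1 x(2) by (intro absorbed_entropy_estimate) auto
              moreover have "x \<notin> A" using False by (simp add: A_def)
              ultimately show ?thesis using e by simp
            next
              case True
              have um: "0 \<le> m x - u1 x" "m x - u1 x \<le> m1" using True \<delta>(3)[OF x(2)] m01[OF x(2)] range(1)[of x] by auto
              have "- (2 * L * m1) \<le> c * (m x - u1 x)"
              proof -
                have "2 * L * (m x - u1 x) \<le> 2 * L * m1" using um L0 by (intro mult_left_mono) auto
                moreover have "- 2 * L * (m x - u1 x) \<le> c * (m x - u1 x)" using um c_ge by (intro mult_right_mono) auto
                ultimately show ?thesis by simp
              qed
              moreover have "E_dens f m x (u1 x) \<le> C0" using C0(2)[OF x(2) range(1)] um by simp
              moreover have "0 \<le> C1 / 2 * q x" using C1 q0 by simp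
              moreover have "indicator A x = (1 :: real)" using True x by (simp add: A_def)
              ultimately show ?thesis using e by (simp add: C2_def)
            qed
          qed
        qed (use qi Eint ui mi ind(1)[OF sets(1,3)] in auto)
        also have "\<dots> = C1 / 2 * d1 + C2 * measure lborel A"
          using qi qd ui mi ind[OF sets(1,3)] by simp
        finally have "E \<le> C1 * d1 + 2 * C2 * measure lborel A"
          by (simp add: E_def rel_entropy_def)
        also have "\<dots> \<le> C1 * (d1 + d2) + 2 * C2 * (CA * ((c1 + c2) * (d1 + d2)))"
          using C1(1) C2 d A_small by (intro add_mono mult_left_mono) auto
        also have "\<dots> \<le> C * (d1 + d2)"
        proof -
          have "0 \<le> S / D0 * (d1 + d2)" using Cparts(2) d by (intro mult_nonneg_nonneg) auto
          moreover have "C * (d1 + d2) = C1 * (d1 + d2) + 2 * C2 * (CA * ((c1 + c2) * (d1 + d2))) + S / D0 * (d1 + d2)"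
            by (simp only: C_def distrib_right mult.assoc)
          ultimately show ?thesis by linarith
        qed
        finally show ?thesis .
      qed
      then have "ennreal E \<le> ennreal (C * (d1 + d2))" by (rule ennreal_leI)
      also have "\<dots> = ennreal C * entropy_production \<Omega> f u"
        using C d by (simp add: prod_d ennreal_mult)
      finally show ?thesis .
    qed
  qed
qed

end

theorem theorem3p8:
  fixes \<Omega> :: "'a::euclidean_space set"
    and f :: "'a \<Rightarrow> real \<Rightarrow> real"
    and m :: "'a \<Rightarrow> real"
    and g1 g2 :: "real \<Rightarrow> real"
    and U :: "('a \<Rightarrow> real) set"
  assumes "open \<Omega>" "connected \<Omega>" "bounded \<Omega>" "\<Omega> \<noteq> {}" "Ck_boundary 1 \<Omega>"
    and f_C2: "Ck_closed 2 (\<Omega> \<times> {0<..}) (closure \<Omega> \<times> {0<..}) (\<lambda>(x, u). f x u)"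
    and f_L1loc: "L1_loc (closure \<Omega> \<times> {0..}) (\<lambda>(x, u). f x u)"
    and uf_cont: "extends_continuously (closure \<Omega> \<times> {0<..}) (closure \<Omega> \<times> {0..})
                    (\<lambda>(x, u). u * f x u)"
    and ufx_cont: "extends_continuously (\<Omega> \<times> {0<..}) (closure \<Omega> \<times> {0..})
                    (\<lambda>(x, u). u *\<^sub>R f_x f x u)"
    and fu_neg: "\<And>x u. x \<in> closure \<Omega> \<Longrightarrow> 0 < u \<Longrightarrow> f_u f x u < 0"
    and g1: "L1_loc {0..} g1"
    and f_bound: "\<And>x. x \<in> closure \<Omega> \<Longrightarrow> AE u in lebesgue_on {0<..}. \<bar>f x u\<bar> \<le> g1 u"
    and g2: "L1_loc {0..} g2"
    and fu_fxu_bound: "\<And>x. x \<in> \<Omega> \<Longrightarrow> AE u in lebesgue_on {0<..}.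
                         u * \<bar>f_u f x u\<bar> + u * norm (f_xu f x u) \<le> g2 u"
    and m_C2: "Ck_closed 2 \<Omega> (closure \<Omega>) m"
    and m_pos: "\<And>x. x \<in> closure \<Omega> \<Longrightarrow> 0 < m x"
    and m_density: "prob_density_on \<Omega> m"
    and f_m: "\<And>x. x \<in> closure \<Omega> \<Longrightarrow> f x (m x) = 0"
    and f_lim: "\<And>K. \<forall>\<^sub>F u in at_top. \<forall>x\<in>closure \<Omega>. f x u \<le> K"
    and U_Linf: "\<And>u. u \<in> U \<Longrightarrow> Linf_on \<Omega> u"
    and U_density: "\<And>u. u \<in> U \<Longrightarrow> prob_density_on \<Omega> u"
    and U_H1: "\<And>u. u \<in> U \<Longrightarrow> H1_on \<Omega> (\<lambda>x. Phi f x (u x))"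
    and U_entropy: "bdd_above (rel_entropy \<Omega> f m ` U)"
  shows "\<exists>C>0. \<forall>u\<in>U. ennreal (rel_entropy \<Omega> f m u) \<le> ennreal C * entropy_production \<Omega> f u"
proof -
  interpret fitness_entropy \<Omega> f m g1 g2
    by unfold_locales fact+
  obtain Emax where "\<And>u. u \<in> U \<Longrightarrow> rel_entropy \<Omega> f m u \<le> Emax"
    using U_entropy by (auto simp: bdd_above_def)
  with entropy_entropy_production[of Emax] U_Linf U_density U_H1 show ?thesis by blast
qed

end
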